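(* Suppose $m>n+1$ and $(F,G,B):\mathbb R^{n+1}\to gl_*(n+1)\times\mathcal M_{(m-n-1)\times(n+1)}\times O(n,1)$ is a solution of the $G^1_{m,n}$-system II. Let $F=(f_{ij})$, $G=(g_{ij})$, $B=(b_{ij})$. Then: (i) $$\omega=\sum_{i=1}^{n+1}\begin{pmatrix}-FC_i+C_iF^t&C_iG^t\\-GC_i&0\end{pmatrix}dx_i$$ is a flat $o(m)$-valued connection 1-form. Hence there exists $A:\mathbb R^{n+1}\to O(m)$ such that $A^{-1}dA=\omega$. (ii) Let $A=(A_1,A_2)$ with $A_1\in\mathcal M_{m\times(n+1)}$. Then $\sum_{i=1}^{n+1}A_1C_iJB^{-1}dx_i$ is exact, so there exists a map $X:\mathbb R^{n+1}\to\mathcal M_{m\times(n+1)}$ such that $$dX=-\sum_{i=1}^{n+1}A_1C_iB^tJ\,dx_i .$$ (iii) Suppose all the entries of the $j$-th row of $B$ are non-zero. Let $X_j:\mathbb R^{n+1}\to\mathbb R^m$ denote the $j$-th column of $X$, and $e_i$ the $i$-th column of $A$. Then $(X_1,\dots,X_{n+1})$ is an $(n+1)$-tuple in $\mathbb R^m$ of type $O(n,1)$, and the two fundamental forms for the immersion $X_j$ are $$I_j=\sum_{i=1}^{n+1}b_{ji}^2\,dx_i^2,\qquad II_j=-\sum_{i=1}^{n+1}\sum_{k=1}^{m-n-1}g_{ki}b_{ji}\,dx_i^2\,e_{n+k+1}.\qquad(1)$$ (iv) Conversely, suppose $(X_1,\dots,X_{n+1})$ is an $(n+1)$-tuple in $\mathbb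 R^m$ of type $O(n,1)$ such that the two fundamental forms are of the form (1) with respect to a common parallel normal frame $e_{n+2},\dots,e_m$ for some $B=(b_{ij})$ and $G=(g_{ij})$. Then $(F,G,B)$ is a solution of the $G^1_{m,n}$-system II, where $F=(f_{ij})\in gl_*(n+1)$ with $f_{ij}=(b_{1j})_{x_i}/b_{1i}$ for $i\ne j$.
   Context: $J=I_{n,1}=\mathrm{diag}(1,\dots,1,-1)$ of size $n+1$; $O(n,1)=\{B:B^tJB=J\}$; $\mathcal M_{p\times q}$: real $p\times q$ matrices; $gl_*(n+1)$: real $(n+1)\times(n+1)$ matrices with zero diagonal; $C_i$: the $(n+1)\times(n+1)$ matrix whose only non-zero entry is a $1$ at $(i,i)$. Flat: $d\omega+\omega\wedge\omega=0$. The $G^1_{m,n}$-system II is: $(f_{ij})_{x_i}+(f_{ji})_{x_j}+\sum_{k=1}^{n+1}f_{ki}f_{kj}+\sum_{k=1}^{m-n-1}g_{ki}g_{kj}=0$ if $i\ne j$; $(f_{ij})_{x_k}=f_{ik}f_{kj}$ if $i,j,k$ are distinct; $(b_{ij})_{x_k}=f_{kj}b_{ik}$ if $j\ne k$; $(g_{ij})_{x_k}=f_{kj}g_{ik}$ if $j\ne k$. $(n+1)$-tuple of type $O(n,1)$: let $m>n+1$, $\mathcal O$ a domain in $\mathbb R^{n+1}$, and $X_i:\mathcal O\to\mathbb R^m$ an immersion with flat and non-degenerate normal bundle for $1\le i\le n+1$. $(X_1,\dots,X_{n+1})$ is an $(n+1)$-tuple in $\mathbb R^m$ of type $O(n,1)$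 if (a) the normal planes of $X_i(x)$ and $X_j(x)$ are parallel for all $i,j$ and $x\in\mathcal O$; (b) there exists a common parallel normal frame $\{e_\alpha\}_{\alpha=n+2}^m$; (c) $x\in\mathcal O$ is a hyperbolic line of curvature coordinate system with respect to $\{e_\alpha\}$ for each $X_j$, such that the fundamental forms of $X_j$ are $I_j=\sum_i\beta_{ji}^2dx_i^2$, $II_j=\sum_{i,k}\beta_{ji}\gamma_{ki}dx_i^2e_{n+1+k}$ for some $O(n,1)$-valued map $(\beta_{ij})$ and $\mathcal M_{(m-n-1)\times(n+1)}$-valued map $(\gamma_{ij})$. The normal bundle of an $(n+1)$-dimensional submanifold is non-degenerate if at each point the space of shape operators $\{A_v:v\text{ normal}\}$ has dimension $n+1$. Line of curvature coordinates with respect to an orthonormal parallel normal frame are coordinates with $I=\sum_ia_i^2dx_i^2$ and $II=\sum_{i,j}c_{ji}dx_i^2e_{n+1+j}$; hyperbolic means in addition $a_1^2+\dots+a_n^2-a_{n+1}^2=\pm1$. Convention: with $\omega_i=\langle dX,e_i\rangle$, $\omega_{i\alpha}=\langle e_i,de_\alpha\rangle$, $I=\sum\omega_i^2$ and $II=\sum_{i,\alpha}\omega_{i\alpha}\omega_ie_\alpha$.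
   Formalization: In (iii), II_j carries the extra factor J_jj (opposite sign for j=n+1, where the printed sign is false), and the full tuple property is stated when rank G = n+1 everywhere, which non-degeneracy requires (it fails for G=0); all other tuple clauses hold without this. *)

theory Defs
  imports "HOL-Analysis.Analysis"
begin

text \<open>
  The index type \<open>'n\<close> (finite, linearly ordered) plays the role of \<open>{1, \<dots>, n+1}\<close>: its least
  element is the index 1, its greatest element is the index \<open>n+1\<close>, and \<open>CARD('n) = n+1\<close>.
  The index type \<open>'k\<close> plays the role of \<open>{1, \<dots>, m-n-1}\<close>, and \<open>'n + 'k\<close> that of \<open>{1, \<dots>, m}\<close>,
  with \<open>Inl i\<close> for \<open>i \<le> n+1\<close> and \<open>Inr k\<close> for \<open>n+1+k\<close>. Types are nonempty, so \<open>m > n+1\<close>.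
\<close>

definition first_idx :: "'n::{finite,linorder}" where
  "first_idx = Min UNIV"

definition last_idx :: "'n::{finite,linorder}" where
  "last_idx = Max UNIV"


subsection \<open>Calculus\<close>

definition partial :: "'n::finite \<Rightarrow> (real^'n \<Rightarrow> 'b::real_normed_vector) \<Rightarrow> real^'n \<Rightarrow> 'b" where
  "partial i f x = frechet_derivative f (at x) (axis i 1)"

primrec Ck_on :: "nat \<Rightarrow> (real^'n) set \<Rightarrow> (real^'n \<Rightarrow> 'b::real_normed_vector) \<Rightarrow> bool" where
  "Ck_on 0 S f \<longleftrightarrow> continuous_on S f"
| "Ck_on (Suc r) S f \<longleftrightarrow> (\<forall>x\<in>S. f differentiable (at x)) \<and> (\<forall>i. Ck_on r S (partial i f))"

text \<open>Only used on open sets.\<close>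

definition smooth_on :: "(real^'n) set \<Rightarrow> (real^'n \<Rightarrow> 'b::real_normed_vector) \<Rightarrow> bool" where
  "smooth_on S f \<longleftrightarrow> (\<forall>r. Ck_on r S f)"

definition is_domain :: "(real^'n) set \<Rightarrow> bool" where
  "is_domain S \<longleftrightarrow> open S \<and> connected S \<and> S \<noteq> {}"

text \<open>
  A (vector- or matrix-valued) 1-form is a map \<open>\<theta>\<close> sending a point \<open>x\<close> and a tangent vector \<open>v\<close>
  to a value linear in \<open>v\<close>; thus \<open>\<Sum>\<^sub>i \<Theta>\<^sub>i dx\<^sub>i\<close> is \<open>\<lambda>x v. \<Sum>\<^sub>i v\<^sub>i \<Theta>\<^sub>i(x)\<close>. Two-forms take two
  tangent vectors.
\<close>

definition smooth_1form_on ::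
    "(real^'n) set \<Rightarrow> (real^'n \<Rightarrow> real^'n \<Rightarrow> 'b::real_normed_vector) \<Rightarrow> bool" where
  "smooth_1form_on S \<theta> \<longleftrightarrow> (\<forall>x\<in>S. linear (\<theta> x)) \<and> (\<forall>v. smooth_on S (\<lambda>x. \<theta> x v))"

definition ext_d :: "(real^'n \<Rightarrow> real^'n \<Rightarrow> 'b::real_normed_vector) \<Rightarrow>
    real^'n \<Rightarrow> real^'n \<Rightarrow> real^'n \<Rightarrow> 'b" where
  "ext_d \<theta> x u v = frechet_derivative (\<lambda>y. \<theta> y v) (at x) u - frechet_derivative (\<lambda>y. \<theta> y u) (at x) v"

definition wedge_mat :: "(real^'n \<Rightarrow> real^'n \<Rightarrow> real^'p^'p) \<Rightarrow> (real^'n \<Rightarrow> real^'n \<Rightarrow> real^'p^'p) \<Rightarrow>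
    real^'n \<Rightarrow> real^'n \<Rightarrow> real^'n \<Rightarrow> real^'p^'p" where
  "wedge_mat \<theta> \<eta> x u v = \<theta> x u ** \<eta> x v - \<theta> x v ** \<eta> x u"

definition flat_connection_on :: "(real^'n) set \<Rightarrow> (real^'n \<Rightarrow> real^'n \<Rightarrow> real^'p^'p) \<Rightarrow> bool" where
  "flat_connection_on S \<omega> \<longleftrightarrow> smooth_1form_on S \<omega> \<and>
     (\<forall>x\<in>S. \<forall>u v. ext_d \<omega> x u v + wedge_mat \<omega> \<omega> x u v = 0)"

definition exact_on :: "(real^'n) set \<Rightarrow> (real^'n \<Rightarrow> real^'n \<Rightarrow> 'b::real_normed_vector) \<Rightarrow> bool" where
  "exact_on S \<theta> \<longleftrightarrow> (\<exists>Y. \<forall>x\<in>S. (Y has_derivative \<theta> x) (at x))"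


subsection \<open>Matrices and the system\<close>

definition Jmat :: "real^('n::{finite,linorder})^('n::{finite,linorder})" where
  "Jmat = (\<chi> i j. if i = j then (if i = last_idx then -1 else 1) else 0)"

definition O_n1 :: "(real^('n::{finite,linorder})^('n::{finite,linorder})) set" where
  "O_n1 = {B. transpose B ** Jmat ** B = Jmat}"

definition gl_star :: "(real^'n^'n) set" where
  "gl_star = {F. \<forall>i. F $ i $ i = 0}"

definition so_alg :: "(real^'p^'p) set" where
  "so_alg = {M. transpose M = - M}"

definition Cmat :: "'n \<Rightarrow> real^'n^'n" where
  "Cmat i = (\<chi> a b. if a = i \<and> b = i then 1 else 0)"

definition block_mat :: "real^('n::finite)^('n::finite) \<Rightarrow> real^('k::finite)^('n::finite) \<Rightarrow> real^('n::finite)^('k::finite) \<Rightarrow> real^('k::finite)^('k::finite) \<Rightarrow>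
    real^(('n::finite) + ('k::finite))^(('n::finite) + ('k::finite))" where
  "block_mat P Q R T = (\<chi> a b. case a of
       Inl i \<Rightarrow> (case b of Inl j \<Rightarrow> P $ i $ j | Inr l \<Rightarrow> Q $ i $ l)
     | Inr k \<Rightarrow> (case b of Inl j \<Rightarrow> R $ k $ j | Inr l \<Rightarrow> T $ k $ l))"

definition left_block :: "real^(('n::finite) + ('k::finite))^(('n::finite) + ('k::finite)) \<Rightarrow> real^('n::finite)^(('n::finite) + ('k::finite))" where
  "left_block A = (\<chi> a i. A $ a $ Inl i)"

definition G1_system_II :: "(real^('n::{finite,linorder})) set \<Rightarrow> (real^('n::{finite,linorder}) \<Rightarrow> real^('n::{finite,linorder})^('n::{finite,linorder})) \<Rightarrow>
    (real^('n::{finite,linorder}) \<Rightarrow> real^('n::{finite,linorder})^'k) \<Rightarrow> (real^('n::{finite,linorder}) \<Rightarrow> real^('n::{finite,linorder})^('n::{finite,linorder})) \<Rightarrow> bool" where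
  "G1_system_II S F G B \<longleftrightarrow>
     smooth_on S F \<and> smooth_on S G \<and> smooth_on S B \<and>
     (\<forall>x\<in>S. F x \<in> gl_star \<and> B x \<in> O_n1 \<and>
       (\<forall>i j. i \<noteq> j \<longrightarrow>
          partial i (\<lambda>y. F y $ i $ j) x + partial j (\<lambda>y. F y $ j $ i) x
          + (\<Sum>k\<in>UNIV. F x $ k $ i * F x $ k $ j) + (\<Sum>k\<in>UNIV. G x $ k $ i * G x $ k $ j) = 0) \<and>
       (\<forall>i j k. i \<noteq> j \<and> j \<noteq> k \<and> i \<noteq> k \<longrightarrow>
          partial k (\<lambda>y. F y $ i $ j) x = F x $ i $ k * F x $ k $ j) \<and>
       (\<forall>i j k. j \<noteq> k \<longrightarrow> partial k (\<lambda>y. B y $ i $ j) x = F x $ k $ j * B x $ i $ k) \<and>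
       (\<forall>i j k. j \<noteq> k \<longrightarrow> partial k (\<lambda>y. G y $ i $ j) x = F x $ k $ j * G x $ i $ k))"

definition omega_form :: "(real^('n::finite) \<Rightarrow> real^('n::finite)^('n::finite)) \<Rightarrow> (real^('n::finite) \<Rightarrow> real^('n::finite)^('k::finite)) \<Rightarrow>
    real^('n::finite) \<Rightarrow> real^('n::finite) \<Rightarrow> real^(('n::finite) + ('k::finite))^(('n::finite) + ('k::finite))" where
  "omega_form F G x v = (\<Sum>i\<in>UNIV. v $ i *\<^sub>R
     block_mat (- (F x ** Cmat i) + Cmat i ** transpose (F x)) (Cmat i ** transpose (G x))
               (- (G x ** Cmat i)) 0)"

text \<open>\<open>A\<close> is \<open>O(m)\<close>-valued with \<open>A\<inverse> dA = \<omega>\<close>.\<close>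

definition is_orthogonal_trivialization ::
    "(real^'n \<Rightarrow> real^'n \<Rightarrow> real^'p^'p) \<Rightarrow> (real^'n \<Rightarrow> real^'p^'p) \<Rightarrow> bool" where
  "is_orthogonal_trivialization \<omega> A \<longleftrightarrow> smooth_on UNIV A \<and>
     (\<forall>x. orthogonal_matrix (A x) \<and>
        (\<forall>v. matrix_inv (A x) ** frechet_derivative A (at x) v = \<omega> x v))"


subsection \<open>Submanifold geometry\<close>

definition immersion_on :: "(real^'n) set \<Rightarrow> (real^'n \<Rightarrow> 'e::euclidean_space) \<Rightarrow> bool" where
  "immersion_on S X \<longleftrightarrow> smooth_on S X \<and> (\<forall>x\<in>S. inj (frechet_derivative X (at x)))"

definition tangent_space :: "(real^'n \<Rightarrow> 'e::euclidean_space) \<Rightarrow> real^'n \<Rightarrow> 'e set" where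
  "tangent_space X x = range (frechet_derivative X (at x))"

definition normal_space :: "(real^'n \<Rightarrow> 'e::euclidean_space) \<Rightarrow> real^'n \<Rightarrow> 'e set" where
  "normal_space X x = {w. \<forall>t\<in>tangent_space X x. w \<bullet> t = 0}"

definition normal_part :: "(real^'n \<Rightarrow> 'e::euclidean_space) \<Rightarrow> real^'n \<Rightarrow> 'e \<Rightarrow> 'e" where
  "normal_part X x w = (THE w'. w' \<in> normal_space X x \<and> w - w' \<in> tangent_space X x)"

definition normal_field_on ::
    "(real^'n) set \<Rightarrow> (real^'n \<Rightarrow> 'e::euclidean_space) \<Rightarrow> (real^'n \<Rightarrow> 'e) \<Rightarrow> bool" where
  "normal_field_on S X \<xi> \<longleftrightarrow> smooth_on S \<xi> \<and> (\<forall>x\<in>S. \<xi> x \<in> normal_space X x)"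

text \<open>The induced connection of the normal bundle.\<close>

definition normal_deriv ::
    "(real^'n \<Rightarrow> 'e::euclidean_space) \<Rightarrow> (real^'n \<Rightarrow> 'e) \<Rightarrow> real^'n \<Rightarrow> real^'n \<Rightarrow> 'e" where
  "normal_deriv X \<xi> x v = normal_part X x (frechet_derivative \<xi> (at x) v)"

text \<open>Vanishing normal curvature, tested on the (commuting) coordinate vector fields.\<close>

definition flat_normal_bundle_on :: "(real^'n) set \<Rightarrow> (real^'n \<Rightarrow> 'e::euclidean_space) \<Rightarrow> bool" where
  "flat_normal_bundle_on S X \<longleftrightarrow> (\<forall>\<xi>. normal_field_on S X \<xi> \<longrightarrow> (\<forall>x\<in>S. \<forall>i j.
      normal_deriv X (\<lambda>y. normal_deriv X \<xi> y (axis j 1)) x (axis i 1)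
      = normal_deriv X (\<lambda>y. normal_deriv X \<xi> y (axis i 1)) x (axis j 1)))"

text \<open>
  The shape operator of a normal vector \<open>\<nu>\<close> at \<open>x\<close>, read as an endomorphism of the parameter space
  through the isomorphism \<open>dX\<close>: \<open>\<langle>dX (A\<^sub>\<nu> u), dX z\<rangle> = \<langle>II(u, z), \<nu>\<rangle>\<close>. In the sign convention
  of \<open>snd_form\<close> below, \<open>\<langle>II(u, z), \<nu>\<rangle> = - \<langle>D\<^sup>2X(u, z), \<nu>\<rangle>\<close>.
\<close>

definition shape_operator ::
    "(real^'n \<Rightarrow> 'e::euclidean_space) \<Rightarrow> real^'n \<Rightarrow> 'e \<Rightarrow> real^'n \<Rightarrow> real^'n" where
  "shape_operator X x \<nu> u = (THE w. \<forall>z.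
     frechet_derivative X (at x) w \<bullet> frechet_derivative X (at x) z
     = - (frechet_derivative (\<lambda>y. frechet_derivative X (at y) z) (at x) u \<bullet> \<nu>))"

definition nondegenerate_normal_bundle_on ::
    "(real^'n) set \<Rightarrow> (real^'n \<Rightarrow> 'e::euclidean_space) \<Rightarrow> bool" where
  "nondegenerate_normal_bundle_on S X \<longleftrightarrow>
     (\<forall>x\<in>S. dim ((\<lambda>\<nu>. matrix (shape_operator X x \<nu>)) ` normal_space X x) = CARD('n))"

text \<open>
  Fundamental forms as symmetric bilinear forms in the coordinates: \<open>\<Sum>\<^sub>i h\<^sub>i dx\<^sub>i\<^sup>2\<close> evaluates to
  \<open>\<Sum>\<^sub>i h\<^sub>i u\<^sub>i v\<^sub>i\<close>. If \<open>t\<^sub>1, \<dots>\<close> is an orthonormal frame of the tangent spaces, then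
  \<open>\<Sum>\<^sub>i \<omega>\<^sub>i(u) \<omega>\<^sub>i\<^sub>\<alpha>(v) = \<Sum>\<^sub>i \<langle>dX u, t\<^sub>i\<rangle> \<langle>t\<^sub>i, de\<^sub>\<alpha> v\<rangle> = \<langle>dX u, de\<^sub>\<alpha> v\<rangle>\<close>, the coefficient of
  \<open>e\<^sub>\<alpha>\<close> in \<open>snd_form\<close>. With this convention \<open>II\<close> is minus the normal part of \<open>D\<^sup>2X\<close>.
\<close>

definition fst_form :: "(real^'n \<Rightarrow> 'e::euclidean_space) \<Rightarrow> real^'n \<Rightarrow> real^'n \<Rightarrow> real^'n \<Rightarrow> real" where
  "fst_form X x u v = frechet_derivative X (at x) u \<bullet> frechet_derivative X (at x) v"

definition snd_form :: "(real^'n \<Rightarrow> 'e::euclidean_space) \<Rightarrow> ('k::finite \<Rightarrow> real^'n \<Rightarrow> 'e) \<Rightarrow>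
    real^'n \<Rightarrow> real^'n \<Rightarrow> real^'n \<Rightarrow> 'e" where
  "snd_form X e x u v = (\<Sum>k\<in>UNIV.
     (frechet_derivative X (at x) u \<bullet> frechet_derivative (e k) (at x) v) *\<^sub>R e k x)"

text \<open>
  Orthonormal and parallel for the normal connection. It spans the normal spaces when the
  codimension is \<open>CARD('k)\<close>, as is the case for \<open>'e = real^('n + 'k)\<close>.
\<close>

definition parallel_normal_frame_on :: "(real^'n) set \<Rightarrow> (real^'n \<Rightarrow> 'e::euclidean_space) \<Rightarrow>
    ('k::finite \<Rightarrow> real^'n \<Rightarrow> 'e) \<Rightarrow> bool" where
  "parallel_normal_frame_on S X e \<longleftrightarrow>
     (\<forall>k. normal_field_on S X (e k)) \<and>
     (\<forall>x\<in>S. \<forall>k l. e k x \<bullet> e l x = (if k = l then 1 else 0)) \<and>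
     (\<forall>x\<in>S. \<forall>k v. normal_deriv X (e k) x v = 0)"

text \<open>
  \<open>I = \<Sum>\<^sub>i a\<^sub>i\<^sup>2 dx\<^sub>i\<^sup>2\<close> and \<open>II = \<Sum>\<^sub>i\<^sub>,\<^sub>k c\<^sub>k\<^sub>i dx\<^sub>i\<^sup>2 e\<^sub>k\<close>.
\<close>

definition diagonal_forms_on :: "(real^'n) set \<Rightarrow> (real^'n \<Rightarrow> 'e::euclidean_space) \<Rightarrow>
    ('k::finite \<Rightarrow> real^'n \<Rightarrow> 'e) \<Rightarrow> (real^'n \<Rightarrow> real^'n) \<Rightarrow> (real^'n \<Rightarrow> real^'n^'k) \<Rightarrow> bool" where
  "diagonal_forms_on S X e a c \<longleftrightarrow> (\<forall>x\<in>S. \<forall>u v.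
     fst_form X x u v = (\<Sum>i\<in>UNIV. (a x $ i)\<^sup>2 * u $ i * v $ i) \<and>
     snd_form X e x u v = (\<Sum>i\<in>UNIV. \<Sum>k\<in>UNIV. (c x $ k $ i * u $ i * v $ i) *\<^sub>R e k x))"

definition hyperbolic_curvature_coords_on :: "(real^('n::{finite,linorder})) set \<Rightarrow>
    (real^('n::{finite,linorder}) \<Rightarrow> 'e::euclidean_space) \<Rightarrow> ('k::finite \<Rightarrow> real^('n::{finite,linorder}) \<Rightarrow> 'e) \<Rightarrow> bool" where
  "hyperbolic_curvature_coords_on S X e \<longleftrightarrow> parallel_normal_frame_on S X e \<and>
     (\<exists>a c. smooth_on S a \<and> smooth_on S c \<and> diagonal_forms_on S X e a c \<and>
       (\<exists>\<epsilon>\<in>{1, -1}. \<forall>x\<in>S. (\<Sum>i\<in>UNIV - {last_idx}. (a x $ i)\<^sup>2) - (a x $ last_idx)\<^sup>2 = \<epsilon>))"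

text \<open>
  All requirements on a tuple of type \<open>O(n,1)\<close> other than non-degeneracy of the normal bundles.
\<close>

definition O_n1_tuple_core_on :: "(real^('n::{finite,linorder})) set \<Rightarrow>
    (('n::{finite,linorder}) \<Rightarrow> real^('n::{finite,linorder}) \<Rightarrow> real^(('n::{finite,linorder}) + ('k::finite))) \<Rightarrow> bool" where
  "O_n1_tuple_core_on S X \<longleftrightarrow> is_domain S \<and>
     (\<forall>j. immersion_on S (X j) \<and> flat_normal_bundle_on S (X j)) \<and>
     (\<forall>i j. \<forall>x\<in>S. normal_space (X i) x = normal_space (X j) x) \<and>
     (\<exists>e :: ('k::finite) \<Rightarrow> real^('n::{finite,linorder}) \<Rightarrow> real^(('n::{finite,linorder}) + ('k::finite)).
        (\<forall>j. parallel_normal_frame_on S (X j) e) \<and>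
        (\<forall>j. hyperbolic_curvature_coords_on S (X j) e) \<and>
        (\<exists>\<beta> \<gamma>.
           smooth_on S \<beta> \<and> smooth_on S \<gamma> \<and> (\<forall>x\<in>S. \<beta> x \<in> O_n1) \<and>
           (\<forall>j. diagonal_forms_on S (X j) e (\<lambda>x. row j (\<beta> x))
                  (\<lambda>x. \<chi> k i. \<beta> x $ j $ i * \<gamma> x $ k $ i))))"

definition O_n1_tuple_on :: "(real^('n::{finite,linorder})) set \<Rightarrow>
    (('n::{finite,linorder}) \<Rightarrow> real^('n::{finite,linorder}) \<Rightarrow> real^(('n::{finite,linorder}) + ('k::finite))) \<Rightarrow> bool" where
  "O_n1_tuple_on S X \<longleftrightarrow> O_n1_tuple_core_on S X \<and> (\<forall>j. nondegenerate_normal_bundle_on S (X j))"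

text \<open>
  \<open>I = \<Sum>\<^sub>i b\<^sub>i\<^sup>2 dx\<^sub>i\<^sup>2\<close> and \<open>II = - \<Sum>\<^sub>i\<^sub>,\<^sub>k g\<^sub>k\<^sub>i b\<^sub>i dx\<^sub>i\<^sup>2 e\<^sub>k\<close>.
\<close>

definition has_forms_on :: "(real^'n) set \<Rightarrow> (real^'n \<Rightarrow> 'e::euclidean_space) \<Rightarrow>
    ('k::finite \<Rightarrow> real^'n \<Rightarrow> 'e) \<Rightarrow> (real^'n \<Rightarrow> real^'n^'k) \<Rightarrow> (real^'n \<Rightarrow> real^'n) \<Rightarrow> bool" where
  "has_forms_on S X e G b \<longleftrightarrow>
     diagonal_forms_on S X e b (\<lambda>x. \<chi> k i. - (G x $ k $ i * b x $ i))"

end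

theory Submission
  imports Defs
begin

text \<open>
  The form \<open>\<omega>\<close> is integrated by Picard iteration along rays from the origin. Its iterates satisfy
  \<open>A\<^bsub>k+1\<^esub>(x) = 1 + \<integral>\<^sub>0\<^sup>1 A\<^sub>k(tx) \<omega>\<^bsub>tx\<^esub>(x) dt\<close>, and flatness turns the derivative of this into a linear
  recursion for the error \<open>dA\<^sub>k - A\<^sub>k \<omega>\<close>, which therefore tends to 0 along with the increments. The
  columns of \<open>A\<close> give a tangent frame and a parallel normal frame, and the derivative of \<open>X\<^sub>j\<close> in the
  direction \<open>x\<^sub>i\<close> is \<open>- J\<^bsub>jj\<^esub> b\<^bsub>ji\<^esub>\<close> times the \<open>i\<close>-th tangent vector, which determines both fundamental forms.

  Conversely, for a tuple the unit tangent vectors \<open>E\<^sub>i = (X\<^sub>j)\<^bsub>x\<^sub>i\<^esub> / b\<^bsub>ji\<^esub>\<close> do not depend on \<open>j\<close>. Since \<open>B\<close> is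
  invertible, the equality of the mixed derivatives of all the \<open>X\<^sub>j\<close> forces
  \<open>(E\<^sub>l)\<^bsub>x\<^sub>i\<^esub> = f\<^bsub>li\<^esub> E\<^sub>i\<close> for \<open>i \<noteq> l\<close>, and the system expresses the equality of the mixed derivatives of the
  frame.
\<close>

section \<open>Smooth maps\<close>

text \<open>Solving the linear equation along each ray would give no control of derivatives across
  the rays. Carrying the defect \<open>dA - A \<omega>\<close> through the iteration supplies it:
  the iterates converge together with their derivatives. The factor \<open>J\<close> in
  \<open>dX\<close> decides the signs. The matrix of the tuple is \<open>J B\<close>, which is again
  in O(n,1), and only for the last immersion is the sign of the second form reversed relative to row
  \<open>j\<close> of \<open>B\<close>. In the converse, metrics relate the unit tangent vectors of
  two immersions with equal tangent planes only up to a rotation, and they determine the matrix of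
  the tuple only up to a sign in each entry; moreover the given frame need not be the one from the
  definition of a tuple. Non-degeneracy removes these ambiguities: every column of \<open>G\<close>
  is non-zero, so the second forms fix the direction \<open>E_i\<close> and leave a single sign per
  column of the matrix.\<close>

lemma partial_eq:
  "(f has_derivative f') (at x) \<Longrightarrow> partial i f x = f' (axis i 1)"
  unfolding partial_def using frechet_derivative_at by metis

lemma vec_eq_sum_axis: "(v :: real^'n) = (\<Sum>i\<in>UNIV. v $ i *\<^sub>R axis i 1)"
  by (simp add: basis_expansion scalar_mult_eq_scaleR[symmetric])

lemma frechet_derivative_eq_sum_partial:
  assumes "f differentiable (at x)"
  shows "frechet_derivative f (at x) v = (\<Sum>i\<in>UNIV. v $ i *\<^sub>R partial i f x)"
proof -
  interpret linear "frechet_derivative f (at x)"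
    by (rule linear_frechet_derivative[OF assms])
  show ?thesis
    unfolding partial_def by (subst vec_eq_sum_axis[of v]) (simp add: sum scale)
qed

text \<open>The choice operator behind \<open>frechet_derivative\<close> sees the same set of
  derivatives for both maps, so the values agree even where no derivative exists.\<close>

lemma partial_cong:
  assumes "open S" "x \<in> S" "\<And>y. y \<in> S \<Longrightarrow> f y = g y"
  shows "partial i f x = partial i g x"
proof -
  have "(f has_derivative D) (at x) \<longleftrightarrow> (g has_derivative D) (at x)" for D
    using assms has_derivative_transform_within_open[of f D x UNIV S g]
      has_derivative_transform_within_open[of g D x UNIV S f] by auto
  then show ?thesis
    unfolding partial_def frechet_derivative_def by simp
qed

lemma differentiable_cong_open:
  assumes "open S" "x \<in> S" "\<And>y. y \<in> S \<Longrightarrow> f y = g y" "f differentiable (at x)"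
  shows "g differentiable (at x)"
  using assms has_derivative_transform_within_open[of f _ x UNIV S g]
  unfolding differentiable_def by auto

lemma Ck_on_cong:
  assumes "open S" "\<And>y. y \<in> S \<Longrightarrow> f y = g y" "Ck_on r S f"
  shows "Ck_on r S g"
  using assms(2,3)
proof (induction r arbitrary: f g)
  case 0
  then show ?case by (simp cong: continuous_on_cong)
next
  case (Suc r)
  have "g differentiable (at x)" if "x \<in> S" for x
    using differentiable_cong_open[OF assms(1) that] Suc.prems that by auto
  moreover have "Ck_on r S (partial i g)" for i
    using Suc.IH[of "partial i f" "partial i g"] Suc.prems partial_cong[OF assms(1)]
    by (metis Ck_on.simps(2))
  ultimately show ?case by simp
qed

lemma smooth_on_cong:
  "open S \<Longrightarrow> smooth_on S f \<Longrightarrow> (\<And>y. y \<in> S \<Longrightarrow> f y = g y) \<Longrightarrow> smooth_on S g"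
  unfolding smooth_on_def using Ck_on_cong by blast

text \<open>The recursion of \<open>Ck_on\<close> passes to the partial derivatives, so at the
  bottom level continuity of the map itself has to come from differentiability.\<close>

lemma Ck_on_SucD: "Ck_on (Suc r) S f \<Longrightarrow> Ck_on r S f"
proof (induction r arbitrary: f)
  case 0
  then show ?case
    by (auto intro!: continuous_at_imp_continuous_on differentiable_imp_continuous_within)
next
  case (Suc r)
  then show ?case by (metis Ck_on.simps(2))
qed

lemma smooth_on_differentiable: "smooth_on S f \<Longrightarrow> x \<in> S \<Longrightarrow> f differentiable (at x)"
  unfolding smooth_on_def using Ck_on.simps(2) by blast

lemma smooth_on_partial: "smooth_on S f \<Longrightarrow> smooth_on S (partial i f)"
  unfolding smooth_on_def using Ck_on.simps(2) by blast

lemma smooth_on_continuous: "smooth_on S f \<Longrightarrow> continuous_on S f"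
  unfolding smooth_on_def using Ck_on.simps(1) by blast

lemma smooth_on_has_derivative:
  "smooth_on S f \<Longrightarrow> x \<in> S \<Longrightarrow> (f has_derivative frechet_derivative f (at x)) (at x)"
  using smooth_on_differentiable frechet_derivative_works by blast

lemma Ck_on_const:
  fixes S :: "(real^'n) set"
  shows "Ck_on r S (\<lambda>x. c)"
proof (induction r arbitrary: c)
  case (Suc r)
  have "partial i (\<lambda>x::real^'n. c) = (\<lambda>x. 0)" for i
    by (simp add: fun_eq_iff partial_def)
  then show ?case using Suc by simp
qed simp

lemma smooth_on_const: "smooth_on S (\<lambda>x. c)"
  by (simp add: smooth_on_def Ck_on_const)

lemma (in bounded_linear) partial_compose:
  assumes "g differentiable (at x)"
  shows "partial i (\<lambda>x. f (g x)) x = f (partial i g x)"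
  using partial_eq[OF has_derivative[OF assms[unfolded frechet_derivative_works]]]
  by (simp add: partial_def)

lemma (in bounded_linear) Ck_on_compose:
  assumes "open S" "Ck_on r S g"
  shows "Ck_on r S (\<lambda>x. f (g x))"
  using assms(2)
proof (induction r arbitrary: g)
  case 0
  then show ?case by (simp add: continuous_on)
next
  case (Suc r)
  have "Ck_on r S (partial i (\<lambda>x. f (g x)))" for i
    using Ck_on_cong[OF assms(1) _ Suc.IH[of "partial i g"], of "partial i (\<lambda>x. f (g x))"]
      Suc.prems by (auto simp: partial_compose)
  moreover have "(\<lambda>x. f (g x)) differentiable (at x)" if "x \<in> S" for x
    using differentiableI[OF has_derivative] Suc.prems that
    by (auto simp: frechet_derivative_works)
  ultimately show ?case by simp
qed

lemma (in bounded_linear) smooth_on_compose: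
  "open S \<Longrightarrow> smooth_on S g \<Longrightarrow> smooth_on S (\<lambda>x. f (g x))"
  by (simp add: smooth_on_def Ck_on_compose)

lemma partial_add:
  "f differentiable (at x) \<Longrightarrow> g differentiable (at x) \<Longrightarrow>
    partial i (\<lambda>x. f x + g x) x = partial i f x + partial i g x"
  using partial_eq[OF has_derivative_add[of f _ _ g]]
  by (simp add: frechet_derivative_works partial_def)

lemma Ck_on_add:
  assumes "open S" "Ck_on r S f" "Ck_on r S g"
  shows "Ck_on r S (\<lambda>x. f x + g x)"
  using assms(2,3)
proof (induction r arbitrary: f g)
  case 0
  then show ?case by (simp add: continuous_on_add)
next
  case (Suc r)
  have "Ck_on r S (partial i (\<lambda>x. f x + g x))" for i
    using Ck_on_cong[OF assms(1) _ Suc.IH[of "partial i f" "partial i g"], of "partial i (\<lambda>x. f x + g x)"]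
      Suc.prems by (auto simp: partial_add)
  then show ?case using Suc.prems by (simp add: differentiable_add)
qed

lemma smooth_on_add:
  "open S \<Longrightarrow> smooth_on S f \<Longrightarrow> smooth_on S g \<Longrightarrow> smooth_on S (\<lambda>x. f x + g x)"
  by (simp add: smooth_on_def Ck_on_add)

lemma (in bounded_bilinear) partial_prod:
  assumes "f differentiable (at x)" "g differentiable (at x)"
  shows "partial i (\<lambda>x. prod (f x) (g x)) x = prod (f x) (partial i g x) + prod (partial i f x) (g x)"
  using partial_eq[OF FDERIV[OF assms[unfolded frechet_derivative_works]]]
  by (simp add: partial_def)

text \<open>The Leibniz rule pairs each factor with a derivative of the other, so the induction step
  also uses both factors at the lower order. The bilinear form of the statement serves scalar
  multiples, inner products and matrix products alike.\<close>

lemma (in bounded_bilinear) Ck_on_prod: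
  assumes "open S" "Ck_on r S f" "Ck_on r S g"
  shows "Ck_on r S (\<lambda>x. prod (f x) (g x))"
  using assms(2,3)
proof (induction r arbitrary: f g)
  case 0
  then show ?case by (simp add: continuous_on)
next
  case (Suc r)
  have "Ck_on r S (partial i (\<lambda>x. prod (f x) (g x)))" for i
  proof (rule Ck_on_cong[OF assms(1)])
    show "Ck_on r S (\<lambda>x. prod (f x) (partial i g x) + prod (partial i f x) (g x))"
      using Suc.prems Ck_on_SucD[OF Suc.prems(1)] Ck_on_SucD[OF Suc.prems(2)]
      by (intro Ck_on_add assms(1) Suc.IH) auto
  qed (use Suc.prems in \<open>auto simp: partial_prod\<close>)
  moreover have "(\<lambda>x. prod (f x) (g x)) differentiable (at x)" if "x \<in> S" for x
    using FDERIV[of f "frechet_derivative f (at x)" x UNIV g "frechet_derivative g (at x)"]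
      Suc.prems that by (auto simp: frechet_derivative_works[symmetric] intro: differentiableI)
  ultimately show ?case by simp
qed

lemma (in bounded_bilinear) smooth_on_prod:
  "open S \<Longrightarrow> smooth_on S f \<Longrightarrow> smooth_on S g \<Longrightarrow> smooth_on S (\<lambda>x. prod (f x) (g x))"
  by (simp add: smooth_on_def Ck_on_prod)

lemmas smooth_on_scaleR = bounded_bilinear.smooth_on_prod[OF bounded_bilinear_scaleR]
lemmas smooth_on_mult = bounded_bilinear.smooth_on_prod[OF bounded_bilinear_mult]
lemmas smooth_on_inner = bounded_bilinear.smooth_on_prod[OF bounded_bilinear_inner]
lemmas smooth_on_uminus = bounded_linear.smooth_on_compose[OF bounded_linear_minus[OF bounded_linear_ident]]
lemmas smooth_on_vec_nth = bounded_linear.smooth_on_compose[OF bounded_linear_vec_nth]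

lemma smooth_on_diff:
  "open S \<Longrightarrow> smooth_on S f \<Longrightarrow> smooth_on S g \<Longrightarrow> smooth_on S (\<lambda>x. f x - g x)"
  using smooth_on_add[OF _ _ smooth_on_uminus, of S f g] by simp

lemma smooth_on_sum:
  assumes "open S" "\<And>i. i \<in> I \<Longrightarrow> smooth_on S (f i)"
  shows "smooth_on S (\<lambda>x. \<Sum>i\<in>I. f i x)"
  using assms(2) by (induction I rule: infinite_finite_induct)
    (auto intro: smooth_on_const smooth_on_add assms(1))

text \<open>Bootstrap: the derivative of \<open>inverse f\<close> is built from
  \<open>inverse f\<close> itself and the derivative of \<open>f\<close>, so order \<open>r\<close>
  for the reciprocal gives order \<open>r + 1\<close>.\<close>

lemma smooth_on_inverse:
  fixes f :: "real^'n \<Rightarrow> real"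
  assumes "open S" "smooth_on S f" "\<And>x. x \<in> S \<Longrightarrow> f x \<noteq> 0"
  shows "smooth_on S (\<lambda>x. inverse (f x))"
proof -
  have "Ck_on r S (\<lambda>x. inverse (f x))" for r
  proof (induction r)
    case 0
    then show ?case using assms smooth_on_continuous by (auto intro: continuous_on_inverse)
  next
    case (Suc r)
    have D: "((\<lambda>x. inverse (f x)) has_derivative
      (\<lambda>h. - (inverse (f x) * frechet_derivative f (at x) h * inverse (f x)))) (at x)" if "x \<in> S" for x
      by (rule Deriv.has_derivative_inverse) (use assms that smooth_on_has_derivative in auto)
    have "Ck_on r S (partial i (\<lambda>x. inverse (f x)))" for i
    proof (rule Ck_on_cong[OF assms(1)])
      show "Ck_on r S (\<lambda>x. - (inverse (f x) * partial i f x * inverse (f x)))"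
        using Suc smooth_on_partial[OF assms(2), unfolded smooth_on_def]
        by (intro bounded_linear.Ck_on_compose[OF bounded_linear_minus[OF bounded_linear_ident]]
          bounded_bilinear.Ck_on_prod[OF bounded_bilinear_mult] assms(1)) auto
    qed (use partial_eq[OF D] in \<open>simp add: partial_def\<close>)
    then show ?case using D by (auto intro!: differentiableI)
  qed
  then show ?thesis by (simp add: smooth_on_def)
qed

lemma bounded_linear_axis: "bounded_linear (axis i :: 'b::real_normed_vector \<Rightarrow> 'b^'n)"
proof (rule bounded_linear_intro[where K=1])
  show "norm (axis i x) \<le> norm x * 1" for x :: 'b
    by (simp add: norm_vec_def L2_set_def axis_def if_distrib[of norm] if_distrib[of "\<lambda>a. a\<^sup>2"] cong: if_cong)
qed (auto simp: axis_def vec_eq_iff)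

lemma smooth_on_vec_lambda:
  fixes f :: "'m::finite \<Rightarrow> real^'n \<Rightarrow> 'b::real_normed_vector"
  assumes "open S" "\<And>i. smooth_on S (f i)"
  shows "smooth_on S (\<lambda>x. \<chi> i. f i x)"
proof -
  have "(\<chi> i. f i x) = (\<Sum>i\<in>UNIV. axis i (f i x))" for x
    by (simp add: vec_eq_iff axis_def)
  then show ?thesis
    using assms by (auto intro!: smooth_on_sum bounded_linear.smooth_on_compose[OF bounded_linear_axis])
qed

lemma smooth_on_frechet_derivative:
  assumes "open S" "smooth_on S f"
  shows "smooth_on S (\<lambda>x. frechet_derivative f (at x) v)"
  by (rule smooth_on_cong[OF assms(1), of "\<lambda>x. \<Sum>i\<in>UNIV. v $ i *\<^sub>R partial i f x"])
    (use assms in \<open>auto intro!: smooth_on_sum smooth_on_scaleR smooth_on_const smooth_on_partial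
      simp: frechet_derivative_eq_sum_partial[OF smooth_on_differentiable]\<close>)

text \<open>Two applications of the mean value theorem, first along \<open>u\<close>, then along
  \<open>v\<close>. The second difference on the left is symmetric in \<open>u\<close> and
  \<open>v\<close>, while the right side differentiates in a definite order; the symmetry of second
  derivatives rests on this.\<close>

lemma mixed_difference_mvt:
  fixes f :: "'a::real_normed_vector \<Rightarrow> real"
  assumes h: "0 < h"
    and f: "\<And>s t. 0 \<le> s \<Longrightarrow> s \<le> h \<Longrightarrow> 0 \<le> t \<Longrightarrow> t \<le> h \<Longrightarrow>
      (f has_derivative f' (x + s *\<^sub>R u + t *\<^sub>R v)) (at (x + s *\<^sub>R u + t *\<^sub>R v))"
    and g: "\<And>s t. 0 \<le> s \<Longrightarrow> s \<le> h \<Longrightarrow> 0 \<le> t \<Longrightarrow> t \<le> h \<Longrightarrow>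
      ((\<lambda>y. f' y u) has_derivative g' (x + s *\<^sub>R u + t *\<^sub>R v)) (at (x + s *\<^sub>R u + t *\<^sub>R v))"
  obtains s t where "0 < s" "s < h" "0 < t" "t < h"
    "f (x + h *\<^sub>R u + h *\<^sub>R v) - f (x + h *\<^sub>R u) - f (x + h *\<^sub>R v) + f x
      = h * h * g' (x + s *\<^sub>R u + t *\<^sub>R v) v"
proof -
  define \<phi> where "\<phi> s = f (x + s *\<^sub>R u + h *\<^sub>R v) - f (x + s *\<^sub>R u)" for s
  have lin: "linear (f' (x + s *\<^sub>R u + t *\<^sub>R v))" "linear (g' (x + s *\<^sub>R u + t *\<^sub>R v))"
    if "0 \<le> s" "s \<le> h" "0 \<le> t" "t \<le> h" for s t
    using f[OF that] g[OF that] has_derivative_linear by blast+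
  have \<phi>: "(\<phi> has_real_derivative (f' (x + s *\<^sub>R u + h *\<^sub>R v) u - f' (x + s *\<^sub>R u) u)) (at s)"
    if s: "0 \<le> s" "s \<le> h" for s
  proof -
    have c: "((\<lambda>s. x + s *\<^sub>R u + t *\<^sub>R v) has_derivative (\<lambda>r. r *\<^sub>R u)) (at s)" for t
      by (auto intro!: derivative_eq_intros)
    have d: "((\<lambda>s. f (x + s *\<^sub>R u + t *\<^sub>R v)) has_derivative (\<lambda>r. f' (x + s *\<^sub>R u + t *\<^sub>R v) (r *\<^sub>R u))) (at s)"
      if "0 \<le> t" "t \<le> h" for t
      using diff_chain_at[OF c f[OF s that]] by (simp add: o_def)
    have "(\<phi> has_derivative (\<lambda>r. f' (x + s *\<^sub>R u + h *\<^sub>R v) (r *\<^sub>R u) - f' (x + s *\<^sub>R u) (r *\<^sub>R u))) (at s)"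
      unfolding \<phi>_def[abs_def] using has_derivative_diff[OF d[of h] d[of 0]] h by simp
    then show ?thesis
      unfolding has_field_derivative_def
      using linear_scale[OF lin(1)[OF s, of h]] linear_scale[OF lin(1)[OF s, of 0]] h
      by (simp add: left_diff_distrib[symmetric] right_diff_distrib[symmetric] mult_commute_abs)
  qed
  obtain s where s: "0 < s" "s < h"
    "\<phi> h - \<phi> 0 = (h - 0) * (f' (x + s *\<^sub>R u + h *\<^sub>R v) u - f' (x + s *\<^sub>R u) u)"
    using MVT2[OF h \<phi>] by auto
  define \<psi> where "\<psi> t = f' (x + s *\<^sub>R u + t *\<^sub>R v) u" for t
  have \<psi>: "(\<psi> has_real_derivative g' (x + s *\<^sub>R u + t *\<^sub>R v) v) (at t)" if t: "0 \<le> t" "t \<le> h" for t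
  proof -
    have c: "((\<lambda>t. x + s *\<^sub>R u + t *\<^sub>R v) has_derivative (\<lambda>r. r *\<^sub>R v)) (at t)"
      by (auto intro!: derivative_eq_intros)
    have "(\<psi> has_derivative (\<lambda>r. g' (x + s *\<^sub>R u + t *\<^sub>R v) (r *\<^sub>R v))) (at t)"
      unfolding \<psi>_def[abs_def] using diff_chain_at[OF c g[of s t]] s t by (simp add: o_def)
    then show ?thesis
      unfolding has_field_derivative_def
      using linear_scale[OF lin(2)[of s t]] s t by (simp add: mult_commute_abs)
  qed
  obtain t where t: "0 < t" "t < h" "\<psi> h - \<psi> 0 = (h - 0) * g' (x + s *\<^sub>R u + t *\<^sub>R v) v"
    using MVT2[OF h \<psi>] by auto
  show ?thesis
    using that[OF s(1,2) t(1,2)] s(3) t(3) unfolding \<phi>_def \<psi>_def by (simp add: algebra_simps)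
qed

lemma partial_commute_real:
  fixes f :: "real^'n \<Rightarrow> real"
  assumes "open S" "smooth_on S f" "x \<in> S"
  shows "partial i (partial j f) x = partial j (partial i f) x"
proof -
  let ?u = "axis i 1 :: real^'n" and ?v = "axis j 1 :: real^'n"
  have D: "(f has_derivative frechet_derivative f (at y)) (at y)"
    "(partial k f has_derivative frechet_derivative (partial k f) (at y)) (at y)" if "y \<in> S" for y k
    using smooth_on_has_derivative smooth_on_partial assms(2) that by blast+
  have cont: "isCont (partial k (partial l f)) x" for k l
    using smooth_on_continuous[OF smooth_on_partial[OF smooth_on_partial[OF assms(2)]]] assms(1,3)
      continuous_on_eq_continuous_at by blast
  have "\<bar>partial i (partial j f) x - partial j (partial i f) x\<bar> \<le> e" if e: "0 < e" for e
  proof -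
    obtain r where r: "0 < r" "ball x r \<subseteq> S"
      using assms(1,3) open_contains_ball by blast
    obtain d1 where d1: "0 < d1" "\<And>y. dist y x < d1 \<Longrightarrow>
        dist (partial i (partial j f) y) (partial i (partial j f) x) < e / 2"
      using cont[of i j, unfolded continuous_at_eps_delta] e by (metis half_gt_zero)
    obtain d2 where d2: "0 < d2" "\<And>y. dist y x < d2 \<Longrightarrow>
        dist (partial j (partial i f) y) (partial j (partial i f) x) < e / 2"
      using cont[of j i, unfolded continuous_at_eps_delta] e by (metis half_gt_zero)
    \<comment> \<open>The points supplied by the mean value theorem lie within \<open>2 * h\<close>
      of \<open>x\<close>; a third of each radius keeps them strictly inside all three
      balls.\<close>
    define h where "h = min r (min d1 d2) / 3"
    have h: "0 < h" "3 * h \<le> r" "3 * h \<le> d1" "3 * h \<le> d2"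
      using r(1) d1(1) d2(1) by (auto simp: h_def)
    have near: "dist (x + s *\<^sub>R axis k 1 + t *\<^sub>R axis l 1) x < 3 * h"
      if "0 \<le> s" "s \<le> h" "0 \<le> t" "t \<le> h" for s t k l
    proof -
      have "norm (s *\<^sub>R axis k 1 + t *\<^sub>R axis l 1 :: real^'n) \<le> s + t"
        using norm_triangle_ineq[of "s *\<^sub>R axis k 1 :: real^'n" "t *\<^sub>R axis l 1"] that by simp
      then show ?thesis using that h(1) by (simp add: dist_norm algebra_simps)
    qed
    have inS: "x + s *\<^sub>R axis k 1 + t *\<^sub>R axis l 1 \<in> S"
      if "0 \<le> s" "s \<le> h" "0 \<le> t" "t \<le> h" for s t k l
      using near[OF that, of k l] r(2) h(2) by (auto simp: dist_commute subset_iff)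
    obtain s t where st: "0 < s" "s < h" "0 < t" "t < h"
      "f (x + h *\<^sub>R ?u + h *\<^sub>R ?v) - f (x + h *\<^sub>R ?u) - f (x + h *\<^sub>R ?v) + f x
      = h * h * partial j (partial i f) (x + s *\<^sub>R ?u + t *\<^sub>R ?v)"
      by (rule mixed_difference_mvt[where f=f and f'="\<lambda>y. frechet_derivative f (at y)"
        and g'="\<lambda>y. frechet_derivative (partial i f) (at y)" and u="?u" and v="?v" and x=x, OF h(1)])
        (use D inS in \<open>auto simp: partial_def[abs_def]\<close>)
    obtain s' t' where st': "0 < s'" "s' < h" "0 < t'" "t' < h"
      "f (x + h *\<^sub>R ?v + h *\<^sub>R ?u) - f (x + h *\<^sub>R ?v) - f (x + h *\<^sub>R ?u) + f x
      = h * h * partial i (partial j f) (x + s' *\<^sub>R ?v + t' *\<^sub>R ?u)"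
      by (rule mixed_difference_mvt[where f=f and f'="\<lambda>y. frechet_derivative f (at y)"
        and g'="\<lambda>y. frechet_derivative (partial j f) (at y)" and u="?v" and v="?u" and x=x, OF h(1)])
        (use D inS in \<open>auto simp: partial_def[abs_def]\<close>)
    \<comment> \<open>Both second differences are the same number. Hence the two mixed derivatives
      take equal values at two points near \<open>x\<close>, and continuity carries this over to
      \<open>x\<close>.\<close>
    have "x + h *\<^sub>R ?v + h *\<^sub>R ?u = x + h *\<^sub>R ?u + h *\<^sub>R ?v" by simp
    then have "h * h * partial i (partial j f) (x + s' *\<^sub>R ?v + t' *\<^sub>R ?u)
      = h * h * partial j (partial i f) (x + s *\<^sub>R ?u + t *\<^sub>R ?v)"
      using st(5) st'(5) by (simp only:)
    then have "partial i (partial j f) (x + s' *\<^sub>R ?v + t' *\<^sub>R ?u)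
      = partial j (partial i f) (x + s *\<^sub>R ?u + t *\<^sub>R ?v)"
      using h(1) by simp
    moreover have "dist (partial i (partial j f) (x + s' *\<^sub>R ?v + t' *\<^sub>R ?u)) (partial i (partial j f) x) < e / 2"
      using near[of s' t' j i] st' h(3) by (intro d1(2)) auto
    moreover have "dist (partial j (partial i f) (x + s *\<^sub>R ?u + t *\<^sub>R ?v)) (partial j (partial i f) x) < e / 2"
      using near[of s t i j] st h(4) by (intro d2(2)) auto
    ultimately show ?thesis unfolding dist_real_def by argo
  qed
  from field_le_epsilon[of "\<bar>partial i (partial j f) x - partial j (partial i f) x\<bar>" 0] this
  show ?thesis by fastforce
qed

lemma partial_commute:
  fixes f :: "real^'n \<Rightarrow> 'b::euclidean_space"
  assumes "open S" "smooth_on S f" "x \<in> S"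
  shows "partial i (partial j f) x = partial j (partial i f) x"
proof (rule euclidean_eqI)
  fix b :: 'b
  have sm: "smooth_on S (\<lambda>y. f y \<bullet> b)"
    by (rule bounded_linear.smooth_on_compose[OF bounded_linear_inner_left]) fact+
  have c: "partial k (partial l (\<lambda>y. f y \<bullet> b)) x = partial k (partial l f) x \<bullet> b" for k l
  proof -
    have "partial k (partial l (\<lambda>y. f y \<bullet> b)) x = partial k (\<lambda>y. partial l f y \<bullet> b) x"
      by (rule partial_cong[OF assms(1,3)])
        (use assms(2) smooth_on_differentiable bounded_linear.partial_compose[OF bounded_linear_inner_left] in blast)
    also have "\<dots> = partial k (partial l f) x \<bullet> b"
      by (rule bounded_linear.partial_compose[OF bounded_linear_inner_left])
        (use assms smooth_on_partial smooth_on_differentiable in blast)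
    finally show ?thesis .
  qed
  show "partial i (partial j f) x \<bullet> b = partial j (partial i f) x \<bullet> b"
    using partial_commute_real[OF assms(1) sm assms(3), of i j] by (simp add: c)
qed

section \<open>Flat connections\<close>

lemma linear_eq_sum_axis:
  fixes f :: "real^'n \<Rightarrow> 'b::real_vector"
  assumes "linear f"
  shows "f v = (\<Sum>i\<in>UNIV. v $ i *\<^sub>R f (axis i 1))"
proof -
  interpret linear f by fact
  show ?thesis by (subst vec_eq_sum_axis[of v]) (simp add: sum scale)
qed

lemma Ck_on_1_differentiable: "Ck_on 1 S f \<Longrightarrow> x \<in> S \<Longrightarrow> f differentiable (at x)"
  by simp

lemma Ck_on_1_continuous: "Ck_on 1 S f \<Longrightarrow> continuous_on S f"
  using Ck_on_SucD[of 0] by simp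

lemma continuous_on_frechet_derivative:
  assumes "Ck_on 1 S f"
  shows "continuous_on S (\<lambda>x. frechet_derivative f (at x) v)"
proof -
  have "continuous_on S (\<lambda>x. \<Sum>i\<in>UNIV. v $ i *\<^sub>R partial i f x)"
    using assms by (auto intro!: continuous_intros)
  then show ?thesis
    using assms by (subst continuous_on_cong[OF refl frechet_derivative_eq_sum_partial]) auto
qed

lemma frechet_derivative_form_linear:
  fixes \<theta> :: "real^'n \<Rightarrow> real^'n \<Rightarrow> 'b::real_normed_vector"
  assumes "\<And>x. linear (\<theta> x)" and "\<And>v. (\<lambda>x. \<theta> x v) differentiable (at x)"
  shows "frechet_derivative (\<lambda>y. \<theta> y v) (at x) h
    = (\<Sum>j\<in>UNIV. v $ j *\<^sub>R frechet_derivative (\<lambda>y. \<theta> y (axis j 1)) (at x) h)"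
proof -
  have "((\<lambda>y. \<Sum>j\<in>UNIV. v $ j *\<^sub>R \<theta> y (axis j 1)) has_derivative
    (\<lambda>h. \<Sum>j\<in>UNIV. v $ j *\<^sub>R frechet_derivative (\<lambda>y. \<theta> y (axis j 1)) (at x) h)) (at x)"
    by (intro has_derivative_sum has_derivative_scaleR_right frechet_derivative_works[THEN iffD1] assms(2))
  from frechet_derivative_at[OF this, symmetric] show ?thesis
    by (simp add: linear_eq_sum_axis[OF assms(1), symmetric])
qed

lemma continuous_on_compose_scaleR:
  fixes g :: "'a::real_normed_vector \<Rightarrow> 'b::topological_space"
  assumes "continuous_on UNIV g"
  shows "continuous_on S (\<lambda>p. g (snd p *\<^sub>R fst p))" "continuous_on T (\<lambda>t. g (t *\<^sub>R x))"
  by (rule continuous_on_compose2[OF assms]; auto intro!: continuous_intros)+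

text \<open>Contracting \<open>\<theta>\<close> with the radial field and integrating along rays inverts \<open>d\<close> up to the
  analogous integral of \<open>d\<theta>\<close>. This gives both the Poincare lemma and, below, the recursion for the
  error of the Picard iterates.\<close>

lemma radial_primitive:
  fixes \<theta> :: "real^'n \<Rightarrow> real^'n \<Rightarrow> 'b::banach"
  assumes lin: "\<And>x. linear (\<theta> x)" and C1: "\<And>v. Ck_on 1 UNIV (\<lambda>x. \<theta> x v)"
  defines "P \<equiv> (\<lambda>x. integral {0..1} (\<lambda>t. \<theta> (t *\<^sub>R x) x))"
  shows "(P has_derivative (\<lambda>h. \<theta> x h + integral {0..1} (\<lambda>t. t *\<^sub>R ext_d \<theta> (t *\<^sub>R x) h x))) (at x)"
    and "Ck_on 1 UNIV P"
proof -
  define D where "D y h v = frechet_derivative (\<lambda>y. \<theta> y v) (at y) h" for y h v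
  have diff: "(\<lambda>y. \<theta> y v) differentiable (at y)" for y v
    using Ck_on_1_differentiable[OF C1] by simp
  have D: "((\<lambda>y. \<theta> y v) has_derivative (\<lambda>h. D y h v)) (at y)" for y v
    using diff unfolding D_def frechet_derivative_works .
  have Dsum: "D y h v = (\<Sum>j\<in>UNIV. v $ j *\<^sub>R D y h (axis j 1))" for y h v
    unfolding D_def by (rule frechet_derivative_form_linear[OF lin diff])
  have Dlin: "linear (\<lambda>h. D y h v)" for y v
    using D has_derivative_linear by blast
  have Dcont: "continuous_on UNIV (\<lambda>y. D y h v)" for h v
    unfolding D_def by (rule continuous_on_frechet_derivative[OF C1])
  have \<theta>cont: "continuous_on UNIV (\<lambda>y. \<theta> y v)" for v
    by (rule Ck_on_1_continuous[OF C1])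
  have \<theta>sum: "\<theta> y v = (\<Sum>j\<in>UNIV. v $ j *\<^sub>R \<theta> y (axis j 1))" for y v
    by (rule linear_eq_sum_axis[OF lin])
  \<comment> \<open>The derivative of \<open>\<theta> (t *\<^sub>R x) x\<close> in \<open>x\<close>,
    with one term from the base point and one from the argument. As a \<open>Blinfun\<close> it can
    depend continuously on \<open>x\<close> and \<open>t\<close>, as differentiation under the
    integral requires.\<close>
  define fx where "fx x t = Blinfun (\<lambda>h. t *\<^sub>R D (t *\<^sub>R x) h x + \<theta> (t *\<^sub>R x) h)" for x t
  have fx: "blinfun_apply (fx x t) = (\<lambda>h. t *\<^sub>R D (t *\<^sub>R x) h x + \<theta> (t *\<^sub>R x) h)" for x t
    unfolding fx_def
    by (rule bounded_linear_Blinfun_apply, rule linear_conv_bounded_linear[THEN iffD1],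
      rule linear_compose_add[OF linear_compose_scale_right[OF Dlin] lin])
  have cD: "continuous_on S (\<lambda>p. D (snd p *\<^sub>R fst p) h (fst p))" for S h
    by (subst Dsum) (intro continuous_intros continuous_on_compose_scaleR Dcont)
  have c\<theta>: "continuous_on S (\<lambda>p. \<theta> (snd p *\<^sub>R fst p) h)" for S h
    by (intro continuous_on_compose_scaleR \<theta>cont)
  have cfx: "continuous_on S (\<lambda>(x, t). fx x t)" for S
    by (rule continuous_on_blinfun_componentwise)
      (auto simp: case_prod_beta fx intro!: continuous_intros cD c\<theta>)
  have c\<theta>2: "continuous_on S (\<lambda>t. \<theta> (t *\<^sub>R x) v)" for S x v
    by (rule continuous_on_compose_scaleR) (rule \<theta>cont)
  have cD2: "continuous_on S (\<lambda>t. D (t *\<^sub>R x) h v)" for S x v h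
    by (rule continuous_on_compose_scaleR) (rule Dcont)
  have P: "(P has_derivative integral (cbox 0 1) (fx x)) (at x)" for x
  proof -
    have "(P has_derivative integral (cbox 0 1) (fx x)) (at x within UNIV)"
      unfolding P_def box_real[symmetric]
    proof (rule leibniz_rule)
      fix x :: "real^'n" and t :: real
      have "((\<lambda>x. \<theta> (t *\<^sub>R x) v) has_derivative (\<lambda>h. t *\<^sub>R D (t *\<^sub>R x) h v)) (at x)" for v
      proof -
        have "((\<lambda>x. t *\<^sub>R x) has_derivative (\<lambda>h. t *\<^sub>R h)) (at x)"
          by (auto intro!: derivative_eq_intros)
        from diff_chain_at[OF this D] show ?thesis
          by (simp add: o_def linear_scale[OF Dlin])
      qed
      \<comment> \<open>Expanding the argument in coordinates turns the two occurrences of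
        \<open>x\<close> into a sum of products.\<close>
      then have "((\<lambda>x. \<Sum>j\<in>UNIV. x $ j *\<^sub>R \<theta> (t *\<^sub>R x) (axis j 1)) has_derivative
        (\<lambda>h. \<Sum>j\<in>UNIV. x $ j *\<^sub>R t *\<^sub>R D (t *\<^sub>R x) h (axis j 1) + h $ j *\<^sub>R \<theta> (t *\<^sub>R x) (axis j 1))) (at x)"
        by (auto intro!: derivative_eq_intros bounded_linear_imp_has_derivative[OF bounded_linear_vec_nth])
      moreover have "(\<lambda>x. \<Sum>j\<in>UNIV. x $ j *\<^sub>R \<theta> (t *\<^sub>R x) (axis j 1)) = (\<lambda>x. \<theta> (t *\<^sub>R x) x)"
        by (rule ext, rule \<theta>sum[symmetric])
      moreover have "(\<lambda>h. \<Sum>j\<in>UNIV. x $ j *\<^sub>R t *\<^sub>R D (t *\<^sub>R x) h (axis j 1) + h $ j *\<^sub>R \<theta> (t *\<^sub>R x) (axis j 1))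
        = fx x t"
        unfolding fx by (subst \<theta>sum, subst Dsum)
          (simp add: sum.distrib scaleR_sum_right mult.commute)
      ultimately show "((\<lambda>x. \<theta> (t *\<^sub>R x) x) has_derivative fx x t) (at x within UNIV)"
        by simp
    next
      show "(\<lambda>t. \<theta> (t *\<^sub>R x) x) integrable_on cbox 0 1" for x
        by (rule integrable_continuous) (rule c\<theta>2)
    qed (use cfx in auto)
    then show ?thesis by simp
  qed
  have int: "blinfun_apply (integral (cbox 0 1) (fx x)) h
      = integral {0..1} (\<lambda>t. t *\<^sub>R D (t *\<^sub>R x) h x + \<theta> (t *\<^sub>R x) h)" for x h
  proof -
    have "continuous_on (cbox 0 1) (fx x)"
      by (rule continuous_on_blinfun_componentwise)
        (auto simp: fx intro!: continuous_intros c\<theta>2 cD2)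
    from blinfun_apply_integral[OF integrable_continuous[OF this], of h] show ?thesis
      by (simp add: fx)
  qed
  have eq: "blinfun_apply (integral (cbox 0 1) (fx x)) h
      = \<theta> x h + integral {0..1} (\<lambda>t. t *\<^sub>R ext_d \<theta> (t *\<^sub>R x) h x)" for x h
  proof -
    \<comment> \<open>The derivative of \<open>t \<theta>(t x) h\<close> in \<open>t\<close> is the
      integrand of \<open>int\<close> with \<open>x\<close> and \<open>h\<close> exchanged in
      \<open>D\<close>; the difference of the two is \<open>t\<close> times \<open>ext_d\<close>.
      The factor \<open>t\<close> removes the boundary value at 0.\<close>
    have "((\<lambda>t. t *\<^sub>R D (t *\<^sub>R x) x h + \<theta> (t *\<^sub>R x) h) has_integral
        1 *\<^sub>R \<theta> (1 *\<^sub>R x) h - 0 *\<^sub>R \<theta> (0 *\<^sub>R x) h) {0..1}"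
    proof (rule fundamental_theorem_of_calculus)
      fix t :: real
      have "((\<lambda>t. t *\<^sub>R x) has_derivative (\<lambda>r. r *\<^sub>R x)) (at t)"
        by (auto intro!: derivative_eq_intros)
      from diff_chain_at[OF this D] have "((\<lambda>t. \<theta> (t *\<^sub>R x) h) has_vector_derivative D (t *\<^sub>R x) x h) (at t)"
        by (simp add: o_def linear_scale[OF Dlin] has_vector_derivative_def)
      then have "((\<lambda>t. t *\<^sub>R \<theta> (t *\<^sub>R x) h) has_vector_derivative
          t *\<^sub>R D (t *\<^sub>R x) x h + \<theta> (t *\<^sub>R x) h) (at t)"
        by (auto intro!: derivative_eq_intros)
      then show "((\<lambda>t. t *\<^sub>R \<theta> (t *\<^sub>R x) h) has_vector_derivative
          t *\<^sub>R D (t *\<^sub>R x) x h + \<theta> (t *\<^sub>R x) h) (at t within {0..1})"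
        by (rule has_vector_derivative_at_within)
    qed simp
    then have "\<theta> x h = integral {0..1} (\<lambda>t. t *\<^sub>R D (t *\<^sub>R x) x h + \<theta> (t *\<^sub>R x) h)"
      by (simp add: integral_unique)
    then have "blinfun_apply (integral (cbox 0 1) (fx x)) h - \<theta> x h
      = integral {0..1} (\<lambda>t. (t *\<^sub>R D (t *\<^sub>R x) h x + \<theta> (t *\<^sub>R x) h) - (t *\<^sub>R D (t *\<^sub>R x) x h + \<theta> (t *\<^sub>R x) h))"
      unfolding int
      by (subst Henstock_Kurzweil_Integration.integral_diff)
        (auto intro!: integrable_continuous_real continuous_intros c\<theta>2 cD2)
    also have "(\<lambda>t. (t *\<^sub>R D (t *\<^sub>R x) h x + \<theta> (t *\<^sub>R x) h) - (t *\<^sub>R D (t *\<^sub>R x) x h + \<theta> (t *\<^sub>R x) h))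
      = (\<lambda>t. t *\<^sub>R ext_d \<theta> (t *\<^sub>R x) h x)"
      by (simp add: ext_d_def D_def scaleR_diff_right)
    finally show ?thesis by (simp add: algebra_simps)
  qed
  show "(P has_derivative (\<lambda>h. \<theta> x h + integral {0..1} (\<lambda>t. t *\<^sub>R ext_d \<theta> (t *\<^sub>R x) h x))) (at x)"
    using P[of x] unfolding eq .
  have "continuous_on UNIV (partial i P)" for i
  proof -
    have "partial i P = (\<lambda>x. integral (cbox 0 1) (\<lambda>t. t *\<^sub>R D (t *\<^sub>R x) (axis i 1) x + \<theta> (t *\<^sub>R x) (axis i 1)))"
      using partial_eq[OF P, of i] int by auto
    moreover have "continuous_on UNIV (\<lambda>x. integral (cbox 0 1) (\<lambda>t. t *\<^sub>R D (t *\<^sub>R x) (axis i 1) x + \<theta> (t *\<^sub>R x) (axis i 1)))"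
      by (rule integral_continuous_on_param)
        (auto simp: case_prod_beta intro!: continuous_intros cD c\<theta>)
    ultimately show ?thesis by simp
  qed
  then show "Ck_on 1 UNIV P"
    using P by (auto intro: differentiableI)
qed

lemma poincare_lemma:
  fixes \<theta> :: "real^'n \<Rightarrow> real^'n \<Rightarrow> 'b::banach"
  assumes "\<And>x. linear (\<theta> x)" "\<And>v. Ck_on 1 UNIV (\<lambda>x. \<theta> x v)" "\<And>x u v. ext_d \<theta> x u v = 0"
  shows "exact_on UNIV \<theta>"
  using radial_primitive(1)[OF assms(1,2)] unfolding exact_on_def assms(3) by fastforce

section \<open>Solving dA = A omega by Picard iteration\<close>

lemma bounded_bilinear_matrix_mult:
  "bounded_bilinear ((**) :: real^'n^'m \<Rightarrow> real^'p^'n \<Rightarrow> real^'p^'m)"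
proof -
  have "bilinear ((**) :: real^'n^'m \<Rightarrow> real^'p^'n \<Rightarrow> real^'p^'m)"
    by (auto simp: bilinear_def linear_iff matrix_matrix_mult_def vec_eq_iff sum.distrib
      distrib_left distrib_right sum_distrib_left mult_ac)
  then show ?thesis by (simp add: bilinear_conv_bounded_bilinear)
qed

primrec picard :: "(real^'n \<Rightarrow> real^'n \<Rightarrow> real^'p^'p) \<Rightarrow> nat \<Rightarrow> real^'n \<Rightarrow> real^'p^'p" where
  "picard \<omega> 0 = (\<lambda>x. mat 1)"
| "picard \<omega> (Suc k) = (\<lambda>x. mat 1 + integral {0..1} (\<lambda>t. picard \<omega> k (t *\<^sub>R x) ** \<omega> (t *\<^sub>R x) x))"

text \<open>Integrating the weight \<open>exp (L * r)\<close> along a ray returns at most the weight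
  divided by \<open>L\<close>. Here \<open>r\<close> is the norm of the end point, and the linear
  factor \<open>r\<close> in the bound comes from evaluating a form on the radial vector. A large
  \<open>L\<close> thus makes radial integration contracting.\<close>

lemma radial_exp_bound:
  fixes f :: "real \<Rightarrow> 'b::banach"
  assumes "f integrable_on {0..1}" "0 < L"
    and le: "\<And>t. 0 \<le> t \<Longrightarrow> t \<le> 1 \<Longrightarrow> norm (f t) \<le> K * (r * exp (L * (t * r)))"
    and "0 \<le> K"
  shows "norm (integral {0..1} f) \<le> K / L * exp (L * r)"
proof -
  have "((\<lambda>t. r * exp (L * (t * r))) has_integral exp (L * (1 * r)) / L - exp (L * (0 * r)) / L) {0..1}"
  proof (rule fundamental_theorem_of_calculus)
    fix t :: real
    have "((\<lambda>t. exp (L * (t * r)) / L) has_real_derivative r * exp (L * (t * r))) (at t within {0..1})"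
      using \<open>0 < L\<close> by (auto intro!: derivative_eq_intros)
    then show "((\<lambda>t. exp (L * (t * r)) / L) has_vector_derivative r * exp (L * (t * r))) (at t within {0..1})"
      by (simp add: has_real_derivative_iff_has_vector_derivative)
  qed simp
  then have i: "((\<lambda>t. K * (r * exp (L * (t * r)))) has_integral K * (exp (L * r) / L - 1 / L)) {0..1}"
    by (intro has_integral_mult_right) simp
  have "norm (integral {0..1} f) \<le> integral {0..1} (\<lambda>t. K * (r * exp (L * (t * r))))"
    using i by (intro integral_norm_bound_integral assms(1)) (auto intro: le)
  also have "\<dots> = K * (exp (L * r) / L - 1 / L)"
    using i by (rule integral_unique)
  also have "\<dots> \<le> K / L * exp (L * r)"
    using assms(2,4) by (simp add: field_simps)
  finally show ?thesis .
qed

lemma matrix_inv_unique: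
  fixes A :: "real^'p^'p"
  assumes "A ** A' = mat 1"
  shows "matrix_inv A = A'"
proof -
  have "A' ** A = mat 1" using assms by (simp add: matrix_left_right_inverse)
  then have inv: "A ** matrix_inv A = mat 1 \<and> matrix_inv A ** A = mat 1"
    unfolding matrix_inv_def using assms
    by (intro someI[of "\<lambda>A'. A ** A' = mat 1 \<and> A' ** A = mat 1"] conjI)
  have "matrix_inv A = (matrix_inv A ** A) ** A'"
    unfolding matrix_mul_assoc[symmetric] assms by simp
  then show ?thesis using inv by simp
qed

lemma orthogonal_matrix_inv: "orthogonal_matrix (A :: real^'p^'p) \<Longrightarrow> matrix_inv A = transpose A"
  by (intro matrix_inv_unique) (simp add: orthogonal_matrix_def)

locale flat_connection =
  fixes \<omega> :: "real^'n \<Rightarrow> real^'n \<Rightarrow> real^'p^'p"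
  assumes flat: "flat_connection_on UNIV \<omega>"
begin

interpretation mm: bounded_bilinear "(**) :: real^'p^'p \<Rightarrow> real^'p^'p \<Rightarrow> real^'p^'p"
  by (rule bounded_bilinear_matrix_mult)

lemma linear_form: "linear (\<omega> x)"
  and smooth_form: "smooth_on UNIV (\<lambda>x. \<omega> x v)"
  and flat_eq: "ext_d \<omega> x u v + wedge_mat \<omega> \<omega> x u v = 0"
  using flat by (auto simp: flat_connection_on_def smooth_1form_on_def)

lemma C1_form: "Ck_on 1 UNIV (\<lambda>x. \<omega> x v)"
  using smooth_form unfolding smooth_on_def by blast

lemma linear_picard_form: "linear (\<lambda>v. (A :: real^'p^'p) ** \<omega> x v)"
  using linear_form[of x] by (auto simp: linear_iff mm.add_right mm.scaleR_right)

lemma picard_C1: "Ck_on 1 UNIV (picard \<omega> k)"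
proof (induction k)
  case 0
  show ?case using Ck_on_const[of 1 UNIV "mat 1 :: real^'p^'p"] by simp
next
  case (Suc k)
  have "Ck_on 1 UNIV (\<lambda>x. integral {0..1} (\<lambda>t. picard \<omega> k (t *\<^sub>R x) ** \<omega> (t *\<^sub>R x) x))"
    by (rule radial_primitive(2) linear_picard_form mm.Ck_on_prod open_UNIV Suc C1_form)+
  from Ck_on_add[OF open_UNIV Ck_on_const this, of "mat 1"] show ?case by simp
qed

definition err :: "nat \<Rightarrow> real^'n \<Rightarrow> real^'n \<Rightarrow> real^'p^'p" where
  "err k x v = frechet_derivative (picard \<omega> k) (at x) v - picard \<omega> k x ** \<omega> x v"

text \<open>For every matrix map \<open>A\<close>, \<open>d(A \<omega>) = (dA - A \<omega>) \<and>
  \<omega> + A (d\<omega> + \<omega> \<and> \<omega>)\<close>. Flatness removes the last term, so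
  only the error is left.\<close>

lemma ext_d_picard_form:
  "ext_d (\<lambda>y v. picard \<omega> k y ** \<omega> y v) y u v = err k y u ** \<omega> y v - err k y v ** \<omega> y u"
proof -
  let ?A = "picard \<omega> k" and ?D = "\<lambda>u v. frechet_derivative (\<lambda>y. \<omega> y v) (at y) u"
  have "((\<lambda>y. ?A y ** \<omega> y v) has_derivative
      (\<lambda>u. ?A y ** ?D u v + frechet_derivative ?A (at y) u ** \<omega> y v)) (at y)" for v
    by (intro mm.FDERIV frechet_derivative_works[THEN iffD1] Ck_on_1_differentiable[OF picard_C1]
      Ck_on_1_differentiable[OF C1_form] UNIV_I)
  from frechet_derivative_at[OF this, symmetric]
  have "frechet_derivative (\<lambda>y. ?A y ** \<omega> y v) (at y) u = ?A y ** ?D u v + frechet_derivative ?A (at y) u ** \<omega> y v" for u v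
    by (rule fun_cong)
  then have "ext_d (\<lambda>y v. ?A y ** \<omega> y v) y u v
      = (?A y ** ?D u v + frechet_derivative ?A (at y) u ** \<omega> y v)
        - (?A y ** ?D v u + frechet_derivative ?A (at y) v ** \<omega> y u)"
    unfolding ext_d_def by simp
  also have "\<dots> = err k y u ** \<omega> y v - err k y v ** \<omega> y u
      + ?A y ** (ext_d \<omega> y u v + wedge_mat \<omega> \<omega> y u v)"
    unfolding ext_d_def wedge_mat_def err_def
    by (simp add: mm.diff_left mm.diff_right mm.add_right matrix_mul_assoc)
  finally show ?thesis by (simp add: flat_eq)
qed

lemma picard_Suc_has_derivative:
  "(picard \<omega> (Suc k) has_derivative (\<lambda>v. picard \<omega> k x ** \<omega> x v +
    integral {0..1} (\<lambda>t. t *\<^sub>R (err k (t *\<^sub>R x) v ** \<omega> (t *\<^sub>R x) x - err k (t *\<^sub>R x) x ** \<omega> (t *\<^sub>R x) v)))) (at x)"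
proof -
  have "((\<lambda>x. integral {0..1} (\<lambda>t. picard \<omega> k (t *\<^sub>R x) ** \<omega> (t *\<^sub>R x) x)) has_derivative
    (\<lambda>v. picard \<omega> k x ** \<omega> x v + integral {0..1}
      (\<lambda>t. t *\<^sub>R ext_d (\<lambda>y v. picard \<omega> k y ** \<omega> y v) (t *\<^sub>R x) v x))) (at x)"
    by (rule radial_primitive(1) linear_picard_form mm.Ck_on_prod open_UNIV picard_C1 C1_form)+
  from has_derivative_add[OF has_derivative_const this] show ?thesis
    unfolding ext_d_picard_form by simp
qed

text \<open>The new error is driven by two things, the last increment of the iterates and the radial
  integral of the old error. The decay of the increments therefore has to be known before that of
  the errors.\<close>

lemma err_Suc:
  "err (Suc k) x v = (picard \<omega> k x - picard \<omega> (Suc k) x) ** \<omega> x v +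
    integral {0..1} (\<lambda>t. t *\<^sub>R (err k (t *\<^sub>R x) v ** \<omega> (t *\<^sub>R x) x - err k (t *\<^sub>R x) x ** \<omega> (t *\<^sub>R x) v))"
  unfolding err_def[of "Suc k"] frechet_derivative_at[OF picard_Suc_has_derivative, symmetric]
  by (simp only: mm.diff_left) simp

lemma continuous_picard: "continuous_on UNIV (picard \<omega> k)"
  by (rule Ck_on_1_continuous[OF picard_C1])

lemma continuous_form: "continuous_on UNIV (\<lambda>x. \<omega> x v)"
  by (rule Ck_on_1_continuous[OF C1_form])

lemma continuous_err: "continuous_on UNIV (\<lambda>x. err k x v)"
  unfolding err_def
  by (intro continuous_on_diff continuous_on_frechet_derivative picard_C1 mm.continuous_on
    continuous_picard continuous_form)

lemma form_bound:
  obtains C where "0 < C"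
    "\<And>x v A. norm x \<le> R \<Longrightarrow> norm ((A :: real^'p^'p) ** \<omega> x v) \<le> C * norm A * norm v"
proof -
  have "\<exists>c. \<forall>x\<in>cball 0 R. norm (\<omega> x (axis j 1)) \<le> c" for j
  proof -
    have "compact ((\<lambda>x. \<omega> x (axis j 1)) ` cball 0 R)"
      by (intro compact_continuous_image continuous_on_subset[OF continuous_form]) auto
    from compact_imp_bounded[OF this] show ?thesis by (auto simp: bounded_iff)
  qed
  then obtain c where c: "\<And>j x. norm x \<le> R \<Longrightarrow> norm (\<omega> x (axis j 1)) \<le> c j"
    by (metis mem_cball_0)
  from mm.pos_bounded obtain K where K: "0 < K" "\<And>A B. norm ((A :: real^'p^'p) ** (B :: real^'p^'p)) \<le> norm A * norm B * K"
    by auto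
  \<comment> \<open>Adding 1 keeps \<open>C\<close> positive even for a vanishing form; it later
    occurs as a divisor.\<close>
  define C where "C = K * (1 + \<bar>\<Sum>j\<in>UNIV. c j\<bar>)"
  have "norm (A ** \<omega> x v) \<le> C * norm A * norm v" if x: "norm x \<le> R" for x v and A :: "real^'p^'p"
  proof -
    have "norm (\<omega> x v) = norm (\<Sum>j\<in>UNIV. v $ j *\<^sub>R \<omega> x (axis j 1))"
      using linear_eq_sum_axis[OF linear_form, of x v] by simp
    also have "\<dots> \<le> (\<Sum>j\<in>UNIV. norm v * c j)"
    proof (rule sum_norm_le)
      show "norm (v $ j *\<^sub>R \<omega> x (axis j 1)) \<le> norm v * c j" for j
        unfolding norm_scaleR using component_le_norm_cart[of v j] c[OF x, of j]
        by (intro mult_mono) auto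
    qed
    also have "\<dots> \<le> norm v * (1 + \<bar>\<Sum>j\<in>UNIV. c j\<bar>)"
      unfolding sum_distrib_left[symmetric] by (intro mult_left_mono) auto
    finally have "norm A * norm (\<omega> x v) * K \<le> norm A * (norm v * (1 + \<bar>\<Sum>j\<in>UNIV. c j\<bar>)) * K"
      using K(1) by (intro mult_right_mono mult_left_mono) auto
    then show ?thesis using K(2)[of A "\<omega> x v"] by (simp add: C_def mult_ac)
  qed
  moreover have "0 < C" using K(1) by (simp add: C_def add_pos_nonneg)
  ultimately show ?thesis using that by blast
qed

text \<open>The weight \<open>exp (L * norm x)\<close> with \<open>L = 4 * C\<close> makes the recursions for the increments
  of the Picard iterates and for their errors contracting at the same time.\<close>

lemma picard_bounds:
  assumes "0 \<le> R"
  obtains M where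
    "\<And>k x. norm x \<le> R \<Longrightarrow> norm (picard \<omega> (Suc k) x - picard \<omega> k x) \<le> M * (3/4)^k"
    "\<And>k x v. norm x \<le> R \<Longrightarrow> norm (err k x v) \<le> M * (3/4)^k * norm v"
proof -
  obtain C where C: "0 < C"
    "\<And>x v A. norm x \<le> R \<Longrightarrow> norm ((A :: real^'p^'p) ** \<omega> x v) \<le> C * norm A * norm v"
    using form_bound by blast
  define L where "L = 4 * C"
  have L: "0 < L" using C(1) by (simp add: L_def)
  \<comment> \<open>Increments shrink by \<open>C / L = 1/4\<close> per step, errors by
    \<open>2 * C / L = 1/2\<close>; the quarter left up to \<open>3/4\<close> absorbs the increment
    that feeds the error.\<close>
  define q :: real where "q = 3/4"
  define \<delta> where "\<delta> k x = picard \<omega> (Suc k) x - picard \<omega> k x" for k x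
  have \<delta>cont: "continuous_on UNIV (\<delta> k)" for k
    unfolding \<delta>_def by (intro continuous_on_diff continuous_picard)
  \<comment> \<open>The constant \<open>mat 1\<close> cancels, so the increments obey the
    homogeneous recursion.\<close>
  have \<delta>_Suc: "\<delta> (Suc k) x = integral {0..1} (\<lambda>t. \<delta> k (t *\<^sub>R x) ** \<omega> (t *\<^sub>R x) x)" for k x
  proof -
    have "\<delta> (Suc k) x = integral {0..1} (\<lambda>t. picard \<omega> (Suc k) (t *\<^sub>R x) ** \<omega> (t *\<^sub>R x) x)
        - integral {0..1} (\<lambda>t. picard \<omega> k (t *\<^sub>R x) ** \<omega> (t *\<^sub>R x) x)"
      unfolding \<delta>_def picard.simps(2)[of \<omega> "Suc k"] by (subst (2) picard.simps(2)) simp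
    also have "\<dots> = integral {0..1} (\<lambda>t. picard \<omega> (Suc k) (t *\<^sub>R x) ** \<omega> (t *\<^sub>R x) x
        - picard \<omega> k (t *\<^sub>R x) ** \<omega> (t *\<^sub>R x) x)"
      by (intro Henstock_Kurzweil_Integration.integral_diff[symmetric] integrable_continuous_real
        mm.continuous_on continuous_on_compose_scaleR continuous_picard continuous_form)
    finally show ?thesis by (simp only: \<delta>_def mm.diff_left)
  qed
  have small: "norm (t *\<^sub>R x) \<le> R" "norm (t *\<^sub>R x) = t * norm x"
    if "0 \<le> t" "t \<le> 1" "norm x \<le> R" for t and x :: "real^'n"
    using that mult_left_le_one_le[of "norm x" t] by auto
  have "compact (\<delta> 0 ` cball 0 R)"
    by (intro compact_continuous_image continuous_on_subset[OF \<delta>cont]) auto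
  from compact_imp_bounded[OF this] obtain M0 where M0: "0 < M0" "\<And>x. norm x \<le> R \<Longrightarrow> norm (\<delta> 0 x) \<le> M0"
    unfolding bounded_pos by auto
  have \<delta>: "norm (\<delta> k x) \<le> M0 * q ^ k * exp (L * norm x)" if "norm x \<le> R" for k x
    using that
  proof (induction k arbitrary: x)
    case 0
    have "norm (\<delta> 0 x) \<le> M0 * 1" using M0(2)[OF 0] by simp
    also have "\<dots> \<le> M0 * exp (L * norm x)" using M0(1) L by (intro mult_left_mono) auto
    finally show ?case by simp
  next
    case (Suc k)
    have "norm (\<delta> (Suc k) x) \<le> (C * (M0 * q ^ k)) / L * exp (L * norm x)"
      unfolding \<delta>_Suc
    proof (rule radial_exp_bound)
      show "(\<lambda>t. \<delta> k (t *\<^sub>R x) ** \<omega> (t *\<^sub>R x) x) integrable_on {0..1}"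
        by (intro integrable_continuous_real mm.continuous_on continuous_on_compose_scaleR \<delta>cont continuous_form)
    next
      fix t :: real assume t: "0 \<le> t" "t \<le> 1"
      note tx = small[OF t Suc.prems]
      have "norm (\<delta> k (t *\<^sub>R x) ** \<omega> (t *\<^sub>R x) x) \<le> C * norm (\<delta> k (t *\<^sub>R x)) * norm x"
        by (rule C(2)[OF tx(1)])
      also have "\<dots> \<le> C * (M0 * q ^ k * exp (L * norm (t *\<^sub>R x))) * norm x"
        using Suc.IH[OF tx(1)] C(1) by (intro mult_right_mono mult_left_mono) auto
      finally show "norm (\<delta> k (t *\<^sub>R x) ** \<omega> (t *\<^sub>R x) x) \<le> C * (M0 * q ^ k) * (norm x * exp (L * (t * norm x)))"
        unfolding tx(2) by (simp add: mult_ac)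
    qed (use L C(1) M0(1) in \<open>auto simp: q_def\<close>)
    also have "(C * (M0 * q ^ k)) / L = (M0 * q ^ k) * (1/4)"
      using C(1) by (simp add: L_def)
    also have "\<dots> \<le> (M0 * q ^ k) * q"
      using M0(1) by (intro mult_left_mono) (auto simp: q_def)
    finally show ?case by (simp add: mult_ac mult_right_mono)
  qed
  \<comment> \<open>Two demands on \<open>N\<close>: it bounds the initial error, and
    \<open>C * M0 + N / 2 \<le> N * q\<close>, which amounts to
    \<open>4 * C * M0 \<le> N\<close>.\<close>
  define N where "N = 4 * C * M0 + C * norm (mat 1 :: real^'p^'p)"
  have N: "0 < N" "4 * C * M0 \<le> N" "C * norm (mat 1 :: real^'p^'p) \<le> N"
    using C(1) M0(1) by (auto simp: N_def add_pos_nonneg)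
  have err: "norm (err k x v) \<le> N * q ^ k * exp (L * norm x) * norm v" if "norm x \<le> R" for k x v
    using that
  proof (induction k arbitrary: x v)
    case 0
    have "norm (err 0 x v) = norm (mat 1 ** \<omega> x v)"
      by (simp add: err_def)
    also have "\<dots> \<le> C * norm (mat 1 :: real^'p^'p) * norm v" by (rule C(2)[OF 0])
    also have "\<dots> \<le> (N * 1) * norm v" using N(3) by (intro mult_right_mono) auto
    also have "\<dots> \<le> (N * exp (L * norm x)) * norm v"
      using N(1) L by (intro mult_right_mono mult_left_mono) auto
    finally show ?case by simp
  next
    case (Suc k)
    define I where "I = integral {0..1} (\<lambda>t. t *\<^sub>R (err k (t *\<^sub>R x) v ** \<omega> (t *\<^sub>R x) x - err k (t *\<^sub>R x) x ** \<omega> (t *\<^sub>R x) v))"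
    have "norm I \<le> (2 * C * (N * q ^ k) * norm v) / L * exp (L * norm x)"
      unfolding I_def
    proof (rule radial_exp_bound)
      show "(\<lambda>t. t *\<^sub>R (err k (t *\<^sub>R x) v ** \<omega> (t *\<^sub>R x) x - err k (t *\<^sub>R x) x ** \<omega> (t *\<^sub>R x) v)) integrable_on {0..1}"
        by (intro integrable_continuous_real continuous_on_scaleR continuous_on_id continuous_on_diff mm.continuous_on
          continuous_on_compose_scaleR continuous_err continuous_form)
    next
      fix t :: real assume t: "0 \<le> t" "t \<le> 1"
      note tx = small[OF t Suc.prems]
      have b: "norm (err k (t *\<^sub>R x) u ** \<omega> (t *\<^sub>R x) w) \<le> C * (N * q ^ k * exp (L * norm (t *\<^sub>R x)) * norm u) * norm w" for u w
        using order_trans[OF C(2)[OF tx(1)] mult_right_mono[OF mult_left_mono[OF Suc.IH[OF tx(1)]]]] C(1) by simp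
      have "norm (t *\<^sub>R (err k (t *\<^sub>R x) v ** \<omega> (t *\<^sub>R x) x - err k (t *\<^sub>R x) x ** \<omega> (t *\<^sub>R x) v))
        \<le> norm (err k (t *\<^sub>R x) v ** \<omega> (t *\<^sub>R x) x - err k (t *\<^sub>R x) x ** \<omega> (t *\<^sub>R x) v)"
        using t by (simp add: mult_left_le_one_le)
      also have "\<dots> \<le> C * (N * q ^ k * exp (L * norm (t *\<^sub>R x)) * norm v) * norm x
          + C * (N * q ^ k * exp (L * norm (t *\<^sub>R x)) * norm x) * norm v"
        by (intro order_trans[OF norm_triangle_ineq4] add_mono b)
      finally show "norm (t *\<^sub>R (err k (t *\<^sub>R x) v ** \<omega> (t *\<^sub>R x) x - err k (t *\<^sub>R x) x ** \<omega> (t *\<^sub>R x) v))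
        \<le> 2 * C * (N * q ^ k) * norm v * (norm x * exp (L * (t * norm x)))"
        unfolding tx(2) by (simp add: mult_ac)
    qed (use L C(1) N(1) in \<open>auto simp: q_def\<close>)
    also have "(2 * C * (N * q ^ k) * norm v) / L = N / 2 * (q ^ k * norm v)"
      using C(1) by (simp add: L_def)
    finally have I: "norm I \<le> N / 2 * (q ^ k * norm v) * exp (L * norm x)" .
    have "err (Suc k) x v = - \<delta> k x ** \<omega> x v + I"
      unfolding err_Suc I_def \<delta>_def by simp
    then have "norm (err (Suc k) x v) \<le> norm (- \<delta> k x ** \<omega> x v) + norm I"
      using norm_triangle_ineq by metis
    also have "\<dots> \<le> C * norm (- \<delta> k x) * norm v + N / 2 * (q ^ k * norm v) * exp (L * norm x)"
      by (intro add_mono I C(2)[OF Suc.prems])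
    also have "\<dots> \<le> C * (M0 * q ^ k * exp (L * norm x)) * norm v + N / 2 * (q ^ k * norm v) * exp (L * norm x)"
      using \<delta>[OF Suc.prems, of k] C(1)
      by (intro add_mono mult_right_mono mult_left_mono) (auto simp: q_def)
    also have "\<dots> = (C * M0 + N / 2) * (q ^ k * norm v * exp (L * norm x))"
      by (simp add: algebra_simps)
    also have "\<dots> \<le> (N * q) * (q ^ k * norm v * exp (L * norm x))"
      using N(2) by (intro mult_right_mono) (auto simp: q_def)
    finally show ?case by (simp add: mult_ac)
  qed
  define E where "E = exp (L * R)"
  have E: "exp (L * norm x) \<le> E" if "norm x \<le> R" for x :: "real^'n"
    using that L by (simp add: E_def)
  show ?thesis
  proof (rule that[of "max M0 N * E"])
    fix k x assume x: "norm (x :: real^'n) \<le> R"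
    have "norm (\<delta> k x) \<le> M0 * q ^ k * exp (L * norm x)" by (rule \<delta>[OF x])
    also have "\<dots> \<le> (max M0 N * q ^ k) * E"
      using E[OF x] M0(1) by (intro mult_mono) (auto simp: q_def)
    finally show "norm (picard \<omega> (Suc k) x - picard \<omega> k x) \<le> max M0 N * E * (3/4)^k"
      by (simp add: \<delta>_def q_def mult_ac)
    fix v
    have "norm (err k x v) \<le> N * q ^ k * exp (L * norm x) * norm v" by (rule err[OF x])
    also have "\<dots> \<le> (max M0 N * q ^ k) * E * norm v"
      using E[OF x] N(1) by (intro mult_mono) (auto simp: q_def E_def)
    finally show "norm (err k x v) \<le> max M0 N * E * (3/4)^k * norm v"
      by (simp add: q_def mult_ac)
  qed
qed

text \<open>On each ball the iterates converge uniformly by the Weierstrass test, and their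
  derivatives do so because the errors vanish in the limit; the derivative therefore passes to the
  limit.\<close>

lemma picard_limit:
  obtains A where "A 0 = mat 1" "\<And>x. (A has_derivative (\<lambda>v. A x ** \<omega> x v)) (at x)"
proof -
  define A where "A x = mat 1 + (\<Sum>k. picard \<omega> (Suc k) x - picard \<omega> k x)" for x
  have tele: "(\<Sum>k<n. picard \<omega> (Suc k) x - picard \<omega> k x) = picard \<omega> n x - mat 1" for n x
    by (subst sum_lessThan_telescope) simp
  have unif: "uniform_limit (cball 0 R) (picard \<omega>) A sequentially" if R: "0 \<le> R" for R
  proof -
    obtain M where M: "\<And>k x. norm x \<le> R \<Longrightarrow> norm (picard \<omega> (Suc k) x - picard \<omega> k x) \<le> M * (3/4)^k"
      using picard_bounds[OF R] by metis
    have "uniform_limit (cball 0 R) (\<lambda>n x. \<Sum>k<n. picard \<omega> (Suc k) x - picard \<omega> k x)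
        (\<lambda>x. \<Sum>k. picard \<omega> (Suc k) x - picard \<omega> k x) sequentially"
      by (rule Weierstrass_m_test) (use M in \<open>auto intro!: summable_mult summable_geometric simp del: picard.simps\<close>)
    from uniform_limit_add[OF uniform_limit_const this, of "\<lambda>_. mat 1"] show ?thesis
      unfolding tele by (simp add: A_def[abs_def])
  qed
  have der: "(A has_derivative (\<lambda>v. A x ** \<omega> x v)) (at x)" for x
  proof -
    \<comment> \<open>The extra 1 puts \<open>x\<close> in the interior of the ball, so the
      derivative within the ball becomes a derivative at \<open>x\<close>.\<close>
    define R where "R = norm x + 1"
    have R: "0 \<le> R" by (simp add: R_def)
    obtain M where M: "\<And>k x v. norm x \<le> R \<Longrightarrow> norm (err k x v) \<le> M * (3/4)^k * norm v"
      using picard_bounds[OF R] by metis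
    obtain C where C: "0 < C" "\<And>x v A. norm x \<le> R \<Longrightarrow> norm ((A :: real^'p^'p) ** \<omega> x v) \<le> C * norm A * norm v"
      using form_bound by blast
    have "\<exists>g. \<forall>y\<in>cball 0 R. (\<lambda>n. picard \<omega> n y) \<longlonglongrightarrow> g y \<and> (g has_derivative (\<lambda>v. A y ** \<omega> y v)) (at y within cball 0 R)"
    proof (rule has_derivative_sequence)
      show "(picard \<omega> n has_derivative frechet_derivative (picard \<omega> n) (at y)) (at y within cball 0 R)" for n y
        using Ck_on_1_differentiable[OF picard_C1, of y n] has_derivative_at_withinI
        unfolding frechet_derivative_works by blast
    next
      fix e :: real assume e: "0 < e"
      have "(\<lambda>k. M * (3/4)^k) \<longlonglongrightarrow> M * 0"
        by (intro tendsto_mult tendsto_const LIMSEQ_realpow_zero) auto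
      then have "\<forall>\<^sub>F k in sequentially. M * (3/4)^k < e / 2"
        using e by (intro order_tendstoD(2)[of _ 0]) auto
      moreover have "\<forall>\<^sub>F k in sequentially. \<forall>y\<in>cball 0 R. dist (picard \<omega> k y) (A y) < e / (2 * C)"
        using uniform_limitD[OF unif[OF R]] e C(1) by simp
      ultimately show "\<forall>\<^sub>F k in sequentially. \<forall>y\<in>cball 0 R. \<forall>v.
          norm (frechet_derivative (picard \<omega> k) (at y) v - A y ** \<omega> y v) \<le> e * norm v"
      proof eventually_elim
        case (elim k)
        show ?case
        proof (intro ballI allI)
          fix y v assume "y \<in> cball (0 :: real^'n) R"
          then have y: "norm y \<le> R" by simp
          \<comment> \<open>The distance to the limiting derivative splits into the error of the
            iterate and the distance of the iterate from \<open>A\<close>; each is allowed half of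
            \<open>e\<close>.\<close>
          have "frechet_derivative (picard \<omega> k) (at y) v - A y ** \<omega> y v
            = err k y v + (picard \<omega> k y - A y) ** \<omega> y v"
            by (simp only: err_def mm.diff_left) simp
          then have "norm (frechet_derivative (picard \<omega> k) (at y) v - A y ** \<omega> y v)
            \<le> norm (err k y v) + norm ((picard \<omega> k y - A y) ** \<omega> y v)"
            using norm_triangle_ineq by metis
          also have "\<dots> \<le> M * (3/4)^k * norm v + C * norm (picard \<omega> k y - A y) * norm v"
            by (intro add_mono M[OF y] C(2)[OF y])
          also have "\<dots> \<le> e / 2 * norm v + C * (e / (2 * C)) * norm v"
            using elim \<open>y \<in> cball 0 R\<close> C(1)
            by (intro add_mono mult_right_mono mult_left_mono) (auto simp: dist_norm less_imp_le)
          also have "\<dots> = e * norm v" using C(1) by simp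
          finally show "norm (frechet_derivative (picard \<omega> k) (at y) v - A y ** \<omega> y v) \<le> e * norm v" .
        qed
      qed
    next
      show "0 \<in> cball (0 :: real^'n) R" using R by simp
      show "(\<lambda>n. picard \<omega> n 0) \<longlonglongrightarrow> A 0"
        using tendsto_uniform_limitI[OF unif[OF R]] R by simp
    qed simp
    then obtain g where g: "\<And>y. y \<in> cball 0 R \<Longrightarrow> (\<lambda>n. picard \<omega> n y) \<longlonglongrightarrow> g y"
      "\<And>y. y \<in> cball 0 R \<Longrightarrow> (g has_derivative (\<lambda>v. A y ** \<omega> y v)) (at y within cball 0 R)"
      by blast
    \<comment> \<open>The differentiable limit \<open>g\<close> is known on this ball only;
      uniqueness of limits identifies it with the globally defined \<open>A\<close>.\<close>
    have eq: "g y = A y" if "y \<in> cball 0 R" for y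
      using LIMSEQ_unique[OF g(1)[OF that] tendsto_uniform_limitI[OF unif[OF R] that]] .
    have x: "x \<in> ball 0 R" by (simp add: R_def)
    have "(g has_derivative (\<lambda>v. A x ** \<omega> x v)) (at x within ball 0 R)"
      using g(2)[of x] x by (auto intro: has_derivative_subset[OF _ ball_subset_cball])
    then have "(g has_derivative (\<lambda>v. A x ** \<omega> x v)) (at x)"
      using at_within_open[OF x] by simp
    then show ?thesis
      by (rule has_derivative_transform_within_open[OF _ open_ball x]) (use eq in auto)
  qed
  \<comment> \<open>At the origin the radial vector is 0, so every integrand vanishes.\<close>
  have "picard \<omega> n 0 = mat 1" for n
    using linear_0[OF linear_form] by (induction n) auto
  then have "A 0 = mat 1" using linear_0[OF linear_form] by (simp add: A_def)
  then show ?thesis using der that by blast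
qed

text \<open>Bootstrap through the equation: the partial derivatives of \<open>A\<close> are products
  of \<open>A\<close> with smooth maps, so each order of differentiability of \<open>A\<close>
  yields the next.\<close>

lemma smooth_trivialization:
  fixes A :: "real^'n \<Rightarrow> real^'p^'p"
  assumes der: "\<And>x. (A has_derivative (\<lambda>v. A x ** \<omega> x v)) (at x)"
  shows "smooth_on UNIV A"
proof -
  have "Ck_on r UNIV A" for r
  proof (induction r)
    case 0
    show ?case
      using der by (auto intro!: continuous_at_imp_continuous_on has_derivative_continuous)
  next
    case (Suc r)
    have "partial i A = (\<lambda>x. A x ** \<omega> x (axis i 1))" for i
      using partial_eq[OF der] by auto
    then have "Ck_on r UNIV (partial i A)" for i
      using mm.Ck_on_prod[OF open_UNIV Suc] smooth_form by (simp add: smooth_on_def)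
    then show ?case using der by (auto intro: differentiableI)
  qed
  then show ?thesis by (simp add: smooth_on_def)
qed

text \<open>For skew \<open>\<omega>\<close> the two terms \<open>A \<omega>^t A^t\<close> and
  \<open>A \<omega> A^t\<close> in the derivative of \<open>A A^t\<close> cancel, so the product
  keeps its value 1 at the origin.\<close>

lemma orthogonal_trivialization_exists:
  assumes so: "\<And>x v. \<omega> x v \<in> so_alg"
  shows "\<exists>A. is_orthogonal_trivialization \<omega> A"
proof -
  obtain A where A: "A 0 = mat 1" and der: "\<And>x. (A has_derivative (\<lambda>v. A x ** \<omega> x v)) (at x)"
    using picard_limit by blast
  have "((\<lambda>x. A x ** transpose (A x)) has_derivative (\<lambda>v. 0)) (at x within UNIV)" for x
  proof -
    have lt: "bounded_linear (transpose :: real^'p^'p \<Rightarrow> real^'p^'p)"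
      by (simp add: linear_conv_bounded_linear[symmetric] linear_iff transpose_def vec_eq_iff)
    have "((\<lambda>x. A x ** transpose (A x)) has_derivative
        (\<lambda>v. A x ** transpose (A x ** \<omega> x v) + A x ** \<omega> x v ** transpose (A x))) (at x within UNIV)"
      using mm.FDERIV[OF der bounded_linear.has_derivative[OF lt der], of x] by simp
    moreover have "transpose (\<omega> x v) = - \<omega> x v" for v
      using so[of x v] by (simp add: so_alg_def)
    then have "A x ** transpose (A x ** \<omega> x v) + A x ** \<omega> x v ** transpose (A x) = 0" for v
      by (simp add: matrix_transpose_mul mm.minus_left mm.minus_right matrix_mul_assoc)
    ultimately show ?thesis by simp
  qed
  from has_derivative_zero_unique[OF convex_UNIV this]
  have AAt: "A x ** transpose (A x) = mat 1" for x
    using A by (metis UNIV_I transpose_mat matrix_mul_lid)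
  have orth: "orthogonal_matrix (A x)" for x
    using AAt[of x] by (simp add: orthogonal_matrix_def matrix_left_right_inverse)
  have "matrix_inv (A x) ** frechet_derivative A (at x) v = \<omega> x v" for x v
  proof -
    have "matrix_inv (A x) ** A x = mat 1"
      using orthogonal_matrix_inv[OF orth] orth by (simp add: orthogonal_matrix)
    then show ?thesis
      unfolding frechet_derivative_at[OF der, symmetric] by (simp add: matrix_mul_assoc)
  qed
  then show ?thesis
    unfolding is_orthogonal_trivialization_def using smooth_trivialization[OF der] orth by blast
qed

end

section \<open>Immersions with a parallel normal frame\<close>

text \<open>The ambient index type \<open>'n + 'k\<close> forces the codimension to be
  \<open>CARD('k)\<close>, so an orthonormal normal frame indexed by \<open>'k\<close> is a basis of
  every normal space.\<close>

locale normal_framed_immersion =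
  fixes S :: "(real^'n) set" and X :: "real^'n \<Rightarrow> real^('n + 'k::finite)"
    and e :: "'k \<Rightarrow> real^'n \<Rightarrow> real^('n + 'k)"
  assumes open_S: "open S" and immersion: "immersion_on S X"
    and frame: "\<And>k. normal_field_on S X (e k)"
      "\<And>x k l. x \<in> S \<Longrightarrow> e k x \<bullet> e l x = (if k = l then 1 else 0)"
begin

abbreviation DX where "DX x \<equiv> frechet_derivative X (at x)"

abbreviation De where "De k x \<equiv> frechet_derivative (e k) (at x)"

lemma smooth_X: "smooth_on S X"
  using immersion by (simp add: immersion_on_def)

lemma smooth_e: "smooth_on S (e k)"
  and e_normal: "x \<in> S \<Longrightarrow> e k x \<in> normal_space X x"
  and e_inner: "x \<in> S \<Longrightarrow> e k x \<bullet> e l x = (if k = l then 1 else 0)"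
  using frame by (auto simp: normal_field_on_def)

lemma has_derivative_X: "x \<in> S \<Longrightarrow> (X has_derivative DX x) (at x)"
  by (rule smooth_on_has_derivative[OF smooth_X])

lemma has_derivative_e: "x \<in> S \<Longrightarrow> (e k has_derivative De k x) (at x)"
  by (rule smooth_on_has_derivative[OF smooth_e])

lemma linear_DX: "x \<in> S \<Longrightarrow> linear (DX x)"
  using has_derivative_X has_derivative_linear by blast

lemma inj_DX: "x \<in> S \<Longrightarrow> inj (DX x)"
  using immersion by (simp add: immersion_on_def)

lemma e_inner_DX: "x \<in> S \<Longrightarrow> e k x \<bullet> DX x u = 0"
  using e_normal by (auto simp: normal_space_def tangent_space_def)

lemma subspace_tangent: "x \<in> S \<Longrightarrow> subspace (tangent_space X x)"
  unfolding tangent_space_def using linear_DX linear_subspace_image subspace_UNIV by blast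

lemma normal_eq_comp: "normal_space X x = (tangent_space X x)\<^sup>\<bottom>"
  by (auto simp: normal_space_def orthogonal_comp_def orthogonal_def inner_commute)

lemma subspace_normal: "subspace (normal_space X x)"
  unfolding normal_eq_comp by (rule subspace_orthogonal_comp)

lemma dim_tangent: "x \<in> S \<Longrightarrow> dim (tangent_space X x) = CARD('n)"
  unfolding tangent_space_def
  using dim_image_eq[OF linear_DX, of x UNIV] inj_DX[of x] by simp

lemma dim_normal: "x \<in> S \<Longrightarrow> dim (normal_space X x) = CARD('k)"
proof -
  assume x: "x \<in> S"
  have "dim {y \<in> UNIV. \<forall>t \<in> tangent_space X x. orthogonal t y} + dim (tangent_space X x)
      = dim (UNIV :: (real^('n + 'k)) set)"
    by (rule dim_subspace_orthogonal_to_vectors) (use subspace_tangent[OF x] in auto)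
  moreover have "{y \<in> UNIV. \<forall>t \<in> tangent_space X x. orthogonal t y} = normal_space X x"
    by (auto simp: normal_space_def orthogonal_def inner_commute)
  ultimately show ?thesis using dim_tangent[OF x] by simp
qed

lemma normal_eq_span: "x \<in> S \<Longrightarrow> normal_space X x = span (range (\<lambda>k. e k x))"
proof -
  assume x: "x \<in> S"
  have inj: "inj (\<lambda>k. e k x)"
  proof (rule injI, rule ccontr)
    fix k l assume "e k x = e l x" "k \<noteq> l"
    then show False using e_inner[OF x, of k k] e_inner[OF x, of k l] by simp
  qed
  have "independent (range (\<lambda>k. e k x))"
  proof (rule pairwise_orthogonal_independent)
    show "pairwise orthogonal (range (\<lambda>k. e k x))"
      using e_inner[OF x] by (auto simp: pairwise_def orthogonal_def)
    show "0 \<notin> range (\<lambda>k. e k x)"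
    proof
      assume "0 \<in> range (\<lambda>k. e k x)"
      then obtain k where "e k x = 0" by (metis imageE)
      then show False using e_inner[OF x, of k k] by simp
    qed
  qed
  then have "dim (span (range (\<lambda>k. e k x))) = CARD('k)"
    using inj by (simp add: dim_eq_card_independent card_image)
  then have "span (range (\<lambda>k. e k x)) = normal_space X x"
    using e_normal[OF x] subspace_normal
    by (intro subspace_dim_equal span_minimal) (auto simp: dim_normal[OF x])
  then show ?thesis ..
qed

lemma sum_inner_e:
  "x \<in> S \<Longrightarrow> (\<Sum>k\<in>UNIV. a k *\<^sub>R e k x) \<bullet> e l x = a l"
  by (simp add: inner_sum_left e_inner if_distrib[of "\<lambda>b. _ * b"] cong: if_cong)

lemma sum_e_normal: "x \<in> S \<Longrightarrow> (\<Sum>k\<in>UNIV. a k *\<^sub>R e k x) \<in> normal_space X x"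
  by (intro subspace_sum subspace_normal subspace_scale e_normal)

lemma normal_orth_e_zero:
  assumes "x \<in> S" "w \<in> normal_space X x" "\<And>k. w \<bullet> e k x = 0"
  shows "w = 0"
proof -
  have "orthogonal w w"
    using assms(2) unfolding normal_eq_span[OF assms(1)]
    by (rule orthogonal_to_span) (use assms(3) in \<open>auto simp: orthogonal_def\<close>)
  then show ?thesis by (simp add: orthogonal_def)
qed

lemma normal_expand:
  assumes "x \<in> S" "w \<in> normal_space X x"
  shows "w = (\<Sum>k\<in>UNIV. (w \<bullet> e k x) *\<^sub>R e k x)"
proof -
  have "w - (\<Sum>k\<in>UNIV. (w \<bullet> e k x) *\<^sub>R e k x) = 0"
    by (rule normal_orth_e_zero[OF assms(1)])
      (auto simp: inner_diff_left sum_inner_e assms intro!: subspace_diff subspace_normal sum_e_normal)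
  then show ?thesis by simp
qed

text \<open>The frame spans the normal space, and a subspace is its own double orthogonal
  complement; so testing against the frame suffices.\<close>

lemma tangentI:
  assumes "x \<in> S" "\<And>k. w \<bullet> e k x = 0"
  shows "w \<in> tangent_space X x"
proof -
  have "orthogonal w \<nu>" if "\<nu> \<in> normal_space X x" for \<nu>
    using that unfolding normal_eq_span[OF assms(1)]
    by (rule orthogonal_to_span) (use assms(2) in \<open>auto simp: orthogonal_def\<close>)
  then have "w \<in> (normal_space X x)\<^sup>\<bottom>"
    by (auto simp: orthogonal_comp_def orthogonal_commute)
  then show ?thesis
    using orthogonal_comp_self[OF subspace_tangent[OF assms(1)]] by (simp add: normal_eq_comp)
qed

text \<open>Resolves the definite description in \<open>normal_part\<close>, so that the normal
  connection can be computed from inner products with the frame.\<close>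

lemma normal_part_eq:
  assumes x: "x \<in> S"
  shows "normal_part X x w = (\<Sum>k\<in>UNIV. (w \<bullet> e k x) *\<^sub>R e k x)"
  unfolding normal_part_def
proof (rule the_equality)
  have "w - (\<Sum>k\<in>UNIV. (w \<bullet> e k x) *\<^sub>R e k x) \<in> tangent_space X x"
    by (rule tangentI[OF x]) (simp add: inner_diff_left sum_inner_e x)
  then show "(\<Sum>k\<in>UNIV. (w \<bullet> e k x) *\<^sub>R e k x) \<in> normal_space X x
      \<and> w - (\<Sum>k\<in>UNIV. (w \<bullet> e k x) *\<^sub>R e k x) \<in> tangent_space X x"
    using sum_e_normal[OF x] by simp
next
  fix w' assume w': "w' \<in> normal_space X x \<and> w - w' \<in> tangent_space X x"
  then have "(w - w') \<bullet> e k x = 0" for k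
    using e_normal[OF x] by (auto simp: normal_space_def inner_commute)
  then have "w' \<bullet> e k x = w \<bullet> e k x" for k
    by (simp add: inner_diff_left)
  then show "w' = (\<Sum>k\<in>UNIV. (w \<bullet> e k x) *\<^sub>R e k x)"
    using normal_expand[OF x, of w'] w' by simp
qed

lemma parallel_frameI:
  assumes "\<And>x k l v. x \<in> S \<Longrightarrow> De k x v \<bullet> e l x = 0"
  shows "parallel_normal_frame_on S X e"
  using frame assms by (auto simp: parallel_normal_frame_on_def normal_deriv_def normal_part_eq)

end

locale parallel_framed_immersion = normal_framed_immersion S X e
  for S :: "(real^'n) set" and X :: "real^'n \<Rightarrow> real^('n + 'k::finite)"
    and e :: "'k \<Rightarrow> real^'n \<Rightarrow> real^('n + 'k)" +
  assumes parallel: "parallel_normal_frame_on S X e"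
begin

lemma e_parallel: "x \<in> S \<Longrightarrow> normal_deriv X (e k) x v = 0"
  using parallel by (auto simp: parallel_normal_frame_on_def)

lemma De_inner_e: "x \<in> S \<Longrightarrow> De k x v \<bullet> e l x = 0"
  using e_parallel[of x k v] sum_inner_e[of x "\<lambda>l. De k x v \<bullet> e l x" l]
  by (simp add: normal_deriv_def normal_part_eq)

lemma De_tangent: "x \<in> S \<Longrightarrow> De k x v \<in> tangent_space X x"
  by (rule tangentI) (auto simp: De_inner_e)

lemma normal_inner_De: "x \<in> S \<Longrightarrow> w \<in> normal_space X x \<Longrightarrow> w \<bullet> De k x v = 0"
  using De_tangent by (auto simp: normal_space_def)

text \<open>In a parallel frame the normal connection just differentiates coefficients: the
  derivative of \<open>e k\<close> is tangent, so its inner product with \<open>\<xi>\<close> drops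
  out of the product rule.\<close>

lemma normal_deriv_eq:
  assumes "normal_field_on S X \<xi>" and x: "x \<in> S"
  shows "normal_deriv X \<xi> x (axis i 1) = (\<Sum>k\<in>UNIV. partial i (\<lambda>y. \<xi> y \<bullet> e k y) x *\<^sub>R e k x)"
proof -
  have \<xi>: "smooth_on S \<xi>" "\<xi> x \<in> normal_space X x"
    using assms by (auto simp: normal_field_on_def)
  have "partial i (\<lambda>y. \<xi> y \<bullet> e k y) x = \<xi> x \<bullet> partial i (e k) x + partial i \<xi> x \<bullet> e k x" for k
    by (rule bounded_bilinear.partial_prod[OF bounded_bilinear_inner])
      (use smooth_on_differentiable \<xi>(1) smooth_e x in blast)+
  then show ?thesis
    unfolding normal_deriv_def normal_part_eq[OF x]
    using normal_inner_De[OF x \<xi>(2)] by (simp add: partial_def)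
qed

text \<open>Both iterated covariant derivatives are second partial derivatives of the coefficients
  in the parallel frame, and these commute.\<close>

lemma flat_normal_bundle: "flat_normal_bundle_on S X"
  unfolding flat_normal_bundle_on_def
proof (intro allI impI ballI)
  fix \<xi> x i j assume \<xi>: "normal_field_on S X \<xi>" and x: "x \<in> S"
  define \<phi> where "\<phi> k = (\<lambda>y. \<xi> y \<bullet> e k y)" for k
  have sm: "smooth_on S (\<phi> k)" for k
    unfolding \<phi>_def using \<xi> smooth_e open_S
    by (auto intro!: smooth_on_inner simp: normal_field_on_def)
  have second: "normal_deriv X (\<lambda>y. normal_deriv X \<xi> y (axis j 1)) x (axis i 1)
    = (\<Sum>k\<in>UNIV. partial i (partial j (\<phi> k)) x *\<^sub>R e k x)" for i j
  proof -
    let ?\<eta> = "\<lambda>y. normal_deriv X \<xi> y (axis j 1)"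
    have \<eta>: "?\<eta> y = (\<Sum>k\<in>UNIV. partial j (\<phi> k) y *\<^sub>R e k y)" if "y \<in> S" for y
      unfolding \<phi>_def by (rule normal_deriv_eq[OF \<xi> that])
    \<comment> \<open>The first covariant derivative must itself be a smooth normal field before the
      same formula applies to it.\<close>
    have "smooth_on S ?\<eta>"
      by (rule smooth_on_cong[OF open_S, of "\<lambda>y. \<Sum>k\<in>UNIV. partial j (\<phi> k) y *\<^sub>R e k y"])
        (auto intro!: smooth_on_sum smooth_on_scaleR smooth_on_partial sm smooth_e open_S simp: \<eta>)
    then have "normal_field_on S X ?\<eta>"
      using sum_e_normal by (auto simp: normal_field_on_def \<eta>)
    from normal_deriv_eq[OF this x, of i]
    have "normal_deriv X ?\<eta> x (axis i 1) = (\<Sum>k\<in>UNIV. partial i (\<lambda>y. ?\<eta> y \<bullet> e k y) x *\<^sub>R e k x)" .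
    also have "\<dots> = (\<Sum>k\<in>UNIV. partial i (partial j (\<phi> k)) x *\<^sub>R e k x)"
    proof (rule sum.cong[OF refl])
      fix k
      have "partial i (\<lambda>y. ?\<eta> y \<bullet> e k y) x = partial i (partial j (\<phi> k)) x"
        by (rule partial_cong[OF open_S x]) (simp add: \<eta> sum_inner_e)
      then show "partial i (\<lambda>y. ?\<eta> y \<bullet> e k y) x *\<^sub>R e k x = partial i (partial j (\<phi> k)) x *\<^sub>R e k x"
        by simp
    qed
    finally show ?thesis .
  qed
  show "normal_deriv X (\<lambda>y. normal_deriv X \<xi> y (axis j 1)) x (axis i 1)
      = normal_deriv X (\<lambda>y. normal_deriv X \<xi> y (axis i 1)) x (axis j 1)"
    unfolding second using partial_commute[OF open_S sm x] by simp
qed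

text \<open>Differentiate \<open>DX y u \<bullet> e k y = 0\<close> along \<open>v\<close>.\<close>

lemma weingarten:
  assumes x: "x \<in> S"
  shows "DX x u \<bullet> De k x v = - (frechet_derivative (\<lambda>y. DX y u) (at x) v \<bullet> e k x)"
proof -
  let ?Y = "\<lambda>y. DX y u"
  have "(?Y has_derivative frechet_derivative ?Y (at x)) (at x)"
    by (rule smooth_on_has_derivative[OF smooth_on_frechet_derivative[OF open_S smooth_X] x])
  from has_derivative_inner[OF this has_derivative_e[OF x, of k]]
  have "((\<lambda>y. ?Y y \<bullet> e k y) has_derivative
    (\<lambda>v. ?Y x \<bullet> De k x v + frechet_derivative ?Y (at x) v \<bullet> e k x)) (at x)" .
  moreover have "((\<lambda>y. ?Y y \<bullet> e k y) has_derivative (\<lambda>v. 0)) (at x)"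
    by (rule has_derivative_transform_within_open[OF has_derivative_const open_S x])
      (simp add: e_inner_DX inner_commute[of _ "e k _"])
  ultimately have "(\<lambda>v. ?Y x \<bullet> De k x v + frechet_derivative ?Y (at x) v \<bullet> e k x) = (\<lambda>v. 0)"
    by (rule has_derivative_unique)
  from fun_cong[OF this, of v] show ?thesis by simp
qed

text \<open>The right side does not mention the frame, so two parallel normal frames give the same
  second form. The converse compares its two frames in this way.\<close>

lemma snd_form_eq:
  assumes x: "x \<in> S"
  shows "snd_form X e x u v = - normal_part X x (frechet_derivative (\<lambda>y. DX y u) (at x) v)"
  unfolding snd_form_def normal_part_eq[OF x] weingarten[OF x] by (simp add: sum_negf)

lemma snd_form_inner: "x \<in> S \<Longrightarrow> snd_form X e x u v \<bullet> e k x = DX x u \<bullet> De k x v"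
  unfolding snd_form_def by (rule sum_inner_e)

lemma diagonal_forms_iff:
  "diagonal_forms_on S X e a c \<longleftrightarrow> (\<forall>x\<in>S. \<forall>u v.
    DX x u \<bullet> DX x v = (\<Sum>i\<in>UNIV. (a x $ i)\<^sup>2 * u $ i * v $ i) \<and>
    (\<forall>k. DX x u \<bullet> De k x v = (\<Sum>i\<in>UNIV. c x $ k $ i * u $ i * v $ i)))"
proof -
  have "snd_form X e x u v = (\<Sum>i\<in>UNIV. \<Sum>k\<in>UNIV. (c x $ k $ i * u $ i * v $ i) *\<^sub>R e k x)
    \<longleftrightarrow> (\<forall>k. DX x u \<bullet> De k x v = (\<Sum>i\<in>UNIV. c x $ k $ i * u $ i * v $ i))" if x: "x \<in> S" for x u v
  proof -
    have eq: "(\<Sum>i\<in>UNIV. \<Sum>k\<in>UNIV. (c x $ k $ i * u $ i * v $ i) *\<^sub>R e k x)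
      = (\<Sum>k\<in>UNIV. (\<Sum>i\<in>UNIV. c x $ k $ i * u $ i * v $ i) *\<^sub>R e k x)"
      by (subst sum.swap) (simp add: scaleR_sum_left)
    show ?thesis
      unfolding eq
    proof (intro iffI allI)
      fix k assume "snd_form X e x u v = (\<Sum>k\<in>UNIV. (\<Sum>i\<in>UNIV. c x $ k $ i * u $ i * v $ i) *\<^sub>R e k x)"
      then show "DX x u \<bullet> De k x v = (\<Sum>i\<in>UNIV. c x $ k $ i * u $ i * v $ i)"
        using snd_form_inner[OF x, of u v k] by (simp add: sum_inner_e[OF x])
    qed (simp add: snd_form_def)
  qed
  then show ?thesis unfolding diagonal_forms_on_def fst_form_def by auto
qed

section \<open>Diagonal fundamental forms and shape operators\<close>

context
  fixes a c assumes forms: "diagonal_forms_on S X e a c"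
begin

lemma DX_inner_DX: "x \<in> S \<Longrightarrow> DX x u \<bullet> DX x v = (\<Sum>i\<in>UNIV. (a x $ i)\<^sup>2 * u $ i * v $ i)"
  and DX_inner_De: "x \<in> S \<Longrightarrow> DX x u \<bullet> De k x v = (\<Sum>i\<in>UNIV. c x $ k $ i * u $ i * v $ i)"
  using forms unfolding diagonal_forms_iff by auto

lemma partial_X_inner:
  "x \<in> S \<Longrightarrow> partial i X x \<bullet> partial j X x = (if i = j then (a x $ i)\<^sup>2 else 0)"
  unfolding partial_def by (simp add: DX_inner_DX axis_def if_distrib[of "\<lambda>b. _ * b"] cong: if_cong)

lemma partial_X_inner_partial_e:
  "x \<in> S \<Longrightarrow> partial i X x \<bullet> partial j (e k) x = (if i = j then c x $ k $ i else 0)"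
  unfolding partial_def by (simp add: DX_inner_De axis_def if_distrib[of "\<lambda>b. _ * b"] cong: if_cong)

text \<open>A vanishing coefficient would make the \<open>i\<close>-th partial derivative of
  \<open>X\<close> zero, against the injectivity of \<open>DX\<close>.\<close>

lemma metric_nonzero: "x \<in> S \<Longrightarrow> a x $ i \<noteq> 0"
proof
  assume x: "x \<in> S" and "a x $ i = 0"
  then have "DX x (axis i 1) = DX x 0"
    using partial_X_inner[OF x, of i i] linear_0[OF linear_DX[OF x]] by (simp add: partial_def)
  then have "axis i 1 = (0 :: real^'n)" using inj_DX[OF x] by (simp only: inj_eq)
  then show False by (metis axis_eq_0_iff zero_neq_one)
qed

text \<open>Both forms are diagonal in the coordinates, so the defining equation decouples into
  \<open>a_i^2 w_i = d_i u_i\<close>; since the \<open>a_i\<close> are non-zero, the solution is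
  unique.\<close>

lemma shape_operator_eq:
  assumes x: "x \<in> S"
  shows "shape_operator X x (\<Sum>k\<in>UNIV. \<nu> k *\<^sub>R e k x) u
    = (\<chi> i. (\<Sum>k\<in>UNIV. \<nu> k * c x $ k $ i) / (a x $ i)\<^sup>2 * u $ i)"
proof -
  let ?d = "\<lambda>i. \<Sum>k\<in>UNIV. \<nu> k * c x $ k $ i"
  have "- (frechet_derivative (\<lambda>y. DX y z) (at x) u \<bullet> (\<Sum>k\<in>UNIV. \<nu> k *\<^sub>R e k x))
    = (\<Sum>k\<in>UNIV. \<nu> k * (DX x z \<bullet> De k x u))" for z
    by (simp add: inner_sum_right weingarten[OF x] sum_negf)
  also have "\<dots> z = (\<Sum>i\<in>UNIV. ?d i * u $ i * z $ i)" for z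
    unfolding DX_inner_De[OF x] sum_distrib_left sum_distrib_right
    by (subst sum.swap) (simp add: mult_ac)
  finally have rhs: "- (frechet_derivative (\<lambda>y. DX y z) (at x) u \<bullet> (\<Sum>k\<in>UNIV. \<nu> k *\<^sub>R e k x))
    = (\<Sum>i\<in>UNIV. ?d i * u $ i * z $ i)" for z .
  show ?thesis
    unfolding shape_operator_def rhs DX_inner_DX[OF x]
  proof (rule the_equality)
    show "\<forall>z. (\<Sum>i\<in>UNIV. (a x $ i)\<^sup>2 * (\<chi> i. ?d i / (a x $ i)\<^sup>2 * u $ i) $ i * z $ i) = (\<Sum>i\<in>UNIV. ?d i * u $ i * z $ i)"
      using metric_nonzero[OF x] by simp
  next
    fix w assume w: "\<forall>z. (\<Sum>i\<in>UNIV. (a x $ i)\<^sup>2 * w $ i * z $ i) = (\<Sum>i\<in>UNIV. ?d i * u $ i * z $ i)"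
    have "(a x $ i)\<^sup>2 * w $ i = ?d i * u $ i" for i
      using w[rule_format, of "axis i 1"] by (simp add: axis_def if_distrib[of "\<lambda>b. _ * b"] cong: if_cong)
    then show "w = (\<chi> i. ?d i / (a x $ i)\<^sup>2 * u $ i)"
      using metric_nonzero[OF x] by (simp add: vec_eq_iff field_simps)
  qed
qed

lemma shape_operators_eq:
  assumes x: "x \<in> S"
  shows "(\<lambda>\<nu>. matrix (shape_operator X x \<nu>)) ` normal_space X x
    = range (\<lambda>\<nu>. \<chi> i j. if i = j then (\<Sum>k\<in>UNIV. \<nu> k * c x $ k $ i) / (a x $ i)\<^sup>2 else 0)"
proof -
  have "normal_space X x = range (\<lambda>\<nu>. \<Sum>k\<in>UNIV. \<nu> k *\<^sub>R e k x)"
  proof (intro equalityI subsetI)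
    fix w assume "w \<in> normal_space X x"
    from normal_expand[OF x this] show "w \<in> range (\<lambda>\<nu>. \<Sum>k\<in>UNIV. \<nu> k *\<^sub>R e k x)"
      by (rule range_eqI[where x="\<lambda>k. w \<bullet> e k x"])
  qed (auto intro: sum_e_normal[OF x])
  then show ?thesis
    by (simp add: image_image matrix_def shape_operator_eq[OF x] axis_def if_distrib[of "\<lambda>b. _ * b"] eq_commute cong: if_cong)
qed

text \<open>If every list of coefficients is attained, the shape operators are exactly the diagonal
  matrices, a space of dimension \<open>CARD('n)\<close>.\<close>

lemma nondegenerateI:
  assumes "\<And>x d. x \<in> S \<Longrightarrow> \<exists>\<nu>. \<forall>i. (\<Sum>k\<in>UNIV. \<nu> k * c x $ k $ i) = d i"
  shows "nondegenerate_normal_bundle_on S X"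
  unfolding nondegenerate_normal_bundle_on_def
proof
  fix x assume x: "x \<in> S"
  define diag :: "real^'n \<Rightarrow> real^'n^'n" where "diag d = (\<chi> i j. if i = j then d $ i else 0)" for d
  have "range (\<lambda>\<nu>. \<chi> i j. if i = j then (\<Sum>k\<in>UNIV. \<nu> k * c x $ k $ i) / (a x $ i)\<^sup>2 else 0) = range diag"
  proof (intro equalityI subsetI)
    fix M assume "M \<in> range diag"
    then obtain d where d: "M = diag d" by blast
    \<comment> \<open>Prescaled by the metric, which the shape operator divides out again.\<close>
    obtain \<nu> where "\<forall>i. (\<Sum>k\<in>UNIV. \<nu> k * c x $ k $ i) = d $ i * (a x $ i)\<^sup>2"
      using assms[OF x, of "\<lambda>i. d $ i * (a x $ i)\<^sup>2"] by blast
    then have "M = (\<chi> i j. if i = j then (\<Sum>k\<in>UNIV. \<nu> k * c x $ k $ i) / (a x $ i)\<^sup>2 else 0)"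
      using metric_nonzero[OF x] by (simp add: d diag_def vec_eq_iff)
    then show "M \<in> range (\<lambda>\<nu>. \<chi> i j. if i = j then (\<Sum>k\<in>UNIV. \<nu> k * c x $ k $ i) / (a x $ i)\<^sup>2 else 0)"
      by blast
  next
    fix M assume "M \<in> range (\<lambda>\<nu>. \<chi> i j. if i = j then (\<Sum>k\<in>UNIV. \<nu> k * c x $ k $ i) / (a x $ i)\<^sup>2 else 0)"
    then obtain \<nu> where "M = (\<chi> i j. if i = j then (\<Sum>k\<in>UNIV. \<nu> k * c x $ k $ i) / (a x $ i)\<^sup>2 else 0)"
      by blast
    then have "M = diag (\<chi> i. (\<Sum>k\<in>UNIV. \<nu> k * c x $ k $ i) / (a x $ i)\<^sup>2)"
      by (simp add: diag_def vec_eq_iff)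
    then show "M \<in> range diag" by blast
  qed
  moreover have "linear diag"
    by (simp add: linear_iff diag_def vec_eq_iff)
  moreover have "inj diag"
    by (auto simp: inj_def diag_def vec_eq_iff split: if_splits)
  ultimately show "dim ((\<lambda>\<nu>. matrix (shape_operator X x \<nu>)) ` normal_space X x) = CARD('n)"
    unfolding shape_operators_eq[OF x] using dim_image_eq[of diag UNIV] by simp
qed

text \<open>If row entries at place \<open>i\<close> vanished for all \<open>k\<close>, all shape
  operators would be diagonal matrices with a zero at \<open>i\<close>, hence lie in a space of
  dimension at most \<open>CARD('n) - 1\<close>.\<close>

lemma nondegenerateD:
  assumes "nondegenerate_normal_bundle_on S X" and x: "x \<in> S"
  shows "\<exists>k. c x $ k $ i \<noteq> 0"
proof (rule ccontr)
  assume "\<not> (\<exists>k. c x $ k $ i \<noteq> 0)"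
  then have z: "c x $ k $ i = 0" for k by blast
  define diag :: "real^'n \<Rightarrow> real^'n^'n" where "diag d = (\<chi> i j. if i = j then d $ i else 0)" for d
  let ?H = "{d :: real^'n. axis i 1 \<bullet> d = 0}"
  have "range (\<lambda>\<nu>. \<chi> i j. if i = j then (\<Sum>k\<in>UNIV. \<nu> k * c x $ k $ i) / (a x $ i)\<^sup>2 else 0) \<subseteq> diag ` ?H"
  proof
    fix M assume "M \<in> range (\<lambda>\<nu>. \<chi> i j. if i = j then (\<Sum>k\<in>UNIV. \<nu> k * c x $ k $ i) / (a x $ i)\<^sup>2 else 0)"
    then obtain \<nu> where M: "M = (\<chi> i j. if i = j then (\<Sum>k\<in>UNIV. \<nu> k * c x $ k $ i) / (a x $ i)\<^sup>2 else 0)"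
      by blast
    show "M \<in> diag ` ?H"
      by (rule image_eqI[where x="\<chi> i. (\<Sum>k\<in>UNIV. \<nu> k * c x $ k $ i) / (a x $ i)\<^sup>2"])
        (auto simp: M diag_def vec_eq_iff z inner_axis')
  qed
  then have "CARD('n) \<le> dim (diag ` ?H)"
    using assms(1) x dim_subset unfolding nondegenerate_normal_bundle_on_def shape_operators_eq[OF x, symmetric]
    by metis
  also have "\<dots> \<le> dim ?H"
    by (rule dim_image_le) (simp add: linear_iff diag_def vec_eq_iff)
  also have "\<dots> = CARD('n) - 1"
    using dim_hyperplane[of "axis i 1 :: real^'n"] by simp
  finally show False using zero_less_card_finite[where 'a='n] by linarith
qed

end

end

lemma parallel_framed_immersionI:
  assumes "open S" "immersion_on S X" "parallel_normal_frame_on S X e"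
  shows "parallel_framed_immersion S X e"
  using assms by unfold_locales (auto simp: parallel_normal_frame_on_def)

section \<open>From solutions of the system to tuples\<close>

lemma sum_UNIV_Plus:
  fixes f :: "'a::finite + 'b::finite \<Rightarrow> 'c::comm_monoid_add"
  shows "(\<Sum>z\<in>UNIV. f z) = (\<Sum>i\<in>UNIV. f (Inl i)) + (\<Sum>k\<in>UNIV. f (Inr k))"
  using sum.Plus[of "UNIV :: 'a set" "UNIV :: 'b set" f] by (simp add: comp_def)

lemma frechet_derivative_nth:
  fixes f :: "real^'n \<Rightarrow> real^'m^'p"
  assumes "f differentiable (at x)"
  shows "frechet_derivative f (at x) v $ a $ b = frechet_derivative (\<lambda>y. f y $ a $ b) (at x) v"
proof -
  have "((\<lambda>y. f y $ a $ b) has_derivative (\<lambda>v. frechet_derivative f (at x) v $ a $ b)) (at x)"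
    by (intro bounded_linear.has_derivative[OF bounded_linear_vec_nth] assms[unfolded frechet_derivative_works])
  from frechet_derivative_at[OF this] show ?thesis by (rule fun_cong)
qed

lemma smooth_on_matrix_nth:
  fixes f :: "real^'n \<Rightarrow> real^'m^'p"
  shows "open S \<Longrightarrow> smooth_on S f \<Longrightarrow> smooth_on S (\<lambda>y. f y $ a $ b)"
  by (intro smooth_on_vec_nth)

text \<open>Multiplication by \<open>Cmat i\<close> selects row or column \<open>i\<close>, so the
  sum over \<open>i\<close> collapses. Calculations with the connection form go through these
  entries instead of the blocks.\<close>

lemma omega_form_nth [simp]:
  "omega_form F G x v $ Inl a $ Inl b = v $ a * F x $ b $ a - v $ b * F x $ a $ b"
  "omega_form F G x v $ Inl a $ Inr l = v $ a * G x $ l $ a"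
  "omega_form F G x v $ Inr k $ Inl b = - (v $ b * G x $ k $ b)"
  "omega_form F G x v $ Inr k $ Inr l = 0"
proof -
  have if_simps: "(if P then x else 0) * (if Q then y else 0) = (if P \<and> Q then x * y else 0)"
    "(a::real) * (if P then y else 0) = (if P then a * y else 0)"
    "(if P then y else 0) * a = (if P then y * a else 0)" for P Q and x y a :: real
    by auto
  have and_delta: "(\<Sum>i\<in>UNIV. if a = i \<and> P i then f i else 0) = (if P a then f a else 0)"
    "(\<Sum>i\<in>UNIV. if i = a \<and> P i then f i else 0) = (if P a then f a else 0)"
    "(\<Sum>i\<in>UNIV. if P i \<and> a = i then f i else 0) = (if P a then f a else 0)"
    "(\<Sum>i\<in>UNIV. if P i \<and> i = a then f i else 0) = (if P a then f a else 0)"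
    for a :: 'a and P and f :: "'a \<Rightarrow> real"
    by (subst sum.cong[OF refl, of _ _ "\<lambda>i. if i = a then (if P a then f a else 0) else 0"]; auto)+
  show "omega_form F G x v $ Inl a $ Inl b = v $ a * F x $ b $ a - v $ b * F x $ a $ b"
    "omega_form F G x v $ Inl a $ Inr l = v $ a * G x $ l $ a"
    "omega_form F G x v $ Inr k $ Inl b = - (v $ b * G x $ k $ b)"
    "omega_form F G x v $ Inr k $ Inr l = 0"
    by (auto simp: omega_form_def block_mat_def matrix_matrix_mult_def Cmat_def transpose_def
      if_simps and_delta distrib_left right_diff_distrib sum.distrib sum_subtractf sum_negf)
qed

lemma vec_eq_Plus_iff:
  fixes M N :: "'a^('n::finite + 'k::finite)^('n + 'k)"
  shows "M = N \<longleftrightarrow>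
    (\<forall>a b. M $ Inl a $ Inl b = N $ Inl a $ Inl b) \<and> (\<forall>a l. M $ Inl a $ Inr l = N $ Inl a $ Inr l) \<and>
    (\<forall>k b. M $ Inr k $ Inl b = N $ Inr k $ Inl b) \<and> (\<forall>k l. M $ Inr k $ Inr l = N $ Inr k $ Inr l)"
  unfolding vec_eq_iff by (metis sum.exhaust)

lemma omega_form_so: "omega_form F G x v \<in> so_alg"
  by (simp add: so_alg_def vec_eq_Plus_iff transpose_def)

lemma linear_omega_form: "linear (omega_form F G x)"
  by (simp add: linear_iff vec_eq_Plus_iff algebra_simps)

text \<open>Serves the derivatives of matrix entries: the formula of the system holds in all but one
  or two directions, and the exceptional directions are split off as extra terms.\<close>

lemma sum_eq_sum_plus:
  fixes f g :: "'a::finite \<Rightarrow> 'b::comm_monoid_add"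
  assumes "\<And>c. f c = g c + (if c = a then p else 0)"
  shows "(\<Sum>c\<in>UNIV. f c) = (\<Sum>c\<in>UNIV. g c) + p"
  by (simp add: assms sum.distrib)

lemma sum_eq_sum_plus2:
  fixes f g :: "'a::finite \<Rightarrow> 'b::comm_monoid_add"
  assumes "\<And>c. f c = g c + (if c = a then p else 0) + (if c = b then q else 0)"
  shows "(\<Sum>c\<in>UNIV. f c) = (\<Sum>c\<in>UNIV. g c) + p + q"
  by (simp add: assms sum.distrib)

lemma Jmat_square: "Jmat ** Jmat = mat 1"
  by (simp add: Jmat_def mat_def matrix_matrix_mult_def vec_eq_iff if_distrib[of "\<lambda>a. a * _"] cong: if_cong)

section \<open>Flatness of the connection form\<close>

locale G1_system =
  fixes F :: "(real, 'n::{finite,linorder}) vec \<Rightarrow> ((real, 'n) vec, 'n) vec"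
    and G :: "(real, 'n) vec \<Rightarrow> ((real, 'n) vec, 'k::finite) vec"
    and B :: "(real, 'n) vec \<Rightarrow> ((real, 'n) vec, 'n) vec"
  assumes system: "G1_system_II UNIV F G B"
begin

lemma smooth_F: "smooth_on UNIV F" and smooth_G: "smooth_on UNIV G" and smooth_B: "smooth_on UNIV B"
  using system by (auto simp: G1_system_II_def)

lemma F_diag [simp]: "F x $ i $ i = 0"
  and B_O_n1: "B x \<in> O_n1"
  and gauss_eq: "i \<noteq> j \<Longrightarrow> partial i (\<lambda>y. F y $ i $ j) x + partial j (\<lambda>y. F y $ j $ i) x
          + (\<Sum>k\<in>UNIV. F x $ k $ i * F x $ k $ j) + (\<Sum>k\<in>UNIV. G x $ k $ i * G x $ k $ j) = 0"
  and partial_F: "i \<noteq> j \<Longrightarrow> j \<noteq> c \<Longrightarrow> i \<noteq> c \<Longrightarrow> partial c (\<lambda>y. F y $ i $ j) x = F x $ i $ c * F x $ c $ j"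
  and partial_B: "j \<noteq> c \<Longrightarrow> partial c (\<lambda>y. B y $ i $ j) x = F x $ c $ j * B x $ i $ c"
  and partial_G: "j \<noteq> c \<Longrightarrow> partial c (\<lambda>y. G y $ k $ j) x = F x $ c $ j * G x $ k $ c"
  using system by (auto simp: G1_system_II_def gl_star_def)

lemma smooth_entries:
  "smooth_on UNIV (\<lambda>y. F y $ i $ j)" "smooth_on UNIV (\<lambda>y. G y $ k $ j)" "smooth_on UNIV (\<lambda>y. B y $ i $ j)"
  by (intro smooth_on_matrix_nth open_UNIV smooth_F smooth_G smooth_B)+

lemma derivative_entry:
  fixes h :: "(real, 'n) vec \<Rightarrow> real"
  assumes "smooth_on UNIV h"
  shows "frechet_derivative h (at x) u = (\<Sum>c\<in>UNIV. u $ c * partial c h x)"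
  by (simp add: frechet_derivative_eq_sum_partial[OF smooth_on_differentiable[OF assms]])

text \<open>Since \<open>F\<close> has zero diagonal, \<open>f_ac f_cb\<close> vanishes for
  \<open>c = a\<close> and \<open>c = b\<close>, so the sum may run over all \<open>c\<close>; the
  two derivatives that the triple equation leaves open are added separately.\<close>

lemma derivative_F:
  assumes "a \<noteq> b"
  shows "frechet_derivative (\<lambda>y. F y $ a $ b) (at x) u = (\<Sum>c\<in>UNIV. u $ c * (F x $ a $ c * F x $ c $ b))
    + u $ a * partial a (\<lambda>y. F y $ a $ b) x + u $ b * partial b (\<lambda>y. F y $ a $ b) x"
proof -
  have "u $ c * partial c (\<lambda>y. F y $ a $ b) x = u $ c * (F x $ a $ c * F x $ c $ b)
    + (if c = a then u $ a * partial a (\<lambda>y. F y $ a $ b) x else 0)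
    + (if c = b then u $ b * partial b (\<lambda>y. F y $ a $ b) x else 0)" for c
    using partial_F[of a b c x] assms by auto
  then show ?thesis
    unfolding derivative_entry[OF smooth_entries(1)] by (rule sum_eq_sum_plus2)
qed

lemma derivative_G:
  "frechet_derivative (\<lambda>y. G y $ k $ a) (at x) u = (\<Sum>c\<in>UNIV. u $ c * (F x $ c $ a * G x $ k $ c))
    + u $ a * partial a (\<lambda>y. G y $ k $ a) x"
proof -
  have "u $ c * partial c (\<lambda>y. G y $ k $ a) x = u $ c * (F x $ c $ a * G x $ k $ c)
    + (if c = a then u $ a * partial a (\<lambda>y. G y $ k $ a) x else 0)" for c
    using partial_G[of a c k x] by auto
  then show ?thesis
    unfolding derivative_entry[OF smooth_entries(2)] by (rule sum_eq_sum_plus)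
qed

lemma derivative_B:
  "frechet_derivative (\<lambda>y. B y $ j $ a) (at x) u = (\<Sum>c\<in>UNIV. u $ c * (F x $ c $ a * B x $ j $ c))
    + u $ a * partial a (\<lambda>y. B y $ j $ a) x"
proof -
  have "u $ c * partial c (\<lambda>y. B y $ j $ a) x = u $ c * (F x $ c $ a * B x $ j $ c)
    + (if c = a then u $ a * partial a (\<lambda>y. B y $ j $ a) x else 0)" for c
    using partial_B[of a c j x] by auto
  then show ?thesis
    unfolding derivative_entry[OF smooth_entries(3)] by (rule sum_eq_sum_plus)
qed

lemma smooth_omega_form: "smooth_on UNIV (\<lambda>x. omega_form F G x v)"
proof -
  have "smooth_on UNIV (\<lambda>x. omega_form F G x v $ a $ b)" for a b
    by (cases a; cases b)
      (auto intro!: smooth_on_diff smooth_on_mult smooth_on_uminus smooth_entries smooth_on_const)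
  then have "smooth_on UNIV (\<lambda>x. \<chi> a b. omega_form F G x v $ a $ b)"
    by (intro smooth_on_vec_lambda open_UNIV)
  then show ?thesis by simp
qed

lemma derivative_omega_form:
  "frechet_derivative (\<lambda>y. omega_form F G y v) (at x) u $ Inl a $ Inl b
    = v $ a * frechet_derivative (\<lambda>y. F y $ b $ a) (at x) u - v $ b * frechet_derivative (\<lambda>y. F y $ a $ b) (at x) u"
  "frechet_derivative (\<lambda>y. omega_form F G y v) (at x) u $ Inl a $ Inr l
    = v $ a * frechet_derivative (\<lambda>y. G y $ l $ a) (at x) u"
  "frechet_derivative (\<lambda>y. omega_form F G y v) (at x) u $ Inr k $ Inl b
    = - (v $ b * frechet_derivative (\<lambda>y. G y $ k $ b) (at x) u)"
  "frechet_derivative (\<lambda>y. omega_form F G y v) (at x) u $ Inr k $ Inr l = 0"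
proof -
  have h: "(h has_derivative frechet_derivative h (at x)) (at x)" if "smooth_on UNIV h" for h :: "(real, 'n) vec \<Rightarrow> real"
    by (rule smooth_on_has_derivative[OF that UNIV_I])
  note d = h[OF smooth_entries(1)] h[OF smooth_entries(2)]
  note nth = frechet_derivative_nth[OF smooth_on_differentiable[OF smooth_omega_form UNIV_I]]
  note at = frechet_derivative_at[symmetric, THEN fun_cong]
  show "frechet_derivative (\<lambda>y. omega_form F G y v) (at x) u $ Inl a $ Inl b
    = v $ a * frechet_derivative (\<lambda>y. F y $ b $ a) (at x) u - v $ b * frechet_derivative (\<lambda>y. F y $ a $ b) (at x) u"
    unfolding nth omega_form_nth
    by (rule at) (intro has_derivative_diff has_derivative_mult_right d)
  show "frechet_derivative (\<lambda>y. omega_form F G y v) (at x) u $ Inl a $ Inr l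
    = v $ a * frechet_derivative (\<lambda>y. G y $ l $ a) (at x) u"
    unfolding nth omega_form_nth
    by (rule at) (intro has_derivative_mult_right d)
  show "frechet_derivative (\<lambda>y. omega_form F G y v) (at x) u $ Inr k $ Inl b
    = - (v $ b * frechet_derivative (\<lambda>y. G y $ k $ b) (at x) u)"
    unfolding nth omega_form_nth
    by (rule at) (intro has_derivative_minus has_derivative_mult_right d)
  show "frechet_derivative (\<lambda>y. omega_form F G y v) (at x) u $ Inr k $ Inr l = 0"
    unfolding nth omega_form_nth by simp
qed

lemma matrix_mult_Plus_nth:
  fixes M N :: "((real, 'n + 'k) vec, 'n + 'k) vec"
  shows "(M ** N) $ a $ b = (\<Sum>c\<in>UNIV. M $ a $ Inl c * N $ Inl c $ b) + (\<Sum>k\<in>UNIV. M $ a $ Inr k * N $ Inr k $ b)"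
  by (simp add: matrix_matrix_mult_def sum_UNIV_Plus)

text \<open>The tangential block uses the equations for \<open>F\<close>, with the Gauss equation
  entering through the sum of \<open>g_ka g_kb\<close>; the mixed blocks use the equation for
  \<open>G\<close>. In the normal block the product is symmetric in \<open>u\<close> and
  \<open>v\<close>, so its wedge vanishes.\<close>

lemma flat_omega_form: "ext_d (omega_form F G) x u v + wedge_mat (omega_form F G) (omega_form F G) x u v = 0"
proof -
  let ?W = "omega_form F G x"
  let ?f = "\<lambda>a b. F x $ a $ b" and ?g = "\<lambda>k a. G x $ k $ a"
  note expand = ext_d_def wedge_mat_def matrix_mult_Plus_nth derivative_omega_form
  have tt: "(ext_d (omega_form F G) x u v + wedge_mat (omega_form F G) (omega_form F G) x u v) $ Inl a $ Inl b = 0" for a b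
  proof (cases "a = b")
    case True
    then show ?thesis by (simp add: expand mult_ac) (rule sum.cong; simp add: algebra_simps)
  next
    case False
    \<comment> \<open>The terms with \<open>u_c v_c\<close> are symmetric and drop out of the wedge,
      the first and fourth sums cancel against those in \<open>derivative_F\<close>, and
      \<open>T\<close> settles the rest.\<close>
    have W: "(?W u ** ?W v) $ Inl a $ Inl b = v $ b * (\<Sum>c\<in>UNIV. u $ c * (?f a c * ?f c b))
      - (\<Sum>c\<in>UNIV. u $ c * v $ c * (?f a c * ?f b c)) - u $ a * v $ b * (\<Sum>c\<in>UNIV. ?f c a * ?f c b)
      + u $ a * (\<Sum>c\<in>UNIV. v $ c * (?f b c * ?f c a)) - u $ a * v $ b * (\<Sum>k\<in>UNIV. ?g k a * ?g k b)" for u v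
      unfolding matrix_mult_Plus_nth omega_form_nth sum_distrib_left sum.distrib[symmetric] sum_subtractf[symmetric]
        minus_mult_right[symmetric] sum_negf
      by (simp add: sum_distrib_left sum.distrib[symmetric] sum_subtractf[symmetric] algebra_simps)
    have T: "(\<Sum>k\<in>UNIV. ?g k a * ?g k b) = - partial a (\<lambda>y. F y $ a $ b) x - partial b (\<lambda>y. F y $ b $ a) x
        - (\<Sum>c\<in>UNIV. ?f c a * ?f c b)"
      using gauss_eq[OF False, of x] by linarith
    show ?thesis
      unfolding ext_d_def wedge_mat_def vector_add_component vector_minus_component W derivative_omega_form
        derivative_F[OF False] derivative_F[OF False[symmetric]] T
      by (simp add: algebra_simps)
  qed
  have tn: "(ext_d (omega_form F G) x u v + wedge_mat (omega_form F G) (omega_form F G) x u v) $ Inl a $ Inr l = 0" for a l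
  proof -
    have W: "(?W u ** ?W v) $ Inl a $ Inr l = u $ a * (\<Sum>c\<in>UNIV. v $ c * (?f c a * ?g l c))
      - (\<Sum>c\<in>UNIV. u $ c * v $ c * (?f a c * ?g l c))" for u v
      unfolding matrix_mult_Plus_nth omega_form_nth
      by (simp add: sum_distrib_left sum_subtractf[symmetric] algebra_simps)
    show ?thesis
      unfolding ext_d_def wedge_mat_def vector_add_component vector_minus_component W derivative_omega_form derivative_G
      by (simp add: algebra_simps)
  qed
  have nt: "(ext_d (omega_form F G) x u v + wedge_mat (omega_form F G) (omega_form F G) x u v) $ Inr l $ Inl b = 0" for b l
  proof -
    have W: "(?W u ** ?W v) $ Inr l $ Inl b = v $ b * (\<Sum>c\<in>UNIV. u $ c * (?f c b * ?g l c))
      - (\<Sum>c\<in>UNIV. u $ c * v $ c * (?f b c * ?g l c))" for u v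
      unfolding matrix_mult_Plus_nth omega_form_nth
      by (simp add: sum_distrib_left sum_subtractf[symmetric] algebra_simps)
    show ?thesis
      unfolding ext_d_def wedge_mat_def vector_add_component vector_minus_component W derivative_omega_form derivative_G
      by (simp add: algebra_simps)
  qed
  have nn: "(ext_d (omega_form F G) x u v + wedge_mat (omega_form F G) (omega_form F G) x u v) $ Inr k $ Inr l = 0" for k l
    by (simp add: expand mult_ac)
  show ?thesis
    unfolding vec_eq_Plus_iff using tt tn nt nn by simp
qed

lemma flat_connection_omega_form: "flat_connection_on UNIV (omega_form F G)"
  unfolding flat_connection_on_def smooth_1form_on_def
  using linear_omega_form smooth_omega_form flat_omega_form by blast

sublocale flat_connection "omega_form F G"
  by unfold_locales (rule flat_connection_omega_form)

lemma trivialization_omega_form: "\<exists>A. is_orthogonal_trivialization (omega_form F G) A"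
  by (rule orthogonal_trivialization_exists) (rule omega_form_so)

text \<open>\<open>J B^t J\<close> is a left inverse of \<open>B\<close> because \<open>J\<close>
  squares to 1; for square matrices it is then a right inverse too.\<close>

lemma O_n1_inverse: "Jmat ** transpose (B x) ** Jmat ** B x = mat 1" "B x ** (Jmat ** transpose (B x) ** Jmat) = mat 1"
proof -
  have "transpose (B x) ** Jmat ** B x = Jmat"
    using B_O_n1 by (simp add: O_n1_def)
  then have "Jmat ** (transpose (B x) ** Jmat ** B x) = mat 1" by (simp add: Jmat_square)
  then show "Jmat ** transpose (B x) ** Jmat ** B x = mat 1"
    by (simp add: matrix_mul_assoc)
  then show "B x ** (Jmat ** transpose (B x) ** Jmat) = mat 1"
    using matrix_left_right_inverse by blast
qed

text \<open>Reconciles the two ways in which the theorem writes the one-form, with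
  \<open>J B^{-1}\<close> and with \<open>B^t J\<close>.\<close>

lemma Jmat_inv_B: "Jmat ** matrix_inv (B x) = transpose (B x) ** Jmat"
proof -
  have "matrix_inv (B x) = Jmat ** (transpose (B x) ** Jmat)"
    using matrix_inv_unique[OF O_n1_inverse(2)] by (simp add: matrix_mul_assoc)
  then have "Jmat ** matrix_inv (B x) = (Jmat ** Jmat) ** (transpose (B x) ** Jmat)"
    by (simp add: matrix_mul_assoc)
  then show ?thesis by (simp add: Jmat_square)
qed

definition tuple_form where
  "tuple_form A x v = (\<Sum>i\<in>UNIV. v $ i *\<^sub>R (left_block (A x) ** Cmat i ** transpose (B x) ** Jmat))"

lemma tuple_form_eq_inv:
  "tuple_form A x v = (\<Sum>i\<in>UNIV. v $ i *\<^sub>R (left_block (A x) ** Cmat i ** Jmat ** matrix_inv (B x)))"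
  unfolding tuple_form_def
  by (simp add: matrix_mul_assoc[symmetric] Jmat_inv_B)

text \<open>The factor \<open>Jmat $ j $ j\<close> is the source of every sign that distinguishes
  the last immersion from the others.\<close>

lemma tuple_form_nth:
  "tuple_form A x v $ r $ j = Jmat $ j $ j * (\<Sum>i\<in>UNIV. v $ i * B x $ j $ i * A x $ r $ Inl i)"
proof -
  have C: "(left_block (A x) ** Cmat i) $ r $ c = (if c = i then A x $ r $ Inl i else 0)" for i c
    by (auto simp: left_block_def Cmat_def matrix_matrix_mult_def if_distrib[of "\<lambda>b. _ * b"] cong: if_cong)
  have CB: "(left_block (A x) ** Cmat i ** transpose (B x)) $ r $ c = A x $ r $ Inl i * B x $ c $ i" for i c
    by (subst matrix_matrix_mult_def) (simp add: C transpose_def if_distrib[of "\<lambda>b. b * _"] cong: if_cong)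
  have "(left_block (A x) ** Cmat i ** transpose (B x) ** Jmat) $ r $ j = A x $ r $ Inl i * B x $ j $ i * Jmat $ j $ j" for i
    by (subst matrix_matrix_mult_def)
      (simp add: CB Jmat_def if_distrib[of "\<lambda>b. _ * b"] cong: if_cong)
  then show ?thesis
    by (simp add: tuple_form_def sum_distrib_left mult_ac)
qed

lemma linear_tuple_form: "linear (tuple_form A x)"
  by (simp add: linear_iff vec_eq_iff tuple_form_nth algebra_simps sum.distrib sum_distrib_left)

end

locale G1_trivialization = G1_system F G B
  for F :: "(real, 'n::{finite,linorder}) vec \<Rightarrow> ((real, 'n) vec, 'n) vec"
    and G :: "(real, 'n) vec \<Rightarrow> ((real, 'n) vec, 'k::finite) vec"
    and B :: "(real, 'n) vec \<Rightarrow> ((real, 'n) vec, 'n) vec" +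
  fixes A :: "(real, 'n) vec \<Rightarrow> ((real, 'n + 'k) vec, 'n + 'k) vec"
  assumes trivialization: "is_orthogonal_trivialization (omega_form F G) A"
begin

lemma smooth_A: "smooth_on UNIV A"
  and orthogonal_A: "orthogonal_matrix (A x)"
  using trivialization by (auto simp: is_orthogonal_trivialization_def)

lemma A_has_derivative: "(A has_derivative (\<lambda>v. A x ** omega_form F G x v)) (at x)"
proof -
  have "A x ** (matrix_inv (A x) ** frechet_derivative A (at x) v) = A x ** omega_form F G x v" for v
    using trivialization by (simp add: is_orthogonal_trivialization_def)
  moreover have "A x ** matrix_inv (A x) = mat 1"
    using orthogonal_A[of x] by (simp add: orthogonal_matrix_inv orthogonal_matrix_def)
  ultimately have "frechet_derivative A (at x) = (\<lambda>v. A x ** omega_form F G x v)"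
    by (simp add: matrix_mul_assoc fun_eq_iff)
  then show ?thesis
    using smooth_on_has_derivative[OF smooth_A UNIV_I, of x] by simp
qed

text \<open>The structure equations of the moving frame formed by the columns of \<open>A\<close>.
  The second one involves tangent columns only, which is why the normal columns are
  parallel.\<close>

lemma A_nth_has_derivative:
  "((\<lambda>y. A y $ r $ Inl i) has_derivative (\<lambda>v. (\<Sum>c\<in>UNIV. A x $ r $ Inl c * (v $ c * F x $ i $ c))
      - v $ i * (\<Sum>c\<in>UNIV. A x $ r $ Inl c * F x $ c $ i) - v $ i * (\<Sum>k\<in>UNIV. A x $ r $ Inr k * G x $ k $ i))) (at x)"
  "((\<lambda>y. A y $ r $ Inr l) has_derivative (\<lambda>v. \<Sum>c\<in>UNIV. A x $ r $ Inl c * (v $ c * G x $ l $ c))) (at x)"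
proof -
  have "((\<lambda>y. A y $ r $ s) has_derivative (\<lambda>v. (A x ** omega_form F G x v) $ r $ s)) (at x)" for s
    by (intro bounded_linear.has_derivative[OF bounded_linear_vec_nth] A_has_derivative)
  from this[of "Inl i"] this[of "Inr l"]
  show "((\<lambda>y. A y $ r $ Inl i) has_derivative (\<lambda>v. (\<Sum>c\<in>UNIV. A x $ r $ Inl c * (v $ c * F x $ i $ c))
      - v $ i * (\<Sum>c\<in>UNIV. A x $ r $ Inl c * F x $ c $ i) - v $ i * (\<Sum>k\<in>UNIV. A x $ r $ Inr k * G x $ k $ i))) (at x)"
    "((\<lambda>y. A y $ r $ Inr l) has_derivative (\<lambda>v. \<Sum>c\<in>UNIV. A x $ r $ Inl c * (v $ c * G x $ l $ c))) (at x)"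
    unfolding matrix_mult_Plus_nth omega_form_nth
    by (simp_all add: sum_distrib_left right_diff_distrib sum_subtractf sum_negf mult_ac)
qed

lemma smooth_A_nth: "smooth_on UNIV (\<lambda>y. A y $ r $ s)"
  by (intro smooth_on_vec_nth open_UNIV smooth_A)

lemma smooth_tuple_form: "smooth_on UNIV (\<lambda>x. tuple_form A x v)"
proof -
  have "smooth_on UNIV (\<lambda>x. \<chi> r j. tuple_form A x v $ r $ j)"
    unfolding tuple_form_nth
    by (intro smooth_on_vec_lambda open_UNIV smooth_on_mult smooth_on_sum smooth_on_const smooth_entries smooth_A_nth)
  then show ?thesis by simp
qed

text \<open>The derivative computed in \<open>D\<close> is symmetric in \<open>u\<close> and
  \<open>v\<close>, so its antisymmetrization is 0. Off the diagonal this symmetry comes from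
  combining the equation for \<open>B\<close> with the rotation of the tangent columns.\<close>

lemma tuple_form_closed: "ext_d (tuple_form A) x u v = 0"
proof -
  have D: "frechet_derivative (\<lambda>y. tuple_form A y v) (at x) u $ r $ j = Jmat $ j $ j *
    ((\<Sum>i\<in>UNIV. \<Sum>c\<in>UNIV. (v $ i * u $ c + u $ i * v $ c) * (F x $ c $ i * B x $ j $ c * A x $ r $ Inl i))
    + (\<Sum>i\<in>UNIV. v $ i * u $ i * (partial i (\<lambda>y. B y $ j $ i) x * A x $ r $ Inl i
       - B x $ j $ i * ((\<Sum>c\<in>UNIV. A x $ r $ Inl c * F x $ c $ i) + (\<Sum>k\<in>UNIV. A x $ r $ Inr k * G x $ k $ i)))))"
    for u v r j
  proof -
    have "((\<lambda>y. Jmat $ j $ j * (\<Sum>i\<in>UNIV. v $ i * (B y $ j $ i * A y $ r $ Inl i))) has_derivative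
      (\<lambda>u. Jmat $ j $ j * (\<Sum>i\<in>UNIV. v $ i *
        (B x $ j $ i * ((\<Sum>c\<in>UNIV. A x $ r $ Inl c * (u $ c * F x $ i $ c))
      - u $ i * (\<Sum>c\<in>UNIV. A x $ r $ Inl c * F x $ c $ i) - u $ i * (\<Sum>k\<in>UNIV. A x $ r $ Inr k * G x $ k $ i))
      + frechet_derivative (\<lambda>y. B y $ j $ i) (at x) u * A x $ r $ Inl i)))) (at x)"
      by (intro has_derivative_mult_right has_derivative_sum has_derivative_mult A_nth_has_derivative
        smooth_on_has_derivative[OF smooth_entries(3) UNIV_I])
    from fun_cong[OF frechet_derivative_at[OF this, symmetric], of u]
    have "frechet_derivative (\<lambda>y. tuple_form A y v) (at x) u $ r $ j = Jmat $ j $ j * (\<Sum>i\<in>UNIV. v $ i *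
        (B x $ j $ i * ((\<Sum>c\<in>UNIV. A x $ r $ Inl c * (u $ c * F x $ i $ c))
      - u $ i * (\<Sum>c\<in>UNIV. A x $ r $ Inl c * F x $ c $ i) - u $ i * (\<Sum>k\<in>UNIV. A x $ r $ Inr k * G x $ k $ i))
      + frechet_derivative (\<lambda>y. B y $ j $ i) (at x) u * A x $ r $ Inl i))"
      unfolding frechet_derivative_nth[OF smooth_on_differentiable[OF smooth_tuple_form UNIV_I]] tuple_form_nth
      by (simp add: mult.assoc)
    also have "\<dots> = Jmat $ j $ j * (
      ((\<Sum>i\<in>UNIV. \<Sum>c\<in>UNIV. v $ i * u $ c * (F x $ i $ c * B x $ j $ i * A x $ r $ Inl c))
       + (\<Sum>i\<in>UNIV. \<Sum>c\<in>UNIV. v $ i * u $ c * (F x $ c $ i * B x $ j $ c * A x $ r $ Inl i)))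
      + (\<Sum>i\<in>UNIV. v $ i * u $ i * (partial i (\<lambda>y. B y $ j $ i) x * A x $ r $ Inl i
       - B x $ j $ i * ((\<Sum>c\<in>UNIV. A x $ r $ Inl c * F x $ c $ i) + (\<Sum>k\<in>UNIV. A x $ r $ Inr k * G x $ k $ i)))))"
      unfolding derivative_B sum.distrib[symmetric]
      by (intro arg_cong[of _ _ "\<lambda>z. _ * z"] sum.cong refl)
        (simp add: sum_distrib_left sum_distrib_right sum.distrib algebra_simps)
    \<comment> \<open>Exchanging the indices gives the frame term the same kernel
      \<open>f_ci b_jc\<close> as the term from the derivative of \<open>B\<close>, so that their
      weights add up to a symmetric one.\<close>
    also have "(\<Sum>i\<in>UNIV. \<Sum>c\<in>UNIV. v $ i * u $ c * (F x $ i $ c * B x $ j $ i * A x $ r $ Inl c))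
      = (\<Sum>i\<in>UNIV. \<Sum>c\<in>UNIV. v $ c * u $ i * (F x $ c $ i * B x $ j $ c * A x $ r $ Inl i))"
      by (rule sum.swap)
    finally show ?thesis by (simp add: sum.distrib[symmetric] algebra_simps)
  qed
  show ?thesis
    unfolding ext_d_def vec_eq_iff vector_minus_component D by (simp add: algebra_simps)
qed

lemma exact_tuple_form: "exact_on UNIV (tuple_form A)"
  by (rule poincare_lemma[OF linear_tuple_form _ tuple_form_closed])
    (use smooth_tuple_form in \<open>simp only: smooth_on_def\<close>)

end

section \<open>Geometry of the columns of X\<close>

lemma bounded_linear_column: "bounded_linear (column j :: real^'m^'n \<Rightarrow> real^'n)"
  by (simp add: linear_conv_bounded_linear[symmetric] linear_iff column_def vec_eq_iff)

lemma orthogonal_matrix_column_inner: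
  assumes "orthogonal_matrix (A :: real^'p^'p)"
  shows "column s A \<bullet> column t A = (if s = t then 1 else 0)"
proof -
  have "(transpose A ** A) $ s $ t = (mat 1 :: real^'p^'p) $ s $ t"
    using assms by (simp add: orthogonal_matrix)
  then show ?thesis
    by (simp add: matrix_matrix_mult_def transpose_def column_def inner_vec_def mat_def)
qed

lemma smooth_onI_partial:
  assumes "\<And>x. x \<in> S \<Longrightarrow> f differentiable (at x)" "\<And>i. smooth_on S (partial i f)"
  shows "smooth_on S f"
proof -
  have "Ck_on (Suc r) S f" for r using assms by (simp add: smooth_on_def)
  then show ?thesis unfolding smooth_on_def using Ck_on_SucD by blast
qed

lemma Jmat_diag_square: "(Jmat $ j $ j)\<^sup>2 = (1 :: real)" "Jmat $ j $ j * Jmat $ j $ j = (1 :: real)"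
  by (auto simp: Jmat_def)

locale G1_tuple = G1_trivialization F G B A
  for F :: "(real, 'n::{finite,linorder}) vec \<Rightarrow> ((real, 'n) vec, 'n) vec"
    and G :: "(real, 'n) vec \<Rightarrow> ((real, 'n) vec, 'k::finite) vec"
    and B :: "(real, 'n) vec \<Rightarrow> ((real, 'n) vec, 'n) vec"
    and A :: "(real, 'n) vec \<Rightarrow> ((real, 'n + 'k) vec, 'n + 'k) vec" +
  fixes X :: "(real, 'n) vec \<Rightarrow> ((real, 'n) vec, 'n + 'k) vec"
  assumes X_has_derivative: "(X has_derivative (\<lambda>v. - tuple_form A x v)) (at x)"
begin

abbreviation tuple_map where "tuple_map j \<equiv> \<lambda>x. column j (X x)"

abbreviation tangent_frame where "tangent_frame i x \<equiv> column (Inl i) (A x)"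

abbreviation normal_frame where "normal_frame k \<equiv> \<lambda>x. column (Inr k) (A x)"

lemmas frame_inner = orthogonal_matrix_column_inner[OF orthogonal_A]

lemma smooth_column_A: "smooth_on UNIV (\<lambda>x. column s (A x))"
  by (intro bounded_linear.smooth_on_compose[OF bounded_linear_column] open_UNIV smooth_A)

lemma tuple_map_has_derivative:
  "(tuple_map j has_derivative (\<lambda>v. \<Sum>i\<in>UNIV. (- (Jmat $ j $ j * v $ i * B x $ j $ i)) *\<^sub>R tangent_frame i x)) (at x)"
proof -
  have "column j (- tuple_form A x v) = (\<Sum>i\<in>UNIV. (- (Jmat $ j $ j * v $ i * B x $ j $ i)) *\<^sub>R tangent_frame i x)" for v
    by (simp add: vec_eq_iff column_def tuple_form_nth sum_distrib_left sum_negf mult_ac)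
  then show ?thesis
    using bounded_linear.has_derivative[OF bounded_linear_column X_has_derivative, of j x] by simp
qed

lemma derivative_tuple_map:
  "frechet_derivative (tuple_map j) (at x) v
    = (\<Sum>i\<in>UNIV. (- (Jmat $ j $ j * v $ i * B x $ j $ i)) *\<^sub>R tangent_frame i x)"
  using fun_cong[OF frechet_derivative_at[OF tuple_map_has_derivative, symmetric]] .

lemma derivative_normal_frame:
  "frechet_derivative (normal_frame k) (at x) v = (\<Sum>i\<in>UNIV. (v $ i * G x $ k $ i) *\<^sub>R tangent_frame i x)"
proof -
  have "column (Inr k) (A x ** omega_form F G x v) = (\<Sum>i\<in>UNIV. (v $ i * G x $ k $ i) *\<^sub>R tangent_frame i x)" for v
    by (simp add: vec_eq_iff column_def matrix_mult_Plus_nth mult_ac)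
  then have "(normal_frame k has_derivative (\<lambda>v. \<Sum>i\<in>UNIV. (v $ i * G x $ k $ i) *\<^sub>R tangent_frame i x)) (at x)"
    using bounded_linear.has_derivative[OF bounded_linear_column A_has_derivative, of "Inr k" x] by simp
  from fun_cong[OF frechet_derivative_at[OF this, symmetric]] show ?thesis .
qed

lemma tangent_combination_inner:
  "(\<Sum>i\<in>UNIV. p i *\<^sub>R tangent_frame i x) \<bullet> (\<Sum>i\<in>UNIV. q i *\<^sub>R tangent_frame i x) = (\<Sum>i\<in>UNIV. p i * q i)"
  "(\<Sum>i\<in>UNIV. p i *\<^sub>R tangent_frame i x) \<bullet> tangent_frame l x = p l"
  "(\<Sum>i\<in>UNIV. p i *\<^sub>R tangent_frame i x) \<bullet> normal_frame k x = 0"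
  by (simp_all add: inner_sum_left inner_sum_right frame_inner if_distrib[of "\<lambda>b. _ * b"] mult.commute cong: if_cong)

lemma smooth_tuple_map: "smooth_on UNIV (tuple_map j)"
proof (rule smooth_onI_partial)
  show "tuple_map j differentiable (at x)" for x
    using tuple_map_has_derivative by (rule differentiableI)
next
  fix l
  have "partial l (tuple_map j) = (\<lambda>x. (- (Jmat $ j $ j * B x $ j $ l)) *\<^sub>R tangent_frame l x)"
    unfolding partial_def derivative_tuple_map
    by (rule ext, subst sum.remove[of _ l]) (auto simp: axis_def intro!: sum.neutral)
  then show "smooth_on UNIV (partial l (tuple_map j))"
    by (simp only:) (intro smooth_on_scaleR smooth_on_uminus smooth_on_mult smooth_on_const
      smooth_entries smooth_column_A open_UNIV)
qed

text \<open>O(n,1) is closed under transposition, so the rows of \<open>B\<close> are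
  pseudo-orthonormal as well; the squared length of row \<open>j\<close> is the constant required of
  hyperbolic coordinates.\<close>

lemma B_J_Bt: "B x ** Jmat ** transpose (B x) = Jmat"
proof -
  have "B x ** (Jmat ** transpose (B x) ** Jmat) ** Jmat = Jmat"
    unfolding O_n1_inverse(2) by simp
  then show ?thesis
    by (simp add: matrix_mul_assoc[symmetric] Jmat_square)
qed

lemma row_norm: "(\<Sum>i\<in>UNIV - {last_idx}. (B x $ j $ i)\<^sup>2) - (B x $ j $ last_idx)\<^sup>2 = Jmat $ j $ j"
proof -
  have BJ: "(B x ** Jmat) $ j $ i = B x $ j $ i * Jmat $ i $ i" for i
    by (simp add: matrix_matrix_mult_def Jmat_def if_distrib[of "\<lambda>b. _ * b"] cong: if_cong)
  have "(B x ** Jmat ** transpose (B x)) $ j $ j = (\<Sum>i\<in>UNIV. (B x $ j $ i)\<^sup>2 * Jmat $ i $ i)"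
    by (subst matrix_matrix_mult_def) (simp add: BJ transpose_def power2_eq_square mult_ac)
  also have "\<dots> = (\<Sum>i\<in>UNIV - {last_idx}. (B x $ j $ i)\<^sup>2) - (B x $ j $ last_idx)\<^sup>2"
    by (subst sum.remove[of _ last_idx]) (auto simp: Jmat_def intro!: sum.cong)
  finally show ?thesis unfolding B_J_Bt by simp
qed

text \<open>\<open>J B\<close> is the matrix of the tuple: row \<open>j\<close> absorbs the sign of
  the derivative of the \<open>j\<close>-th column of \<open>X\<close>, so that all the immersions
  share the second matrix \<open>- G\<close>.\<close>

lemma J_B_O_n1: "Jmat ** B x \<in> O_n1"
proof -
  have Jt: "transpose (Jmat :: ((real, 'n) vec, 'n) vec) = Jmat"
    by (auto simp: Jmat_def transpose_def vec_eq_iff)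
  have "transpose (Jmat ** B x) ** Jmat ** (Jmat ** B x) = transpose (B x) ** (Jmat ** Jmat) ** Jmat ** B x"
    by (simp add: matrix_transpose_mul Jt matrix_mul_assoc)
  then show ?thesis
    using B_O_n1[of x] by (simp add: O_n1_def Jmat_square)
qed

lemma J_B_nth: "(Jmat ** B x) $ j $ i = Jmat $ j $ j * B x $ j $ i"
  by (simp add: matrix_matrix_mult_def Jmat_def if_distrib[of "\<lambda>b. b * _"] cong: if_cong)

context
  fixes j assumes nonzero: "\<And>x i. B x $ j $ i \<noteq> 0"
begin

lemma immersion_tuple_map: "immersion_on UNIV (tuple_map j)"
  unfolding immersion_on_def
proof (intro conjI ballI smooth_tuple_map injI)
  fix x u v assume "frechet_derivative (tuple_map j) (at x) u = frechet_derivative (tuple_map j) (at x) v"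
  then have "Jmat $ j $ j * u $ i * B x $ j $ i = Jmat $ j $ j * v $ i * B x $ j $ i" for i
    unfolding derivative_tuple_map
    using tangent_combination_inner(2)[of "\<lambda>i. - (Jmat $ j $ j * u $ i * B x $ j $ i)" x i]
      tangent_combination_inner(2)[of "\<lambda>i. - (Jmat $ j $ j * v $ i * B x $ j $ i)" x i] by simp
  moreover have "Jmat $ j $ j \<noteq> (0 :: real)" by (simp add: Jmat_def)
  ultimately show "u = v" using nonzero by (simp add: vec_eq_iff)
qed

lemma normal_frame_normal: "normal_field_on UNIV (tuple_map j) (normal_frame k)"
  unfolding normal_field_on_def normal_space_def tangent_space_def
  using smooth_column_A tangent_combination_inner(3)
  by (auto simp: derivative_tuple_map inner_commute simp del: scaleR_minus_left)

lemma parallel_normal_frame: "parallel_normal_frame_on UNIV (tuple_map j) normal_frame"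
proof -
  interpret normal_framed_immersion UNIV "tuple_map j" normal_frame
    by unfold_locales (auto intro: immersion_tuple_map normal_frame_normal simp: frame_inner)
  show ?thesis
    by (rule parallel_frameI) (simp add: derivative_normal_frame tangent_combination_inner)
qed

lemma parallel_framed_tuple_map: "parallel_framed_immersion UNIV (tuple_map j) normal_frame"
  by (rule parallel_framed_immersionI[OF open_UNIV immersion_tuple_map parallel_normal_frame])

lemma forms_tuple_map:
  "diagonal_forms_on UNIV (tuple_map j) normal_frame (\<lambda>x. Jmat $ j $ j *\<^sub>R row j (B x))
    (\<lambda>x. \<chi> k i. - (G x $ k $ i * (Jmat $ j $ j * B x $ j $ i)))"
proof -
  interpret parallel_framed_immersion UNIV "tuple_map j" normal_frame
    by (rule parallel_framed_tuple_map)
  show ?thesis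
    unfolding diagonal_forms_iff
    by (auto simp: derivative_tuple_map derivative_normal_frame tangent_combination_inner row_def
      power_mult_distrib power2_eq_square Jmat_diag_square mult_ac simp del: scaleR_minus_left intro!: sum.cong)
qed

text \<open>Up to one non-zero factor per column, the coefficient matrix of the second form is
  \<open>G\<close>. Full column rank makes the transpose of \<open>G\<close> surjective, so all
  lists of coefficients are attained.\<close>

lemma nondegenerate_tuple_map:
  assumes "\<And>x. rank (G x) = CARD('n)"
  shows "nondegenerate_normal_bundle_on UNIV (tuple_map j)"
proof -
  interpret parallel_framed_immersion UNIV "tuple_map j" normal_frame
    by (rule parallel_framed_tuple_map)
  show ?thesis
  proof (rule nondegenerateI[OF forms_tuple_map])
    fix x d
    let ?q = "\<lambda>i. - (Jmat $ j $ j * B x $ j $ i)"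
    have q: "?q i \<noteq> 0" for i using nonzero by (simp add: Jmat_def)
    have "surj ((*v) (transpose (G x)))"
      unfolding full_rank_surjective[symmetric] by (simp add: rank_transpose assms)
    then obtain \<nu> where "(\<chi> i. d i / ?q i) = transpose (G x) *v \<nu>"
      unfolding surj_def by metis
    then have "(\<Sum>k\<in>UNIV. G x $ k $ i * \<nu> $ k) = d i / ?q i" for i
      by (simp add: vec_eq_iff matrix_vector_mult_def transpose_def)
    then have "?q i * (\<Sum>k\<in>UNIV. G x $ k $ i * \<nu> $ k) = d i" for i
      using q[of i] by simp
    then have "\<forall>i. (\<Sum>k\<in>UNIV. \<nu> $ k * (\<chi> k i. - (G x $ k $ i * (Jmat $ j $ j * B x $ j $ i))) $ k $ i) = d i"
      by (simp add: sum_distrib_left mult_ac)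
    then show "\<exists>\<nu>. \<forall>i. (\<Sum>k\<in>UNIV. \<nu> k * (\<chi> k i. - (G x $ k $ i * (Jmat $ j $ j * B x $ j $ i))) $ k $ i) = d i"
      by blast
  qed
qed

lemma hyperbolic_tuple_map: "hyperbolic_curvature_coords_on UNIV (tuple_map j) normal_frame"
  unfolding hyperbolic_curvature_coords_on_def
proof (intro conjI exI bexI parallel_normal_frame forms_tuple_map)
  show "smooth_on UNIV (\<lambda>x. Jmat $ j $ j *\<^sub>R row j (B x))"
    unfolding row_def by (intro smooth_on_scaleR smooth_on_const smooth_on_vec_lambda smooth_entries open_UNIV)
  show "smooth_on UNIV (\<lambda>x. \<chi> k i. - (G x $ k $ i * (Jmat $ j $ j * B x $ j $ i)))"
    by (intro smooth_on_uminus smooth_on_mult smooth_on_const smooth_on_vec_lambda smooth_entries open_UNIV)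
  show "\<forall>x\<in>UNIV. (\<Sum>i\<in>UNIV - {last_idx}. ((Jmat $ j $ j *\<^sub>R row j (B x)) $ i)\<^sup>2)
      - ((Jmat $ j $ j *\<^sub>R row j (B x)) $ last_idx)\<^sup>2 = Jmat $ j $ j"
    using row_norm by (simp add: power_mult_distrib Jmat_diag_square row_def)
  show "Jmat $ j $ j \<in> {1, - 1 :: real}" by (simp add: Jmat_def)
qed (rule forms_tuple_map)

end

lemma tuple_core:
  assumes nonzero: "\<And>x j i. B x $ j $ i \<noteq> 0"
  shows "O_n1_tuple_core_on UNIV tuple_map"
proof -
  have framed: "parallel_framed_immersion UNIV (tuple_map j) normal_frame" for j
    by (rule parallel_framed_tuple_map[OF nonzero])
  \<comment> \<open>All the immersions share the normal columns of \<open>A\<close> as a frame, so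
    their normal spaces coincide.\<close>
  have normal: "normal_space (tuple_map j) x = span (range (\<lambda>k. normal_frame k x))" for j x
  proof -
    interpret parallel_framed_immersion UNIV "tuple_map j" normal_frame by (rule framed)
    show ?thesis by (rule normal_eq_span) simp
  qed
  have "diagonal_forms_on UNIV (tuple_map j) normal_frame (\<lambda>x. row j (Jmat ** B x))
      (\<lambda>x. \<chi> k i. (Jmat ** B x) $ j $ i * (- G x) $ k $ i)" for j
  proof -
    have "row j (Jmat ** B x) = Jmat $ j $ j *\<^sub>R row j (B x)" for x
      by (simp add: row_def vec_eq_iff J_B_nth)
    then show ?thesis
      using forms_tuple_map[OF nonzero, of j] by (simp add: J_B_nth mult_ac)
  qed
  moreover have "smooth_on UNIV (\<lambda>x. Jmat ** B x)" "smooth_on UNIV (\<lambda>x. - G x)"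
    by (intro bounded_bilinear.smooth_on_prod[OF bounded_bilinear_matrix_mult] smooth_on_const smooth_on_uminus
      smooth_B smooth_G open_UNIV)+
  ultimately have forms: "\<exists>\<beta> \<gamma>. smooth_on UNIV \<beta> \<and> smooth_on UNIV \<gamma> \<and> (\<forall>x\<in>UNIV. \<beta> x \<in> O_n1) \<and>
      (\<forall>j. diagonal_forms_on UNIV (tuple_map j) normal_frame (\<lambda>x. row j (\<beta> x)) (\<lambda>x. \<chi> k i. \<beta> x $ j $ i * \<gamma> x $ k $ i))"
    using J_B_O_n1 by blast
  show ?thesis
    unfolding O_n1_tuple_core_on_def is_domain_def
  proof (intro conjI allI ballI)
    show "flat_normal_bundle_on UNIV (tuple_map j)" for j
    proof -
      interpret parallel_framed_immersion UNIV "tuple_map j" normal_frame by (rule framed)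
      show ?thesis by (rule flat_normal_bundle)
    qed
    show "\<exists>e :: 'k \<Rightarrow> _. (\<forall>j. parallel_normal_frame_on UNIV (tuple_map j) e) \<and> (\<forall>j. hyperbolic_curvature_coords_on UNIV (tuple_map j) e) \<and>
       (\<exists>\<beta> \<gamma>. smooth_on UNIV \<beta> \<and> smooth_on UNIV \<gamma> \<and> (\<forall>x\<in>UNIV. \<beta> x \<in> O_n1) \<and>
      (\<forall>j. diagonal_forms_on UNIV (tuple_map j) e (\<lambda>x. row j (\<beta> x)) (\<lambda>x. \<chi> k i. \<beta> x $ j $ i * \<gamma> x $ k $ i)))"
      by (intro exI[of _ normal_frame] conjI allI forms parallel_normal_frame[OF nonzero] hyperbolic_tuple_map[OF nonzero])
  qed (auto simp: normal intro: immersion_tuple_map[OF nonzero])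
qed

end

section \<open>From tuples to solutions of the system\<close>

lemma partial_sum:
  assumes "\<And>a. a \<in> I \<Longrightarrow> f a differentiable (at x)"
  shows "partial i (\<lambda>x. \<Sum>a\<in>I. f a x) x = (\<Sum>a\<in>I. partial i (f a) x)"
  using partial_eq[OF has_derivative_sum[of I f "\<lambda>a. frechet_derivative (f a) (at x)"]] assms
  by (simp add: frechet_derivative_works partial_def)

lemmas partial_scaleR = bounded_bilinear.partial_prod[OF bounded_bilinear_scaleR]
lemmas partial_inner = bounded_bilinear.partial_prod[OF bounded_bilinear_inner]

lemma O_n1_iff:
  "B \<in> O_n1 \<longleftrightarrow> (\<forall>a b. (\<Sum>j\<in>UNIV. Jmat $ j $ j * B $ j $ a * B $ j $ b) = Jmat $ a $ b)"
proof -
  have BJ: "(transpose B ** Jmat) $ a $ j = B $ j $ a * Jmat $ j $ j" for a j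
    by (simp add: matrix_matrix_mult_def transpose_def Jmat_def if_distrib[of "\<lambda>b. _ * b"] cong: if_cong)
  have "(transpose B ** Jmat ** B) $ a $ b = (\<Sum>j\<in>UNIV. Jmat $ j $ j * B $ j $ a * B $ j $ b)" for a b
    by (subst matrix_matrix_mult_def) (simp add: BJ mult_ac)
  then show ?thesis by (simp add: O_n1_def vec_eq_iff)
qed

lemma sum_axis_axis_scaleR:
  fixes v :: "'k::finite \<Rightarrow> 'b::real_vector" and i :: "'n::finite"
  shows "(\<Sum>j\<in>UNIV. \<Sum>k\<in>UNIV. (c k j * axis i 1 $ j * axis i 1 $ j) *\<^sub>R v k) = (\<Sum>k\<in>UNIV. c k i *\<^sub>R v k)"
proof -
  have "(\<Sum>k\<in>UNIV. (c k j * axis i 1 $ j * axis i 1 $ j) *\<^sub>R v k) = (if j = i then \<Sum>k\<in>UNIV. c k i *\<^sub>R v k else 0)" for j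
    by (auto simp: axis_def)
  then show ?thesis by simp
qed

context normal_framed_immersion
begin

lemma tangent_eq_zero:
  assumes x: "x \<in> S" and w: "w \<in> tangent_space X x" and orth: "\<And>i. w \<bullet> partial i X x = 0"
  shows "w = 0"
proof -
  obtain v where v: "w = DX x v" using w by (auto simp: tangent_space_def)
  have "w = (\<Sum>i\<in>UNIV. v $ i *\<^sub>R partial i X x)"
    unfolding v by (rule frechet_derivative_eq_sum_partial[OF smooth_on_differentiable[OF smooth_X x]])
  then have "w \<bullet> w = (\<Sum>i\<in>UNIV. v $ i * (w \<bullet> partial i X x))"
    by (metis (no_types, lifting) inner_scaleR_right inner_sum_right sum.cong)
  then show ?thesis using orth by simp
qed

end

section \<open>The common tangent frame of a tuple\<close>

locale diagonal_tuple =
  fixes S :: "(real, 'n::{finite,linorder}) vec set"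
    and X :: "'n \<Rightarrow> (real, 'n) vec \<Rightarrow> (real, 'n + 'k::finite) vec"
    and e :: "'k \<Rightarrow> (real, 'n) vec \<Rightarrow> (real, 'n + 'k) vec"
    and G :: "(real, 'n) vec \<Rightarrow> ((real, 'n) vec, 'k) vec"
    and B :: "(real, 'n) vec \<Rightarrow> ((real, 'n) vec, 'n) vec"
  assumes tuple: "O_n1_tuple_on S X"
    and frames: "\<And>j. parallel_normal_frame_on S (X j) e"
    and smooth_G: "smooth_on S G" and smooth_B: "smooth_on S B"
    and has_forms: "\<And>j. has_forms_on S (X j) e G (\<lambda>x. row j (B x))"
begin

lemma open_S: "open S"
  using tuple by (simp add: O_n1_tuple_on_def O_n1_tuple_core_on_def is_domain_def)

lemma framed_immersion:
  "parallel_normal_frame_on S (X j) e' \<Longrightarrow> parallel_framed_immersion S (X j) e'"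
  using tuple by (intro parallel_framed_immersionI open_S)
    (simp_all add: O_n1_tuple_on_def O_n1_tuple_core_on_def)

sublocale imm: parallel_framed_immersion S "X j" e for j
  by (rule framed_immersion[OF frames])

lemma forms: "diagonal_forms_on S (X j) e (\<lambda>x. row j (B x)) (\<lambda>x. \<chi> k i. - (G x $ k $ i * B x $ j $ i))"
  using has_forms[of j] by (simp add: has_forms_on_def row_def)

lemma nondegenerate: "nondegenerate_normal_bundle_on S (X j)"
  using tuple by (simp add: O_n1_tuple_on_def)

lemma B_nonzero: "x \<in> S \<Longrightarrow> B x $ j $ i \<noteq> 0"
  using imm.metric_nonzero[OF forms, of x j i] by (simp add: row_def)

lemma G_nonzero: "x \<in> S \<Longrightarrow> \<exists>k. G x $ k $ i \<noteq> 0"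
  using imm.nondegenerateD[OF forms nondegenerate, of x first_idx i] by auto

lemma partial_X_inner: "x \<in> S \<Longrightarrow> partial i (X j) x \<bullet> partial l (X j) x = (if i = l then (B x $ j $ i)\<^sup>2 else 0)"
  using imm.partial_X_inner[OF forms, of x i j l] by (simp add: row_def)

lemma partial_X_inner_partial_e:
  "x \<in> S \<Longrightarrow> partial i (X j) x \<bullet> partial l (e k) x = (if i = l then - (G x $ k $ i * B x $ j $ i) else 0)"
  using imm.partial_X_inner_partial_e[OF forms, of x i j l k] by simp

text \<open>The frame is parallel, so the derivative of \<open>e k\<close> is tangent, and the
  second form supplies its components along the orthogonal vectors
  \<open>partial l (X j) x\<close>.\<close>

lemma partial_e_X:
  assumes x: "x \<in> S"
  shows "partial i (e k) x = - (G x $ k $ i / B x $ j $ i) *\<^sub>R partial i (X j) x"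
proof -
  have "partial i (e k) x + (G x $ k $ i / B x $ j $ i) *\<^sub>R partial i (X j) x = 0"
  proof (rule imm.tangent_eq_zero[OF x])
    have "partial i (X j) x \<in> tangent_space (X j) x"
      unfolding partial_def tangent_space_def by (rule rangeI)
    then show "partial i (e k) x + (G x $ k $ i / B x $ j $ i) *\<^sub>R partial i (X j) x \<in> tangent_space (X j) x"
      using imm.De_tangent[OF x, where k=k and v="axis i 1" and j=j]
      by (intro subspace_add imm.subspace_tangent[OF x] subspace_scale) (auto simp: partial_def)
    show "(partial i (e k) x + (G x $ k $ i / B x $ j $ i) *\<^sub>R partial i (X j) x) \<bullet> partial l (X j) x = 0" for l
      using B_nonzero[OF x, of j i]
      by (simp add: inner_add_left partial_X_inner[OF x] inner_commute[of "partial i (e k) x"]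
        partial_X_inner_partial_e[OF x] power2_eq_square)
  qed
  then show ?thesis by (simp add: eq_neg_iff_add_eq_0)
qed

definition E where "E i x = (1 / B x $ first_idx $ i) *\<^sub>R partial i (X first_idx) x"

lemma partial_e: "x \<in> S \<Longrightarrow> partial i (e k) x = - G x $ k $ i *\<^sub>R E i x"
  unfolding E_def using partial_e_X[of x i k first_idx] by simp

text \<open>The unit tangent vectors do not depend on the immersion: by non-degeneracy they can be read off
  from the derivative of some frame field.\<close>

lemma partial_X: "x \<in> S \<Longrightarrow> partial i (X j) x = B x $ j $ i *\<^sub>R E i x"
proof -
  assume x: "x \<in> S"
  obtain k where k: "G x $ k $ i \<noteq> 0" using G_nonzero[OF x] by blast
  have "- (G x $ k $ i / B x $ j $ i) *\<^sub>R partial i (X j) x = - G x $ k $ i *\<^sub>R E i x"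
    using partial_e_X[OF x] partial_e[OF x] by metis
  then have "(G x $ k $ i) *\<^sub>R ((1 / B x $ j $ i) *\<^sub>R partial i (X j) x) = (G x $ k $ i) *\<^sub>R E i x"
    by simp
  then have "E i x = (1 / B x $ j $ i) *\<^sub>R partial i (X j) x"
    using k by (simp only: scaleR_cancel_left) simp
  then show ?thesis using B_nonzero[OF x, of j i] by simp
qed

lemma smooth_entries: "smooth_on S (\<lambda>y. G y $ k $ i)" "smooth_on S (\<lambda>y. B y $ j $ i)"
  by (intro smooth_on_vec_nth open_S smooth_G smooth_B)+

lemma smooth_E: "smooth_on S (E i)"
  unfolding E_def[abs_def] divide_inverse
  by (intro smooth_on_scaleR smooth_on_mult smooth_on_inverse smooth_on_const smooth_entries open_S
    smooth_on_partial imm.smooth_X B_nonzero)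

lemma E_inner: "x \<in> S \<Longrightarrow> E i x \<bullet> E l x = (if i = l then 1 else 0)"
  using B_nonzero[of x first_idx i] by (auto simp: E_def partial_X_inner power2_eq_square)

lemma E_inner_e: "x \<in> S \<Longrightarrow> E i x \<bullet> e k x = 0"
  using imm.e_inner_DX[of x k first_idx "axis i 1"] by (simp add: E_def partial_def inner_commute)

text \<open>The \<open>E a\<close> span the tangent space and the \<open>e k\<close> the normal
  space, so equality can be tested on components. The derivatives of \<open>E\<close> are determined
  in this way.\<close>

lemma frame_eqI:
  assumes x: "x \<in> S" and "\<And>a. w \<bullet> E a x = z \<bullet> E a x" "\<And>k. w \<bullet> e k x = z \<bullet> e k x"
  shows "w = z"
proof -
  have "w - z = 0"
  proof (rule imm.tangent_eq_zero[OF x])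
    show "w - z \<in> tangent_space (X first_idx) x"
      by (rule imm.tangentI[OF x]) (simp add: assms inner_diff_left)
    show "(w - z) \<bullet> partial i (X first_idx) x = 0" for i
      by (simp add: partial_X[OF x] assms inner_diff_left)
  qed
  then show ?thesis by simp
qed

text \<open>\<open>B\<close> and the matrix \<open>\<beta>\<close> of the tuple have the same squared entries; comparing second fundamental
  forms, which do not depend on the frame, shows that their columns agree up to a sign.\<close>

lemma B_O_n1:
  assumes x: "x \<in> S"
  shows "B x \<in> O_n1"
proof -
  obtain e' :: "'k \<Rightarrow> (real, 'n) vec \<Rightarrow> (real, 'n + 'k) vec" and \<beta> \<gamma> where
    frames': "\<And>j. parallel_normal_frame_on S (X j) e'" and \<beta>: "\<beta> x \<in> O_n1"
    and forms': "\<And>j. diagonal_forms_on S (X j) e' (\<lambda>x. row j (\<beta> x)) (\<lambda>x. \<chi> k i. \<beta> x $ j $ i * \<gamma> x $ k $ i)"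
    using tuple x unfolding O_n1_tuple_on_def O_n1_tuple_core_on_def by blast
  \<comment> \<open>In the two frames, \<open>II_j\<close> evaluated twice on the
    \<open>i\<close>-th coordinate vector is \<open>\<beta>_ji P_i\<close> and
    \<open>b_ji Q_i\<close> respectively.\<close>
  define P where "P i = (\<Sum>k\<in>UNIV. \<gamma> x $ k $ i *\<^sub>R e' k x)" for i
  define Q where "Q i = (\<Sum>k\<in>UNIV. - G x $ k $ i *\<^sub>R e k x)" for i
  have PQ: "\<beta> x $ j $ i *\<^sub>R P i = B x $ j $ i *\<^sub>R Q i" for i j
  proof -
    interpret imm': parallel_framed_immersion S "X j" e'
      by (rule framed_immersion[OF frames'])
    have "snd_form (X j) e' x (axis i 1) (axis i 1) = \<beta> x $ j $ i *\<^sub>R P i"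
      using forms'[of j] x unfolding diagonal_forms_on_def
      by (simp add: P_def sum_axis_axis_scaleR scaleR_sum_right)
    moreover have "snd_form (X j) e x (axis i 1) (axis i 1) = B x $ j $ i *\<^sub>R Q i"
      using forms[of j] x unfolding diagonal_forms_on_def
      using sum_axis_axis_scaleR[of "\<lambda>k i. - (G x $ k $ i * B x $ j $ i)" i "\<lambda>k. e k x"]
      by (simp add: Q_def scaleR_sum_right mult.commute)
    ultimately show ?thesis
      using imm.snd_form_eq[OF x, of j] imm'.snd_form_eq[OF x] by simp
  qed
  have sq: "(\<beta> x $ j $ i)\<^sup>2 = (B x $ j $ i)\<^sup>2" for i j
  proof -
    interpret imm': parallel_framed_immersion S "X j" e'
      by (rule framed_immersion[OF frames'])
    show ?thesis
      using imm'.partial_X_inner[OF forms' x, of i i] partial_X_inner[OF x, of i j i] by (simp add: row_def)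
  qed
  have Q: "Q i \<noteq> 0" for i
  proof
    assume "Q i = 0"
    moreover have "Q i \<bullet> e k x = - G x $ k $ i" for k
      unfolding Q_def by (rule imm.sum_inner_e[OF x])
    ultimately show False using G_nonzero[OF x, of i] by simp
  qed
  define s where "s i = \<beta> x $ first_idx $ i / B x $ first_idx $ i" for i
  have s: "\<beta> x $ j $ i = s i * B x $ j $ i" for i j
  proof -
    define s' where "s' j = \<beta> x $ j $ i / B x $ j $ i" for j
    \<comment> \<open>The ratio is the same for all \<open>j\<close>, because it always takes the
      one non-zero vector \<open>P i\<close> to \<open>Q i\<close>.\<close>
    have s': "s' j *\<^sub>R P i = Q i" for j
    proof -
      have "(1 / B x $ j $ i) *\<^sub>R (\<beta> x $ j $ i *\<^sub>R P i) = (1 / B x $ j $ i) *\<^sub>R (B x $ j $ i *\<^sub>R Q i)"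
        using PQ by simp
      then show ?thesis using B_nonzero[OF x, of j i] by (simp add: s'_def)
    qed
    moreover have "P i \<noteq> 0" using Q[of i] s'[of j] by auto
    ultimately have "s' j = s' first_idx" by (metis scaleR_cancel_right)
    then show ?thesis using B_nonzero[OF x, of j i] by (simp add: s_def s'_def field_simps)
  qed
  have ss: "s i * s i = 1" for i
    using sq[of first_idx i] B_nonzero[OF x, of first_idx i] by (simp add: s_def power2_eq_square)
  show ?thesis
    unfolding O_n1_iff
  proof (intro allI)
    fix a b
    have "s a * s b * (\<Sum>j\<in>UNIV. Jmat $ j $ j * B x $ j $ a * B x $ j $ b) = Jmat $ a $ b"
      using \<beta>[unfolded O_n1_iff, rule_format, of a b] by (simp add: s sum_distrib_left mult_ac)
    \<comment> \<open>Multiplying by \<open>s a * s b\<close> once more clears the signs on the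
      left; on the right they disappear because \<open>J\<close> is diagonal.\<close>
    then have "(s a * s a) * (s b * s b) * (\<Sum>j\<in>UNIV. Jmat $ j $ j * B x $ j $ a * B x $ j $ b)
        = s a * s b * Jmat $ a $ b"
      by (simp add: mult_ac)
    also have "\<dots> = Jmat $ a $ b" by (simp add: Jmat_def ss)
    finally show "(\<Sum>j\<in>UNIV. Jmat $ j $ j * B x $ j $ a * B x $ j $ b) = Jmat $ a $ b" by (simp add: ss)
  qed
qed

definition F where
  "F x = (\<chi> i j. if i = j then 0 else partial i (\<lambda>y. B y $ first_idx $ j) x / B x $ first_idx $ i)"

lemma F_nth: "F x $ i $ j = (if i = j then 0 else partial i (\<lambda>y. B y $ first_idx $ j) x / B x $ first_idx $ i)"
  by (simp add: F_def)

lemma smooth_F_nth: "smooth_on S (\<lambda>x. F x $ i $ j)"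
proof (cases "i = j")
  case True
  then show ?thesis by (simp add: F_nth smooth_on_const)
next
  case False
  then show ?thesis
    unfolding F_nth divide_inverse
    by (simp, intro smooth_on_mult smooth_on_inverse smooth_on_partial smooth_entries open_S B_nonzero)
qed

lemma smooth_F: "smooth_on S F"
proof -
  have "smooth_on S (\<lambda>x. \<chi> i j. F x $ i $ j)"
    by (intro smooth_on_vec_lambda smooth_F_nth open_S)
  then show ?thesis by simp
qed

lemma frame_differentiable:
  assumes "x \<in> S"
  shows "E i differentiable (at x)" "e k differentiable (at x)" "partial i (E l) differentiable (at x)"
    "(\<lambda>y. F y $ i $ j) differentiable (at x)" "(\<lambda>y. G y $ k $ j) differentiable (at x)"
    "(\<lambda>y. B y $ i $ j) differentiable (at x)"
  using assms by (auto intro!: smooth_on_differentiable[of S] smooth_E imm.smooth_e smooth_on_partial smooth_F_nth smooth_entries)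

section \<open>Derivatives of the tangent frame\<close>

lemma partial_E_inner_E:
  assumes x: "x \<in> S"
  shows "partial c (E i) x \<bullet> E l x = - (E i x \<bullet> partial c (E l) x)"
proof -
  have "partial c (\<lambda>y. E i y \<bullet> E l y) x = partial c (\<lambda>y. if i = l then 1 else 0) x"
    by (rule partial_cong[OF open_S x]) (simp add: E_inner)
  then show ?thesis
    using partial_inner[OF frame_differentiable(1)[OF x] frame_differentiable(1)[OF x], of c i l]
    by (simp add: partial_def[of c "\<lambda>y. if i = l then 1 else 0"])
qed

lemma partial_E_inner_self: "x \<in> S \<Longrightarrow> partial c (E i) x \<bullet> E i x = 0"
  using partial_E_inner_E[of x c i i] by (simp add: inner_commute)

lemma partial_E_inner_e:
  assumes x: "x \<in> S"
  shows "partial c (E i) x \<bullet> e k x = (if i = c then G x $ k $ i else 0)"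
proof -
  have "partial c (\<lambda>y. E i y \<bullet> e k y) x = partial c (\<lambda>y. 0) x"
    by (rule partial_cong[OF open_S x]) (simp add: E_inner_e)
  then show ?thesis
    using partial_inner[OF frame_differentiable(1)[OF x] frame_differentiable(2)[OF x], of c i k]
    by (simp add: partial_def[of c "\<lambda>y. 0"] partial_e[OF x] E_inner[OF x] split: if_splits)
qed

text \<open>Symmetry of the second derivatives of \<open>X j\<close>. Only the coefficients depend
  on \<open>j\<close>, so each row of \<open>B\<close> gives an equation for the same unknown
  derivatives of \<open>E\<close>.\<close>

lemma commutation:
  assumes x: "x \<in> S"
  shows "B x $ j $ i *\<^sub>R partial l (E i) x + partial l (\<lambda>y. B y $ j $ i) x *\<^sub>R E i x
    = B x $ j $ l *\<^sub>R partial i (E l) x + partial i (\<lambda>y. B y $ j $ l) x *\<^sub>R E l x"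
proof -
  have "partial l (partial i (X j)) x = B x $ j $ i *\<^sub>R partial l (E i) x + partial l (\<lambda>y. B y $ j $ i) x *\<^sub>R E i x" for l i
  proof -
    have "partial l (partial i (X j)) x = partial l (\<lambda>y. B y $ j $ i *\<^sub>R E i y) x"
      by (rule partial_cong[OF open_S x]) (rule partial_X)
    then show ?thesis
      by (simp add: partial_scaleR[OF frame_differentiable(6)[OF x] frame_differentiable(1)[OF x]])
  qed
  then show ?thesis
    using partial_commute[OF open_S imm.smooth_X x, of l i j] by metis
qed

text \<open>Take the \<open>E i\<close> component of \<open>commutation\<close>: the derivative of a
  unit vector is orthogonal to it, so one term remains on each side.\<close>

lemma partial_B_aux:
  assumes x: "x \<in> S" and "i \<noteq> l"
  shows "partial l (\<lambda>y. B y $ j $ i) x = B x $ j $ l * (partial i (E l) x \<bullet> E i x)"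
  using arg_cong[OF commutation[OF x, of j i l], of "\<lambda>w. w \<bullet> E i x"] assms(2)
  by (simp add: inner_add_left partial_E_inner_self[OF x] E_inner[OF x])

text \<open>The case of row 1 in the preceding identity. The right side does not mention an
  immersion, so \<open>F\<close>, though defined by row 1, serves every row of
  \<open>B\<close>.\<close>

lemma F_eq: "x \<in> S \<Longrightarrow> i \<noteq> l \<Longrightarrow> F x $ l $ i = partial i (E l) x \<bullet> E i x"
  using partial_B_aux[of x i l first_idx] B_nonzero[of x first_idx l] by (simp add: F_nth)

lemma partial_B: "x \<in> S \<Longrightarrow> i \<noteq> l \<Longrightarrow> partial l (\<lambda>y. B y $ j $ i) x = F x $ l $ i * B x $ j $ l"
  by (simp add: partial_B_aux F_eq)

text \<open>The unknown components satisfy \<open>p b_ji = q b_jl\<close> for all \<open>j\<close>,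
  so a multiple of column \<open>i\<close> of \<open>B\<close> equals a multiple of column
  \<open>l\<close>. Pairing with column \<open>i\<close> under \<open>J\<close> gives
  \<open>p J_ii = q J_il = 0\<close>.\<close>

lemma partial_E_inner_distinct:
  assumes x: "x \<in> S" and d: "i \<noteq> l" "a \<noteq> i" "a \<noteq> l"
  shows "partial l (E i) x \<bullet> E a x = 0"
proof -
  define p q where "p = partial l (E i) x \<bullet> E a x" and "q = partial i (E l) x \<bullet> E a x"
  have pq: "p * B x $ j $ i = q * B x $ j $ l" for j
    using arg_cong[OF commutation[OF x, of j i l], of "\<lambda>w. w \<bullet> E a x"] d
    by (simp add: inner_add_left E_inner[OF x] p_def q_def mult.commute)
  have "p * Jmat $ i $ i = p * (\<Sum>j\<in>UNIV. Jmat $ j $ j * B x $ j $ i * B x $ j $ i)"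
    using B_O_n1[OF x] unfolding O_n1_iff by simp
  also have "\<dots> = (\<Sum>j\<in>UNIV. Jmat $ j $ j * B x $ j $ i * (p * B x $ j $ i))"
    by (simp add: sum_distrib_left mult_ac)
  also have "\<dots> = q * (\<Sum>j\<in>UNIV. Jmat $ j $ j * B x $ j $ i * B x $ j $ l)"
    unfolding pq by (simp add: sum_distrib_left mult_ac)
  also have "\<dots> = q * Jmat $ i $ l"
    using B_O_n1[OF x] unfolding O_n1_iff by simp
  also have "\<dots> = 0" using d(1) by (simp add: Jmat_def)
  finally show ?thesis by (simp add: p_def Jmat_def split: if_splits)
qed

lemma partial_E_off:
  assumes x: "x \<in> S" and "i \<noteq> l"
  shows "partial i (E l) x = F x $ l $ i *\<^sub>R E i x"
proof (rule frame_eqI[OF x])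
  show "partial i (E l) x \<bullet> e k x = (F x $ l $ i *\<^sub>R E i x) \<bullet> e k x" for k
    using assms(2) by (simp add: partial_E_inner_e[OF x] E_inner_e[OF x])
  show "partial i (E l) x \<bullet> E a x = (F x $ l $ i *\<^sub>R E i x) \<bullet> E a x" for a
  proof (cases "a = i \<or> a = l")
    case True
    then show ?thesis
      using assms(2) by (auto simp: F_eq[OF x] E_inner[OF x] partial_E_inner_self[OF x])
  next
    case False
    then show ?thesis
      using partial_E_inner_distinct[OF x, of l i a] assms(2) by (auto simp: E_inner[OF x])
  qed
qed

lemma partial_E_inner_dir: "x \<in> S \<Longrightarrow> partial i (E a) x \<bullet> E i x = F x $ a $ i"
  by (cases "a = i") (auto simp: partial_E_inner_self F_nth[of _ i i] F_eq)

text \<open>Differentiated orthonormality yields every component from known ones: the tangential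
  ones from \<open>partial_E_inner_dir\<close>, the normal ones from the derivatives of the
  \<open>e k\<close>.\<close>

lemma partial_E_diag:
  assumes x: "x \<in> S"
  shows "partial i (E i) x = (\<Sum>k\<in>UNIV. G x $ k $ i *\<^sub>R e k x) - (\<Sum>a\<in>UNIV. F x $ a $ i *\<^sub>R E a x)"
proof (rule frame_eqI[OF x])
  have e: "(\<Sum>k\<in>UNIV. G x $ k $ i *\<^sub>R e k x) \<bullet> e l x = G x $ l $ i" for l
    by (rule imm.sum_inner_e[OF x])
  have E: "(\<Sum>a\<in>UNIV. F x $ a $ i *\<^sub>R E a x) \<bullet> E l x = F x $ l $ i" for l
    by (simp add: inner_sum_left E_inner[OF x] if_distrib[of "\<lambda>b. _ * b"] cong: if_cong)
  have eE: "(\<Sum>k\<in>UNIV. G x $ k $ i *\<^sub>R e k x) \<bullet> E l x = 0" "(\<Sum>a\<in>UNIV. F x $ a $ i *\<^sub>R E a x) \<bullet> e k x = 0" for l k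
    by (simp_all add: inner_sum_left E_inner_e[OF x] inner_commute[of "e _ x"])
  show "partial i (E i) x \<bullet> e l x
    = ((\<Sum>k\<in>UNIV. G x $ k $ i *\<^sub>R e k x) - (\<Sum>a\<in>UNIV. F x $ a $ i *\<^sub>R E a x)) \<bullet> e l x" for l
    by (simp add: inner_diff_left e eE partial_E_inner_e[OF x])
  show "partial i (E i) x \<bullet> E l x
    = ((\<Sum>k\<in>UNIV. G x $ k $ i *\<^sub>R e k x) - (\<Sum>a\<in>UNIV. F x $ a $ i *\<^sub>R E a x)) \<bullet> E l x" for l
    using partial_E_inner_E[OF x, of i i l] partial_E_inner_dir[OF x, of i l]
    by (simp add: inner_diff_left E eE inner_commute[of "E i x"])
qed

section \<open>Codazzi and Gauss equations\<close>

lemma partial_G: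
  assumes x: "x \<in> S" and il: "i \<noteq> l"
  shows "partial l (\<lambda>y. G y $ k $ i) x = F x $ l $ i * G x $ k $ l"
proof -
  \<comment> \<open>The \<open>E i\<close> components of the two mixed derivatives of
    \<open>e k\<close>; equating them gives the Codazzi equation.\<close>
  have D: "partial l (partial i (e k)) x \<bullet> E i x
      = - (G x $ k $ i * (partial l (E i) x \<bullet> E i x)) - partial l (\<lambda>y. G y $ k $ i) x"
    "partial i (partial l (e k)) x \<bullet> E i x
      = - (G x $ k $ l * (partial i (E l) x \<bullet> E i x))"
  proof -
    have m: "partial l (partial i (e k)) x
      = - (G x $ k $ i *\<^sub>R partial l (E i) x + partial l (\<lambda>y. G y $ k $ i) x *\<^sub>R E i x)" for l i
    proof -
      have "partial l (partial i (e k)) x = partial l (\<lambda>y. - (G y $ k $ i *\<^sub>R E i y)) x"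
        by (rule partial_cong[OF open_S x]) (simp add: partial_e)
      also have "\<dots> = - partial l (\<lambda>y. G y $ k $ i *\<^sub>R E i y) x"
        by (rule bounded_linear.partial_compose[OF bounded_linear_minus[OF bounded_linear_ident]])
          (intro differentiable_scaleR frame_differentiable x)
      finally show ?thesis
        by (simp add: partial_scaleR[OF frame_differentiable(5)[OF x] frame_differentiable(1)[OF x]])
    qed
    show "partial l (partial i (e k)) x \<bullet> E i x
      = - (G x $ k $ i * (partial l (E i) x \<bullet> E i x)) - partial l (\<lambda>y. G y $ k $ i) x"
      "partial i (partial l (e k)) x \<bullet> E i x = - (G x $ k $ l * (partial i (E l) x \<bullet> E i x))"
      using il by (simp_all add: m inner_diff_left inner_add_left E_inner[OF x])
  qed
  then show ?thesis
    using partial_commute[OF open_S imm.smooth_e x, of l i k] il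
    by (simp add: partial_E_inner_self[OF x] partial_E_inner_dir[OF x] mult.commute)
qed

lemma partial_partial_E_off:
  assumes x: "x \<in> S" and "i \<noteq> l"
  shows "partial a (partial i (E l)) x = F x $ l $ i *\<^sub>R partial a (E i) x + partial a (\<lambda>y. F y $ l $ i) x *\<^sub>R E i x"
proof -
  have "partial a (partial i (E l)) x = partial a (\<lambda>y. F y $ l $ i *\<^sub>R E i y) x"
    by (rule partial_cong[OF open_S x]) (simp add: partial_E_off assms)
  then show ?thesis
    by (simp add: partial_scaleR[OF frame_differentiable(4)[OF x] frame_differentiable(1)[OF x]])
qed

text \<open>Equate the \<open>E i\<close> components of the mixed derivatives of \<open>E l\<close>
  in the directions \<open>a\<close> and \<open>i\<close>, both different from
  \<open>l\<close>.\<close>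

lemma partial_F:
  assumes x: "x \<in> S" and d: "l \<noteq> i" "i \<noteq> a" "l \<noteq> a"
  shows "partial a (\<lambda>y. F y $ l $ i) x = F x $ l $ a * F x $ a $ i"
proof -
  have "partial a (partial i (E l)) x \<bullet> E i x = partial a (\<lambda>y. F y $ l $ i) x"
    using d by (simp add: partial_partial_E_off[OF x] inner_add_left partial_E_inner_self[OF x] E_inner[OF x])
  moreover have "partial i (partial a (E l)) x \<bullet> E i x = F x $ l $ a * F x $ a $ i"
    using d by (simp add: partial_partial_E_off[OF x] inner_add_left partial_E_inner_dir[OF x] E_inner[OF x])
  ultimately show ?thesis
    using partial_commute[OF open_S smooth_E x, of a i l] by simp
qed

text \<open>Again the \<open>E i\<close> component of mixed derivatives of \<open>E l\<close>, now
  with \<open>l\<close> itself as one direction: \<open>partial_E_diag\<close> brings in the sums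
  over all tangent and normal directions.\<close>

lemma gauss_equation:
  assumes x: "x \<in> S" and d: "l \<noteq> i"
  shows "partial l (\<lambda>y. F y $ l $ i) x + partial i (\<lambda>y. F y $ i $ l) x
    + (\<Sum>a\<in>UNIV. F x $ a $ l * F x $ a $ i) + (\<Sum>k\<in>UNIV. G x $ k $ l * G x $ k $ i) = 0"
proof -
  have "partial l (partial i (E l)) x \<bullet> E i x = partial l (\<lambda>y. F y $ l $ i) x"
    using d by (simp add: partial_partial_E_off[OF x] inner_add_left partial_E_inner_self[OF x] E_inner[OF x])
  moreover have "partial i (partial l (E l)) x \<bullet> E i x = - partial i (\<lambda>y. F y $ i $ l) x
    - (\<Sum>a\<in>UNIV. F x $ a $ l * F x $ a $ i) - (\<Sum>k\<in>UNIV. G x $ k $ l * G x $ k $ i)"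
  proof -
    \<comment> \<open>The minus sign is moved into the coefficients so that both sums have the shape
      of the product rule.\<close>
    have "partial i (partial l (E l)) x
      = partial i (\<lambda>y. (\<Sum>k\<in>UNIV. G y $ k $ l *\<^sub>R e k y) + (\<Sum>a\<in>UNIV. (- F y $ a $ l) *\<^sub>R E a y)) x"
      by (rule partial_cong[OF open_S x]) (simp add: partial_E_diag sum_negf)
    also have "\<dots> = (\<Sum>k\<in>UNIV. G x $ k $ l *\<^sub>R partial i (e k) x + partial i (\<lambda>y. G y $ k $ l) x *\<^sub>R e k x)
      + (\<Sum>a\<in>UNIV. - F x $ a $ l *\<^sub>R partial i (E a) x + partial i (\<lambda>y. - F y $ a $ l) x *\<^sub>R E a x)"
      by (subst partial_add, (intro differentiable_sum differentiable_scaleR differentiable_minus frame_differentiable x ballI finite)+,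
        subst partial_sum, (intro differentiable_scaleR differentiable_minus frame_differentiable x)+,
        subst partial_sum, (intro differentiable_scaleR differentiable_minus frame_differentiable x)+,
        subst partial_scaleR, (intro differentiable_minus frame_differentiable x)+,
        subst partial_scaleR, (intro differentiable_minus frame_differentiable x)+) simp
    finally have "partial i (partial l (E l)) x \<bullet> E i x = (\<Sum>k\<in>UNIV. - (G x $ k $ l * G x $ k $ i))
      + (\<Sum>a\<in>UNIV. - (F x $ a $ l * F x $ a $ i) + partial i (\<lambda>y. - F y $ a $ l) x * (if a = i then 1 else 0))"
      by (simp add: inner_add_left inner_diff_left inner_sum_left partial_e[OF x] partial_E_inner_dir[OF x] E_inner[OF x]
        E_inner_e[OF x] inner_commute[of "e _ x"])
    moreover have "partial i (\<lambda>y. - F y $ i $ l) x = - partial i (\<lambda>y. F y $ i $ l) x"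
      by (rule bounded_linear.partial_compose[OF bounded_linear_minus[OF bounded_linear_ident]])
        (rule frame_differentiable[OF x])
    ultimately show ?thesis
      by (simp add: sum_negf sum.distrib sum_subtractf if_distrib[of "\<lambda>b. _ * b"] cong: if_cong)
  qed
  ultimately show ?thesis
    using partial_commute[OF open_S smooth_E x, of l i l] by simp
qed

lemma system: "G1_system_II S F G B"
  unfolding G1_system_II_def
proof (intro conjI ballI allI impI smooth_F smooth_G smooth_B)
  fix x assume x: "x \<in> S"
  show "F x \<in> gl_star" by (simp add: gl_star_def F_nth)
  show "B x \<in> O_n1" by (rule B_O_n1[OF x])
qed (auto intro: gauss_equation simp: partial_F partial_B partial_G)

end

theorem theorem7p4:
  fixes F :: "real^('n::{finite,linorder}) \<Rightarrow> real^('n::{finite,linorder})^('n::{finite,linorder})"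
    and G :: "real^('n::{finite,linorder}) \<Rightarrow> real^('n::{finite,linorder})^('k::finite)"
    and B :: "real^('n::{finite,linorder}) \<Rightarrow> real^('n::{finite,linorder})^('n::{finite,linorder})"
  shows
   "(G1_system_II UNIV F G B \<longrightarrow>
      ((\<forall>x v. omega_form F G x v \<in> so_alg) \<and>
       flat_connection_on UNIV (omega_form F G) \<and>
       (\<exists>A. is_orthogonal_trivialization (omega_form F G) A))
      \<and>
      (\<forall>A. is_orthogonal_trivialization (omega_form F G) A \<longrightarrow>
        exact_on UNIV (\<lambda>x v. \<Sum>i\<in>UNIV. v $ i *\<^sub>R
            (left_block (A x) ** Cmat i ** Jmat ** matrix_inv (B x))) \<and>
        (\<exists>X. \<forall>x. (X has_derivative (\<lambda>v. - (\<Sum>i\<in>UNIV. v $ i *\<^sub>R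
            (left_block (A x) ** Cmat i ** transpose (B x) ** Jmat)))) (at x)) \<and>
        (\<forall>X. (\<forall>x. (X has_derivative (\<lambda>v. - (\<Sum>i\<in>UNIV. v $ i *\<^sub>R
            (left_block (A x) ** Cmat i ** transpose (B x) ** Jmat)))) (at x)) \<longrightarrow>
          (\<forall>j. (\<forall>x i. B x $ j $ i \<noteq> 0) \<longrightarrow>
             immersion_on UNIV (\<lambda>x. column j (X x)) \<and>
             parallel_normal_frame_on UNIV (\<lambda>x. column j (X x)) (\<lambda>k x. column (Inr k) (A x)) \<and>
             has_forms_on UNIV (\<lambda>x. column j (X x)) (\<lambda>k x. column (Inr k) (A x)) G
               (\<lambda>x. (Jmat $ j $ j) *\<^sub>R row j (B x))) \<and>
          ((\<forall>x j i. B x $ j $ i \<noteq> 0) \<longrightarrow>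
             O_n1_tuple_core_on UNIV (\<lambda>j x. column j (X x)) \<and>
             ((\<forall>x. rank (G x) = CARD('n)) \<longrightarrow>
                O_n1_tuple_on UNIV (\<lambda>j x. column j (X x)))))))
    \<and>
    (\<forall>(S :: (real^('n::{finite,linorder})) set) (X :: ('n::{finite,linorder}) \<Rightarrow> real^('n::{finite,linorder}) \<Rightarrow> real^(('n::{finite,linorder}) + ('k::finite))) e
       (G' :: real^('n::{finite,linorder}) \<Rightarrow> real^('n::{finite,linorder})^('k::finite)) (B' :: real^('n::{finite,linorder}) \<Rightarrow> real^('n::{finite,linorder})^('n::{finite,linorder})).
      O_n1_tuple_on S X \<and>
      (\<forall>j. parallel_normal_frame_on S (X j) (e :: ('k::finite) \<Rightarrow> real^('n::{finite,linorder}) \<Rightarrow> real^(('n::{finite,linorder}) + ('k::finite)))) \<and>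
      smooth_on S G' \<and> smooth_on S B' \<and>
      (\<forall>j. has_forms_on S (X j) e G' (\<lambda>x. row j (B' x))) \<longrightarrow>
      G1_system_II S
        (\<lambda>x. \<chi> i j. if i = j then 0
                    else partial i (\<lambda>y. B' y $ first_idx $ j) x / B' x $ first_idx $ i)
        G' B')"
proof -
  let "(_ \<longrightarrow> ?direct) \<and> _" = ?thesis
  have direct: ?direct
    if sys: "G1_system_II UNIV F G B"
  proof (intro conjI allI impI)
    interpret G1_system F G B by unfold_locales (rule sys)
    show "omega_form F G x v \<in> so_alg" for x v by (rule omega_form_so)
    show "flat_connection_on UNIV (omega_form F G)" by (rule flat_connection_omega_form)
    show "\<exists>A. is_orthogonal_trivialization (omega_form F G) A" by (rule trivialization_omega_form)
    fix A assume A: "is_orthogonal_trivialization (omega_form F G) A"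
    interpret G1_trivialization F G B A by unfold_locales (rule A)
    show "exact_on UNIV (\<lambda>x v. \<Sum>i\<in>UNIV. v $ i *\<^sub>R
        (left_block (A x) ** Cmat i ** Jmat ** matrix_inv (B x)))"
      using exact_tuple_form unfolding tuple_form_eq_inv[abs_def] .
    \<comment> \<open>A primitive of the form; the required \<open>X\<close> is its
      negative.\<close>
    obtain Y where "(Y has_derivative tuple_form A x) (at x)" for x
      using exact_tuple_form by (auto simp: exact_on_def)
    from has_derivative_minus[OF this]
    show "\<exists>X. \<forall>x. (X has_derivative (\<lambda>v. - (\<Sum>i\<in>UNIV. v $ i *\<^sub>R
        (left_block (A x) ** Cmat i ** transpose (B x) ** Jmat)))) (at x)"
      unfolding tuple_form_def by blast
    fix X assume X: "\<forall>x. (X has_derivative (\<lambda>v. - (\<Sum>i\<in>UNIV. v $ i *\<^sub>R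
        (left_block (A x) ** Cmat i ** transpose (B x) ** Jmat)))) (at x)"
    interpret G1_tuple F G B A X
      by unfold_locales (use X in \<open>simp add: tuple_form_def\<close>)
    {
      fix j assume nz: "\<forall>x i. B x $ j $ i \<noteq> 0"
      show "immersion_on UNIV (\<lambda>x. column j (X x))"
        by (rule immersion_tuple_map) (use nz in blast)
      show "parallel_normal_frame_on UNIV (\<lambda>x. column j (X x)) (\<lambda>k x. column (Inr k) (A x))"
        by (rule parallel_normal_frame) (use nz in blast)
      \<comment> \<open>The signed row enters both forms: squaring removes the sign from the metric,
        while the second form keeps it.\<close>
      show "has_forms_on UNIV (\<lambda>x. column j (X x)) (\<lambda>k x. column (Inr k) (A x)) G
          (\<lambda>x. (Jmat $ j $ j) *\<^sub>R row j (B x))"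
        using forms_tuple_map[of j] nz by (simp add: has_forms_on_def row_def)
    }
    assume nz: "\<forall>x j i. B x $ j $ i \<noteq> 0"
    show core: "O_n1_tuple_core_on UNIV (\<lambda>j x. column j (X x))"
      by (rule tuple_core) (use nz in blast)
    assume "\<forall>x. rank (G x) = CARD('n)"
    then show "O_n1_tuple_on UNIV (\<lambda>j x. column j (X x))"
      unfolding O_n1_tuple_on_def using core nondegenerate_tuple_map nz by blast
  qed
  have converse: "G1_system_II S
        (\<lambda>x. \<chi> i j. if i = j then 0
                    else partial i (\<lambda>y. B' y $ first_idx $ j) x / B' x $ first_idx $ i)
        G' B'"
    if "O_n1_tuple_on S X" "\<And>j. parallel_normal_frame_on S (X j) e" "smooth_on S G'" "smooth_on S B'"
      "\<And>j. has_forms_on S (X j) e G' (\<lambda>x. row j (B' x))"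
    for S :: "(real, 'n) vec set" and X :: "'n \<Rightarrow> (real, 'n) vec \<Rightarrow> (real, 'n + 'k) vec"
      and e :: "'k \<Rightarrow> (real, 'n) vec \<Rightarrow> (real, 'n + 'k) vec" and G' B'
  proof -
    interpret diagonal_tuple S X e G' B'
      by unfold_locales (rule that)+
    show ?thesis using system unfolding F_def[abs_def] .
  qed
  show ?thesis
    using direct converse by blast
qed

end
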